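(* Let $n\geq 6$ and let $\pi=(d_1,d_2,\dots,d_n)$ be a graphic sequence with $d_1\geq d_2\geq\cdots\geq d_n\geq 1$. Then $\pi$ is potentially $(K_6-C_6)$-graphic if and only if all of the following conditions hold: (1) $d_6\geq 3$; (2) for $i=1,2$, $d_1=n-i$ implies $d_{4-i}\geq 4$; (3) $d_2=n-1$ implies $d_4\geq 4$; (4) for every $i$ with $3\leq i\leq n-4$: if $d_1+d_2=2n-i$ and $d_{n-i+3}=1$, then $d_4\geq 4$; (5) for every $i$ with $4\leq i\leq n-3$: if $d_1+d_2=2n-i$ and $d_{n-i+4}=1$, then $d_3\geq 4$; (6) if $\pi=(d_1,d_2,d_3,3^k,2^t,1^{n-3-k-t})$ for some $k,t\ge 0$, then $d_1+d_2+d_3\leq n+2k+t+1$; (7) if $\pi=(d_1,d_2,3^4,2^t,1^{n-6-t})$ for some $t\ge 0$, then $d_1+d_2\leq n+t+2$; (8) $\pi\neq(n-i,k,t,3^t,2^{k-i-t-1},1^{n-2-k+i})$ for all $i=1,\dots,\lfloor\frac{n-t-1}{2}\rfloor$, $k=i+t+1,\dots,n-i$ and $t=4,5,\dots,k-i-1$; (9) $\pi$ is none of the sequences $(3^6,2)$, $(4^2,3^6)$, $(4,3^6,2)$, $(3^6,2^2)$, $(3^8)$, $(3^7,1)$, $(4,3^8)$, $(4,3^7,1)$, $(3^8,2)$, $(3^7,2,1)$, $(3^9,1)$, $(3^8,1^2)$, $(n-1,4^2,3^4,1^{n-7})$, $(n-1,4^2,3^5,1^{n-8})$, $(n-2,4,3^5,1^{n-7})$,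 $(n-2,4,3^6,1^{n-8})$, $(n-3,3^6,1^{n-7})$, $(n-3,3^7,1^{n-8})$.
   Context: All graphs are finite and simple. A sequence of nonnegative integers is graphic if it is the degree sequence of some simple graph, called a realization of it. For a graph $H$, a graphic sequence $\pi$ is potentially $H$-graphic if some realization of $\pi$ contains $H$ as a subgraph. In a sequence, $r^t$ denotes $t$ consecutive terms equal to $r$ (zero repetitions allowed). $K_6-C_6$ denotes the graph obtained from the complete graph $K_6$ by deleting the edges of a Hamiltonian cycle $C_6$ (a 3-regular graph on 6 vertices). $\lfloor x\rfloor$ is the largest integer at most $x$. *)

theory Defs
  imports "Graph_Theory.Graph_Theory" "HOL-Library.Multiset"
begin

text \<open>
  A finite simple graph is a \<^const>\<open>pair_graph\<close>: an undirected edge between \<open>u\<close> and \<open>v\<close> is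
  represented by the two arcs \<open>(u, v)\<close> and \<open>(v, u)\<close>, so the degree of \<open>v\<close> is its out-degree.
  Realizations have vertices in \<^typ>\<open>nat\<close>, which loses nothing because every finite graph is
  isomorphic to such a graph. The order of the terms of the sequence is irrelevant here.
\<close>

definition realization :: "nat pair_pre_digraph \<Rightarrow> nat list \<Rightarrow> bool" where
  "realization G \<pi> \<longleftrightarrow>
     pair_graph G \<and>
     mset \<pi> = image_mset (out_degree (with_proj G)) (mset_set (pverts G))"

definition graphic :: "nat list \<Rightarrow> bool" where
  "graphic \<pi> \<longleftrightarrow> (\<exists>G. realization G \<pi>)"

text \<open>Containment is up to isomorphism, and the subgraph need not be induced.\<close>

definition contains_subgraph :: "nat pair_pre_digraph \<Rightarrow> 'a pair_pre_digraph \<Rightarrow> bool" where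
  "contains_subgraph G H \<longleftrightarrow>
     (\<exists>S :: nat pair_pre_digraph.
        subgraph (with_proj S) (with_proj G) \<and> digraph_iso (with_proj H) (with_proj S))"

definition potentially_graphic :: "'a pair_pre_digraph \<Rightarrow> nat list \<Rightarrow> bool" where
  "potentially_graphic H \<pi> \<longleftrightarrow> (\<exists>G. realization G \<pi> \<and> contains_subgraph G H)"

definition K6_minus_C6 :: "nat pair_pre_digraph" where
  "K6_minus_C6 =
     \<lparr> pverts = {0..<6},
       parcs = {(u, v). u \<in> {0..<6} \<and> v \<in> {0..<6} \<and> u \<noteq> v}
             - {(u, v). v = (u + 1) mod 6 \<or> u = (v + 1) mod 6} \<rparr>"

lemma pair_graph_K6_minus_C6: "pair_graph K6_minus_C6"
proof -
  have "finite (parcs K6_minus_C6)"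
    by (rule finite_subset[of _ "{0..<6} \<times> {0..<6}"]) (auto simp: K6_minus_C6_def)
  then show ?thesis
    by unfold_locales (auto simp: K6_minus_C6_def symmetric_def sym_def)
qed

lemma out_degree_K6_minus_C6:
  assumes "v \<in> pverts K6_minus_C6"
  shows "out_degree (with_proj K6_minus_C6) v = 3"
proof -
  have v: "v < 6"
    using assms by (simp add: K6_minus_C6_def)
  have "out_arcs (with_proj K6_minus_C6) v =
      Pair v ` set (filter (\<lambda>w. v \<noteq> w \<and> w \<noteq> (v + 1) mod 6 \<and> v \<noteq> (w + 1) mod 6) [0..<6])"
    using v by (auto simp: out_arcs_def K6_minus_C6_def)
  then have "out_degree (with_proj K6_minus_C6) v =
      length (filter (\<lambda>w. v \<noteq> w \<and> w \<noteq> (v + 1) mod 6 \<and> v \<noteq> (w + 1) mod 6) [0..<6])"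
    unfolding out_degree_def
    by (subst distinct_card[symmetric]) (simp_all add: card_image inj_on_def del: set_filter)
  moreover have "v = 0 \<or> v = 1 \<or> v = 2 \<or> v = 3 \<or> v = 4 \<or> v = 5"
    using v by linarith
  ultimately show ?thesis
    by (elim disjE) (simp_all add: upt_rec)
qed

end

theory Submission
  imports Defs
begin

text \<open>
  The graph \<open>K\<^sub>6 - C\<^sub>6\<close> is the triangular prism. Attaching a new vertex keeps a prism, so a sequence
  is potentially prism-graphic as soon as this holds for a sequence obtained by deleting a term
  \<open>r\<close> and decreasing \<open>r\<close> other terms by one.

  If \<open>d\<^sub>4 \<ge> 4\<close> and \<open>d\<^sub>6 \<ge> 3\<close>, every graphic sequence has a realization with a prism: by the
  Kleitman-Wang theorem one deletes the smallest term and decreases the largest ones, and either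
  the assumptions persist or the fourth term drops to 3.

  If \<open>d\<^sub>4 = d\<^sub>6 = 3\<close>, the sequence is \<open>a, b, c, 3^k, 2^t, 1^m\<close>. A switch moves a prism onto the vertices
  of degrees \<open>a, b, c\<close>; the other three prism vertices then have no further edges. Since three
  vertices of a prism are never pairwise non-adjacent, at most two further edges join the three
  large vertices, and counting the edges to the remaining vertices gives the inequalities and
  excludes the sporadic sequences. Conversely every sequence that satisfies these inequalities and
  is not sporadic arises from a shorter one of the same kind by attaching a vertex, down to six
  vertices.
\<close>

section \<open>Graphs and degree-preserving exchanges\<close>

text \<open>Origin of the constants: with the prism on the vertices of degrees \<open>a\<close>,
  \<open>b\<close>, \<open>c\<close>, each of these spends three edges in it, and outside lie
  \<open>k - 3\<close> vertices of degree 3, \<open>t\<close> of degree 2 and \<open>m\<close> of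
  degree 1. They absorb at most \<open>2(k - 3) + 2t + m\<close> edges from two large vertices and
  \<open>3(k - 3) + 2t + m\<close> from three. The extra edges among the large vertices add at most
  3 to \<open>a + b\<close>, where 3 needs one at the third vertex and so \<open>c \<ge> 4\<close>,
  and at most 4 to \<open>a + b + c\<close>. These bounds ignore that the outside vertices must be
  completed among themselves; in the sporadic sequences there are too few of them for that. The
  exceptions are the obstacle in both inductions: a smaller sequence may be sporadic or break a
  bound although the given one does not. When the fourth term is 3, a removed vertex is therefore
  offered several choices of neighbours, one of which avoids the exceptions. When it is at least 4,
  the largest terms serve as neighbours throughout, and the sequences for which this runs into an
  exception are realized by separate constructions. Parity of the degree sum settles several
  borderline cases.\<close>

definition sgraph :: "'a set \<Rightarrow> ('a \<times> 'a) set \<Rightarrow> bool" where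
  "sgraph V E \<longleftrightarrow> finite V \<and> E \<subseteq> V \<times> V \<and> sym E \<and> irrefl E"

definition deg :: "('a \<times> 'a) set \<Rightarrow> 'a \<Rightarrow> nat" where
  "deg E v = card (E `` {v})"

definition degs :: "'a set \<Rightarrow> ('a \<times> 'a) set \<Rightarrow> nat multiset" where
  "degs V E = image_mset (deg E) (mset_set V)"

lemma sgraph_finite_nbrs:
  assumes "sgraph V E" shows "finite (E `` {v})"
proof (rule finite_subset)
  show "E `` {v} \<subseteq> V" "finite V" using assms unfolding sgraph_def by auto
qed

lemma sgraph_sym: "sgraph V E \<Longrightarrow> (x, y) \<in> E \<Longrightarrow> (y, x) \<in> E"
  unfolding sgraph_def sym_def by blast

lemma sgraph_irrefl: "sgraph V E \<Longrightarrow> (x, x) \<notin> E"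
  unfolding sgraph_def irrefl_def by blast

lemma sgraph_mem: "sgraph V E \<Longrightarrow> (x, y) \<in> E \<Longrightarrow> x \<in> V \<and> y \<in> V"
  unfolding sgraph_def by blast

text \<open>
  Both the Kleitman-Wang switch and the replacement of a vertex of a prism are instances of this
  exchange of private neighbours of \<open>u\<close> and \<open>w\<close>.
\<close>

definition exchange ::
  "('a \<times> 'a) set \<Rightarrow> 'a \<Rightarrow> 'a \<Rightarrow> 'a set \<Rightarrow> 'a set \<Rightarrow> ('a \<times> 'a) set" where
  "exchange E u w Q Z =
     (E - ({u} \<times> Q \<union> Q \<times> {u} \<union> {w} \<times> Z \<union> Z \<times> {w})) \<union>
     ({w} \<times> Q \<union> Q \<times> {w} \<union> {u} \<times> Z \<union> Z \<times> {u})"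

text \<open>\<open>Q\<close> and \<open>Z\<close> contain no common neighbours, so no edge is
  doubled, and avoid \<open>w\<close> and \<open>u\<close> respectively, so no loop arises.\<close>

locale exchangeable =
  fixes V :: "'a set" and E u w Q Z
  assumes graph: "sgraph V E" and ne: "u \<noteq> w" and wV: "w \<in> V"
    and Q: "Q \<subseteq> E `` {u} - E `` {w} - {w}"
    and Z: "Z \<subseteq> E `` {w} - E `` {u} - {u}"
    and eq: "card Q = card Z"
begin

lemma sgraph_exchange: "u \<in> V \<Longrightarrow> sgraph V (exchange E u w Q Z)"
proof -
  assume uV: "u \<in> V"
  have QZ: "Q \<subseteq> V" "Z \<subseteq> V" "u \<notin> Z" "w \<notin> Q" "u \<notin> Q" "w \<notin> Z"
    using Q Z graph unfolding sgraph_def irrefl_def by auto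
  show ?thesis
    unfolding sgraph_def
  proof (intro conjI)
    show "finite V" using graph by (simp add: sgraph_def)
    show "exchange E u w Q Z \<subseteq> V \<times> V"
      using QZ uV wV graph unfolding exchange_def sgraph_def by auto
    show "sym (exchange E u w Q Z)"
      using graph unfolding exchange_def sgraph_def sym_def by auto
    show "irrefl (exchange E u w Q Z)"
      using graph QZ unfolding exchange_def sgraph_def irrefl_def by auto
  qed
qed

text \<open>A vertex of \<open>Q\<close> swaps its neighbour \<open>u\<close> for \<open>w\<close>,
  one of \<open>Z\<close> swaps \<open>w\<close> for \<open>u\<close>, and \<open>u\<close> and
  \<open>w\<close> themselves trade sets of equal size. No other vertex sees the change.\<close>

lemma deg_exchange: "deg (exchange E u w Q Z) y = deg E y"
proof -
  have QZ: "u \<notin> Z" "w \<notin> Q" "u \<notin> Q" "w \<notin> Z" "Q \<inter> Z = {}"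
    using Q Z graph unfolding sgraph_def irrefl_def by auto
  have fin: "finite (E `` {v})" for v by (rule sgraph_finite_nbrs[OF graph])
  have finQ: "finite Q" "finite Z"
    using Q Z fin by (meson finite_Diff finite_subset)+
  have sy: "(a, b) \<in> E \<longleftrightarrow> (b, a) \<in> E" for a b
    using sgraph_sym[OF graph] by blast
  consider (u) "y = u" | (w) "y = w" | (q) "y \<in> Q" "y \<noteq> u" "y \<noteq> w"
    | (z) "y \<in> Z" "y \<noteq> u" "y \<noteq> w" | (o) "y \<notin> Q" "y \<notin> Z" "y \<noteq> u" "y \<noteq> w" by blast
  then show ?thesis
  proof cases
    case u
    have "exchange E u w Q Z `` {y} = (E `` {u} - Q) \<union> Z"
      unfolding exchange_def u using QZ ne by auto
    moreover have "card ((E `` {u} - Q) \<union> Z) = card (E `` {u} - Q) + card Z"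
      by (rule card_Un_disjoint) (use fin finQ Z in auto)
    moreover have "card (E `` {u} - Q) = card (E `` {u}) - card Q"
      by (rule card_Diff_subset) (use finQ Q in auto)
    moreover have "card Q \<le> card (E `` {u})"
      by (rule card_mono) (use fin Q in auto)
    ultimately show ?thesis unfolding deg_def u using eq by simp
  next
    case w
    have "exchange E u w Q Z `` {y} = (E `` {w} - Z) \<union> Q"
      unfolding exchange_def w using QZ ne by auto
    moreover have "card ((E `` {w} - Z) \<union> Q) = card (E `` {w} - Z) + card Q"
      by (rule card_Un_disjoint) (use fin finQ Q in auto)
    moreover have "card (E `` {w} - Z) = card (E `` {w}) - card Z"
      by (rule card_Diff_subset) (use finQ Z in auto)
    moreover have "card Z \<le> card (E `` {w})"
      by (rule card_mono) (use fin Z in auto)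
    ultimately show ?thesis unfolding deg_def w using eq by simp
  next
    case q
    have "exchange E u w Q Z `` {y} = insert w (E `` {y} - {u})"
      unfolding exchange_def using q QZ ne by auto
    moreover have "u \<in> E `` {y}" "w \<notin> E `` {y}"
      using q Q sy by auto
    ultimately show ?thesis unfolding deg_def using fin[of y] card.remove[of "E `` {y}" u]
      by (simp add: card_insert_if)
  next
    case z
    have "exchange E u w Q Z `` {y} = insert u (E `` {y} - {w})"
      unfolding exchange_def using z QZ ne by auto
    moreover have "w \<in> E `` {y}" "u \<notin> E `` {y}"
      using z Z sy by auto
    ultimately show ?thesis unfolding deg_def using fin[of y] card.remove[of "E `` {y}" w]
      by (simp add: card_insert_if)
  next
    case o
    have "exchange E u w Q Z `` {y} = E `` {y}"
      unfolding exchange_def using o by auto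
    then show ?thesis unfolding deg_def by simp
  qed
qed

end

text \<open>Common neighbours cancel when the degrees are compared, and so does an edge between
  \<open>u\<close> and \<open>w\<close>, which counts once on each side. Hence \<open>w\<close> has
  enough private neighbours to pay for any \<open>Q\<close> that it receives.\<close>

lemma exists_private_nbrs:
  assumes G: "sgraph V E" and le: "deg E u \<le> deg E w"
    and Q: "Q \<subseteq> E `` {u} - E `` {w} - {w}" and ne: "u \<noteq> w"
  shows "\<exists>Z \<subseteq> E `` {w} - E `` {u} - {u}. card Z = card Q"
proof -
  have fin: "finite (E `` {v})" for v by (rule sgraph_finite_nbrs[OF G])
  have sy: "(u, w) \<in> E \<longleftrightarrow> (w, u) \<in> E"
    using sgraph_sym[OF G] by blast
  have irr: "(u, u) \<notin> E" "(w, w) \<notin> E" using sgraph_irrefl[OF G] by auto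
  let ?A = "E `` {u} - {w}" and ?B = "E `` {w} - {u}"
  have "card ?A \<le> card ?B"
    using le sy fin unfolding deg_def by (cases "(u, w) \<in> E") (auto simp: card_Diff_singleton_if)
  moreover have "card (?A - ?B) + card (?A \<inter> ?B) = card ?A" "card (?B - ?A) + card (?A \<inter> ?B) = card ?B"
    using fin by (metis card_Diff_subset_Int card_mono finite_Diff finite_Int inf.cobounded1 inf.commute le_add_diff_inverse2)+
  ultimately have "card (?A - ?B) \<le> card (?B - ?A)" by linarith
  moreover have "card Q \<le> card (?A - ?B)"
    by (rule card_mono) (use Q fin irr in auto)
  ultimately have "card Q \<le> card (?B - ?A)" by linarith
  then obtain Z where "Z \<subseteq> ?B - ?A" "card Z = card Q"
    by (meson obtain_subset_with_card_n)
  moreover have "Z \<subseteq> E `` {w} - E `` {u} - {u}" using \<open>Z \<subseteq> ?B - ?A\<close> irr by auto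
  ultimately show ?thesis by blast
qed

text \<open>A neighbour \<open>y\<close> of \<open>v\<close> outside \<open>T\<close> is traded for
  a missing \<open>x\<close> in \<open>T\<close>: as \<open>x\<close> has at least the degree of
  \<open>y\<close>, some private neighbour of \<open>x\<close> can be handed to \<open>y\<close> in
  return. Each trade leaves one vertex of \<open>T\<close> less to be reached.\<close>

lemma kleitman_wang:
  assumes "sgraph V E" and "v \<in> V" and "T \<subseteq> V - {v}" and "card T = deg E v"
    and "\<And>x y. x \<in> T \<Longrightarrow> y \<in> V - {v} - T \<Longrightarrow> deg E y \<le> deg E x"
  shows "\<exists>E'. sgraph V E' \<and> deg E' = deg E \<and> E' `` {v} = T"
  using assms
proof (induction "card (T - E `` {v})" arbitrary: E rule: less_induct)
  case less
  note G = less.prems(1)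
  have fin: "finite (E `` {x})" for x by (rule sgraph_finite_nbrs[OF G])
  have finT: "finite T"
    using less.prems(3) G unfolding sgraph_def by (meson finite_Diff finite_subset)
  show ?case
  proof (cases "T \<subseteq> E `` {v}")
    case True
    then have "T = E `` {v}"
      using less.prems(4) fin unfolding deg_def by (metis card_subset_eq)
    then show ?thesis using G by blast
  next
    case False
    then obtain x where x: "x \<in> T" "x \<notin> E `` {v}" by blast
    have "\<not> E `` {v} \<subseteq> T"
      using less.prems(4) finT False unfolding deg_def by (metis card_subset_eq order_refl)
    then obtain y where y: "y \<in> E `` {v}" "y \<notin> T" by blast
    have yv: "y \<noteq> v" "y \<in> V" using y sgraph_irrefl[OF G] sgraph_mem[OF G] by auto
    have xV: "x \<in> V" "x \<noteq> v" using x less.prems(3) by auto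
    have xy: "y \<noteq> x" using x y by auto
    have "deg E y \<le> deg E x" using less.prems(5)[OF x(1)] y yv by auto
    moreover have Q: "{v} \<subseteq> E `` {y} - E `` {x} - {x}"
      using x y xV sgraph_sym[OF G] by auto
    ultimately obtain Z where Z: "Z \<subseteq> E `` {x} - E `` {y} - {y}" "card Z = card {v}"
      using exists_private_nbrs[OF G _ Q xy] by metis
    interpret ex: exchangeable V E y x "{v}" Z
      using G xy xV Q Z by unfold_locales auto
    let ?E = "exchange E y x {v} Z"
    have G': "sgraph V ?E" by (rule ex.sgraph_exchange[OF yv(2)])
    have d: "deg ?E = deg E" using ex.deg_exchange by blast
    \<comment> \<open>The vertex returned to \<open>y\<close> is a neighbour of \<open>x\<close>,
      and \<open>v\<close> is not, so \<open>v\<close> gains only \<open>x\<close> and loses only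
      \<open>y\<close>.\<close>
    have "v \<notin> Z" using Z x sgraph_sym[OF G] by auto
    then have nb: "?E `` {v} = insert x (E `` {v} - {y})"
      unfolding exchange_def using xV yv xy by auto
    have "T - ?E `` {v} = (T - E `` {v}) - {x}"
      unfolding nb using y by auto
    then have "card (T - ?E `` {v}) < card (T - E `` {v})"
      using x finT by (metis DiffI card_Diff1_less finite_Diff)
    from less.hyps[OF this G' less.prems(2,3)] show ?thesis
      using less.prems(4,5) d by simp
  qed
qed

section \<open>Realizations that contain a prism\<close>

text \<open>Multisets spare any resorting when terms are changed, and vertices in \<open>nat\<close>
  always leave a fresh one to attach.\<close>

definition graphical :: "nat multiset \<Rightarrow> bool" where
  "graphical M \<longleftrightarrow> (\<exists>(V :: nat set) E. sgraph V E \<and> degs V E = M)"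

definition prism_at :: "('a \<times> 'a) set \<Rightarrow> (nat \<Rightarrow> 'a) \<Rightarrow> bool" where
  "prism_at E g \<longleftrightarrow> inj_on g {0..<6} \<and> (\<forall>i j. (i, j) \<in> parcs K6_minus_C6 \<longrightarrow> (g i, g j) \<in> E)"

definition pot :: "nat multiset \<Rightarrow> bool" where
  "pot M \<longleftrightarrow> (\<exists>(V :: nat set) E g. sgraph V E \<and> degs V E = M \<and> prism_at E g)"

lemma pot_graphical: "pot M \<Longrightarrow> graphical M"
  unfolding pot_def graphical_def by blast

text \<open>All multiplicities in \<open>mset_set V\<close> are at most one, so both summands are
  sets and cannot share an element.\<close>

lemma split_mset_set:
  assumes "finite V" and "mset_set V = B + C"
  shows "B = mset_set (set_mset B) \<and> V = set_mset B \<union> set_mset C \<and> set_mset B \<inter> set_mset C = {}"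
proof -
  have c: "count B x + count C x = (if x \<in> V then 1 else 0)" for x
    using assms by (metis count_mset_set(1) count_mset_set(3) count_union)
  have le: "count B x + count C x \<le> 1" for x using c[of x] by (simp split: if_splits)
  have "count B x = count (mset_set (set_mset B)) x" for x
  proof (cases "x \<in># B")
    case True
    then have "0 < count B x" by simp
    with le[of x] have "count B x = 1" by linarith
    then show ?thesis using True by simp
  qed (simp add: not_in_iff)
  moreover have "V = set_mset B \<union> set_mset C"
    using assms by (metis finite_set_mset_mset_set set_mset_union)
  moreover have "set_mset B \<inter> set_mset C = {}"
  proof (rule ccontr)
    assume "\<not> ?thesis"
    then obtain x where "x \<in># B" "x \<in># C" by blast
    then have "0 < count B x" "0 < count C x" by simp_all
    with le[of x] show False by linarith
  qed
  ultimately show ?thesis by (simp add: multiset_eqI)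
qed

text \<open>This is how vertices with prescribed degrees are picked: a splitting of the degree
  multiset lifts to a partition of the vertices.\<close>

lemma split_image_mset_set:
  assumes "finite V" and "image_mset f (mset_set V) = R + D"
  obtains V1 V2 where "V = V1 \<union> V2" "V1 \<inter> V2 = {}"
    "image_mset f (mset_set V1) = R" "image_mset f (mset_set V2) = D"
proof -
  obtain B C where BC: "mset_set V = B + C" "R = image_mset f B" "D = image_mset f C"
    using image_mset_eq_plusD[OF assms(2)] by blast
  from BC(1) have CB: "mset_set V = C + B" by simp
  show thesis
    using split_mset_set[OF assms(1) BC(1)] split_mset_set[OF assms(1) CB] BC(2,3)
    by (intro that[of "set_mset B" "set_mset C"]) auto
qed

text \<open>\<open>D\<close> holds the degrees of the neighbours chosen for the new vertex, whose
  own degree is then \<open>size D\<close>; \<open>R\<close> holds the others. Edges are only added,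
  so the prism survives.\<close>

lemma pot_add_vertex:
  assumes "pot (D + R)"
  shows "pot ({#size D#} + image_mset Suc D + R)"
proof -
  obtain V E and g :: "nat \<Rightarrow> nat" where G: "sgraph V E" and d: "degs V E = D + R" and g: "prism_at E g"
    using assms unfolding pot_def by blast
  have fV: "finite V" using G by (simp add: sgraph_def)
  obtain V2 V1 where V: "V = V2 \<union> V1" "V2 \<inter> V1 = {}"
    "image_mset (deg E) (mset_set V1) = R" "image_mset (deg E) (mset_set V2) = D"
    using split_image_mset_set[OF fV d[unfolded degs_def]] by metis
  have f12: "finite V1" "finite V2" using fV V(1) by auto
  obtain z where z: "z \<notin> V" using fV ex_new_if_finite infinite_UNIV_nat by blast
  define E' where "E' = E \<union> {z} \<times> V2 \<union> V2 \<times> {z}"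
  have zE: "(z, x) \<notin> E" "(x, z) \<notin> E" for x using sgraph_mem[OF G] z by blast+
  have G': "sgraph (insert z V) E'"
    using G V(1) z unfolding sgraph_def E'_def sym_def irrefl_def by auto
  have "E' `` {z} = V2" unfolding E'_def using zE z V(1) by auto
  then have dz: "deg E' z = size D" using V(4) by (auto simp: deg_def)
  have "E' `` {x} = insert z (E `` {x})" if "x \<in> V2" for x
    unfolding E'_def using that z V(1) by auto
  then have d2: "deg E' x = Suc (deg E x)" if "x \<in> V2" for x
    using that zE sgraph_finite_nbrs[OF G] by (simp add: deg_def)
  have "E' `` {x} = E `` {x}" if "x \<in> V1" for x
    unfolding E'_def using that z V by auto
  then have d1: "deg E' x = deg E x" if "x \<in> V1" for x
    using that by (simp add: deg_def)
  have "degs (insert z V) E' = {#deg E' z#} + image_mset (deg E') (mset_set V2) + image_mset (deg E') (mset_set V1)"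
    unfolding degs_def using z f12 V(1,2) by (simp add: mset_set_Union)
  also have "image_mset (deg E') (mset_set V2) = image_mset Suc D"
    unfolding V(4)[symmetric] using d2 f12
    by (auto simp: multiset.map_comp intro!: image_mset_cong)
  also have "image_mset (deg E') (mset_set V1) = R"
    unfolding V(3)[symmetric] using d1 f12 by (auto intro!: image_mset_cong)
  finally have "degs (insert z V) E' = {#size D#} + image_mset Suc D + R" using dz by simp
  moreover have "prism_at E' g" using g unfolding prism_at_def E'_def by blast
  ultimately show ?thesis using G' unfolding pot_def by blast
qed

text \<open>By \<open>kleitman_wang\<close> some vertex of degree \<open>size D\<close> may be
  assumed adjacent to exactly the vertices with degrees \<open>D\<close>; it is then deleted.
  Positivity is recorded because \<open>x - 1\<close> is truncated and has to be undone by
  \<open>Suc\<close> later.\<close>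

lemma graphical_remove:
  assumes "graphical ({#size D#} + D + R)" and "\<And>x y. x \<in># D \<Longrightarrow> y \<in># R \<Longrightarrow> y \<le> x"
  shows "graphical (image_mset (\<lambda>x. x - 1) D + R) \<and> (\<forall>x \<in># D. x \<ge> 1)"
proof -
  obtain V and E :: "(nat \<times> nat) set"
    where G: "sgraph V E" and d: "degs V E = {#size D#} + (D + R)"
    using assms(1) unfolding graphical_def by (metis add.assoc)
  have fV: "finite V" using G by (simp add: sgraph_def)
  obtain V0 V3 where V03: "V = V0 \<union> V3" "V0 \<inter> V3 = {}"
    "image_mset (deg E) (mset_set V0) = {#size D#}" "image_mset (deg E) (mset_set V3) = D + R"
    using split_image_mset_set[OF fV d[unfolded degs_def]] by metis
  have fV3: "finite V3" "finite V0" using fV V03 by auto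
  obtain V2 V1 where V: "V3 = V2 \<union> V1" "V2 \<inter> V1 = {}"
    "image_mset (deg E) (mset_set V1) = R" "image_mset (deg E) (mset_set V2) = D"
    using split_image_mset_set[OF fV3(1) V03(4)] by metis
  have f12: "finite V1" "finite V2" using fV3 V(1) by auto
  have "card V0 = 1" using V03(3) by (metis size_image_mset size_mset_set size_single)
  then obtain v where v: "V0 = {v}" by (rule card_1_singletonE)
  have dv: "deg E v = size D" using V03(3) v by simp
  have vV: "v \<in> V" "v \<notin> V1" "v \<notin> V2" using V03 V v by auto
  have "\<exists>E'. sgraph V E' \<and> deg E' = deg E \<and> E' `` {v} = V2"
  proof (rule kleitman_wang[OF G vV(1)])
    show "V2 \<subseteq> V - {v}" using V03 V v by auto
    show "card V2 = deg E v" using dv V(4) by (metis size_image_mset size_mset_set)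
    fix x y assume "x \<in> V2" "y \<in> V - {v} - V2"
    then have "x \<in> V2" "y \<in> V1" using V03(1) V(1) v by auto
    then have "deg E x \<in># D" "deg E y \<in># R"
      unfolding V(3)[symmetric] V(4)[symmetric] using f12 by auto
    then show "deg E y \<le> deg E x" using assms(2) by blast
  qed
  then obtain E' where E': "sgraph V E'" "deg E' = deg E" "E' `` {v} = V2" by blast
  define F where "F = E' \<inter> V3 \<times> V3"
  have GF: "sgraph V3 F"
    using E'(1) fV3 unfolding sgraph_def F_def sym_def irrefl_def by auto
  have sub: "E' \<subseteq> V \<times> V" using E'(1) by (simp add: sgraph_def)
  have n2: "F `` {x} = E' `` {x} - {v}" "v \<in> E' `` {x}" if "x \<in> V2" for x
  proof -
    show "v \<in> E' `` {x}" using that E'(3) sgraph_sym[OF E'(1)] by blast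
    show "F `` {x} = E' `` {x} - {v}"
      unfolding F_def using that sub V03 V v by auto
  qed
  have d2: "deg F x = deg E x - 1" "deg E x \<ge> 1" if "x \<in> V2" for x
  proof -
    have "deg E x = card (E' `` {x})" using E'(2) by (metis deg_def)
    moreover have "finite (E' `` {x})" by (rule sgraph_finite_nbrs[OF E'(1)])
    ultimately show "deg F x = deg E x - 1" "deg E x \<ge> 1"
      using n2[OF that] by (auto simp: deg_def card_gt_0_iff Suc_le_eq)
  qed
  have d1: "deg F x = deg E x" if "x \<in> V1" for x
  proof -
    have "v \<notin> E' `` {x}" using that E'(3) V(2) sgraph_sym[OF E'(1)] by blast
    then have "F `` {x} = E' `` {x}"
      unfolding F_def using that sub V03 V v by auto
    then show ?thesis using E'(2) by (metis deg_def)
  qed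
  have "degs V3 F = image_mset (deg F) (mset_set V2) + image_mset (deg F) (mset_set V1)"
    unfolding degs_def using f12 V(1,2) by (simp add: mset_set_Union)
  also have "image_mset (deg F) (mset_set V2) = image_mset (\<lambda>x. x - 1) D"
    unfolding V(4)[symmetric] using d2 f12
    by (auto simp: multiset.map_comp intro!: image_mset_cong)
  also have "image_mset (deg F) (mset_set V1) = R"
    unfolding V(3)[symmetric] using d1 f12 by (auto intro!: image_mset_cong)
  finally have "graphical (image_mset (\<lambda>x. x - 1) D + R)"
    using GF unfolding graphical_def by blast
  moreover have "\<forall>x \<in># D. x \<ge> 1" unfolding V(4)[symmetric] using d2 f12 by auto
  ultimately show ?thesis by blast
qed

lemma graphical_even:
  assumes "graphical M" shows "even (sum_mset M)"
proof -
  obtain V and E :: "(nat \<times> nat) set" where G: "sgraph V E" and d: "degs V E = M"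
    using assms unfolding graphical_def by blast
  have fV: "finite V" and sub: "E \<subseteq> V \<times> V" using G by (auto simp: sgraph_def)
  have fE: "finite E" using fV sub by (meson finite_SigmaI finite_subset)
  have "E = Sigma V (\<lambda>v. E `` {v})" using sub by auto
  then have "card E = (\<Sum>v\<in>V. deg E v)"
    using card_SigmaI[OF fV, of "\<lambda>v. E `` {v}"] sgraph_finite_nbrs[OF G] by (simp add: deg_def)
  then have "sum_mset M = card E" by (simp add: d[symmetric] degs_def sum_unfold_sum_mset)
  moreover have "even (card E)"
  proof -
    let ?A = "{(x, y) \<in> E. x < y}" and ?B = "{(x, y) \<in> E. y < x}"
    have "E = ?A \<union> ?B"
    proof -
      have "x < y \<or> y < x" if "(x, y) \<in> E" for x y
        using that sgraph_irrefl[OF G] by (metis linorder_less_linear)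
      then show ?thesis by auto
    qed
    moreover have "?B = prod.swap ` ?A" using sgraph_sym[OF G] by (auto simp: image_iff)
    then have "card ?B = card ?A" by (simp add: card_image)
    moreover have "card (?A \<union> ?B) = card ?A + card ?B"
      by (rule card_Un_disjoint) (use fE in \<open>auto intro: finite_subset\<close>)
    ultimately show ?thesis by simp
  qed
  ultimately show ?thesis by simp
qed

lemma graphical_less_size:
  assumes "graphical M" and "x \<in># M" shows "x < size M"
proof -
  obtain V and E :: "(nat \<times> nat) set" where G: "sgraph V E" and d: "degs V E = M"
    using assms unfolding graphical_def by blast
  have fV: "finite V" using G by (auto simp: sgraph_def)
  obtain v where v: "v \<in> V" "x = deg E v" using assms(2) fV unfolding d[symmetric] degs_def by auto
  have "E `` {v} \<subseteq> V - {v}" using G by (auto simp: sgraph_def irrefl_def)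
  then have "card (E `` {v}) \<le> card (V - {v})" using fV by (intro card_mono) auto
  then show ?thesis using v fV card_gt_0_iff[of V]
    by (auto simp: d[symmetric] degs_def deg_def)
qed

text \<open>The complement of the prism is the 6-cycle \<open>0, 1, \<dots>, 5\<close>, whose edges can be added at will.\<close>

lemma pot_prism_rim:
  "pot {#3 + of_bool (s 0) + of_bool (s 5), 3 + of_bool (s 0) + of_bool (s 1),
         3 + of_bool (s 1) + of_bool (s 2), 3 + of_bool (s 2) + of_bool (s 3),
         3 + of_bool (s 3) + of_bool (s 4), 3 + of_bool (s 4) + of_bool (s (5 :: nat))#}"
proof -
  \<comment> \<open>\<open>s i\<close> decides whether the rim edge between \<open>i\<close> and
    \<open>i + 1\<close> modulo 6 is present.\<close>
  define P where "P = (\<lambda>i j :: nat. i \<noteq> j \<and> (j = (i + 1) mod 6 \<longrightarrow> s i) \<and> (i = (j + 1) mod 6 \<longrightarrow> s j))"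
  define E where "E = {(i, j). i \<in> {0..<6} \<and> j \<in> {0..<6} \<and> P i j}"
  have G: "sgraph {0..<6} E"
    unfolding sgraph_def E_def P_def sym_def irrefl_def by auto
  have deg: "deg E i = length (filter (P i) [0..<6])" if "i < 6" for i
  proof -
    have "E `` {i} = set (filter (P i) [0..<6])" using that by (auto simp: E_def)
    then show ?thesis unfolding deg_def by (metis distinct_card distinct_filter distinct_upt)
  qed
  have "{0..<6} = {0, 1, 2, 3, 4, 5 :: nat}" by auto
  then have "mset_set {0..<6} = {#0, 1, 2, 3, 4, 5 :: nat#}" by simp
  then have "degs {0..<6} E =
      {#deg E 0, deg E 1, deg E 2, deg E 3, deg E 4, deg E 5#}"
    unfolding degs_def by simp
  also have "\<dots> = {#3 + of_bool (s 0) + of_bool (s 5), 3 + of_bool (s 0) + of_bool (s 1),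
         3 + of_bool (s 1) + of_bool (s 2), 3 + of_bool (s 2) + of_bool (s 3),
         3 + of_bool (s 3) + of_bool (s 4), 3 + of_bool (s 4) + of_bool (s (5 :: nat))#}"
  proof -
    have "[0..<6] = [0, 1, 2, 3, 4, 5 :: nat]" by (simp add: upt_rec)
    then have
      "deg E 0 = 3 + of_bool (s 0) + of_bool (s 5)" "deg E 1 = 3 + of_bool (s 0) + of_bool (s 1)"
      "deg E 2 = 3 + of_bool (s 1) + of_bool (s 2)" "deg E 3 = 3 + of_bool (s 2) + of_bool (s 3)"
      "deg E 4 = 3 + of_bool (s 3) + of_bool (s 4)" "deg E 5 = 3 + of_bool (s 4) + of_bool (s (5 :: nat))"
      by (simp_all add: deg P_def)
    then show ?thesis by simp
  qed
  finally have d: "degs {0..<6} E = \<dots>" .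
  have "prism_at E id"
    unfolding prism_at_def E_def P_def K6_minus_C6_def by auto
  then show ?thesis using G d unfolding pot_def by metis
qed

section \<open>Sequences whose fourth term is three: sufficiency\<close>

text \<open>\<open>a\<close>, \<open>b\<close>, \<open>c\<close> are not assumed sorted:
  \<open>seq_swap\<close> permutes them, so the lemmas on attaching a vertex may always raise the
  leading ones.\<close>

definition seq :: "nat \<Rightarrow> nat \<Rightarrow> nat \<Rightarrow> nat \<Rightarrow> nat \<Rightarrow> nat \<Rightarrow> nat multiset" where
  "seq a b c k t m = {#a, b, c#} + replicate_mset k 3 + replicate_mset t 2 + replicate_mset m 1"

lemma seq_swap: "seq a b c k t m = seq b a c k t m" "seq a b c k t m = seq a c b k t m"
  by (simp_all add: seq_def add_mset_commute)

section \<open>Attaching a vertex of degree 1, 2 or 3\<close>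

lemma pot_add1:
  assumes "pot (seq a b c k t m)" shows "pot (seq (a + 1) b c k t (m + 1))"
  using pot_add_vertex[of "{#a#}" "{#b, c#} + replicate_mset k 3 + replicate_mset t 2 + replicate_mset m 1"]
    assms by (simp add: seq_def add_mset_commute)

text \<open>In these names the first digit is the degree of the new vertex, and the digits after the
  underscore are the raised values of its neighbours among the small terms. Its other neighbours are
  large vertices.\<close>

lemma pot_add1_3:
  assumes "pot (seq a b c k (t + 1) m)" shows "pot (seq a b c (k + 1) t (m + 1))"
  using pot_add_vertex[of "{#2#}" "{#a, b, c#} + replicate_mset k 3 + replicate_mset t 2 + replicate_mset m 1"]
    assms by (simp add: seq_def add_mset_commute)

lemma pot_add1_2:
  assumes "pot (seq a b c k t (m + 1))" shows "pot (seq a b c k (t + 1) (m + 1))"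
  using pot_add_vertex[of "{#1#}" "{#a, b, c#} + replicate_mset k 3 + replicate_mset t 2 + replicate_mset m 1"]
    assms by (simp add: seq_def add_mset_commute numeral_2_eq_2)

text \<open>The leaf hangs on an isolated vertex attached just before, which amounts to adding a
  separate edge.\<close>

lemma pot_add1_1:
  assumes "pot (seq a b c k t m)" shows "pot (seq a b c k t (m + 2))"
  using pot_add_vertex[of "{#}" "seq a b c k t m"] pot_add_vertex[of "{#0#}" "seq a b c k t m"]
    assms by (simp add: seq_def add_mset_commute)

lemma pot_add2:
  assumes "pot (seq a b c k t m)" shows "pot (seq (a + 1) (b + 1) c k (t + 1) m)"
  using pot_add_vertex[of "{#a, b#}" "{#c#} + replicate_mset k 3 + replicate_mset t 2 + replicate_mset m 1"]
    assms by (simp add: seq_def add_mset_commute numeral_2_eq_2)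

lemma pot_add2_3:
  assumes "pot (seq a b c k (t + 1) m)" shows "pot (seq (a + 1) b c (k + 1) (t + 1) m)"
  using pot_add_vertex[of "{#a, 2#}" "{#b, c#} + replicate_mset k 3 + replicate_mset t 2 + replicate_mset m 1"]
    assms by (simp add: seq_def add_mset_commute numeral_3_eq_3 numeral_2_eq_2)

lemma pot_add2_2:
  assumes "pot (seq a b c k t (m + 1))" shows "pot (seq (a + 1) b c k (t + 2) m)"
  using pot_add_vertex[of "{#a, 1#}" "{#b, c#} + replicate_mset k 3 + replicate_mset t 2 + replicate_mset m 1"]
    assms by (simp add: seq_def add_mset_commute numeral_3_eq_3 numeral_2_eq_2)

lemma pot_add2_33:
  assumes "pot (seq a b c k (t + 2) m)" shows "pot (seq a b c (k + 2) (t + 1) m)"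
  using pot_add_vertex[of "{#2, 2#}" "{#a, b, c#} + replicate_mset k 3 + replicate_mset t 2 + replicate_mset m 1"]
    assms by (simp add: seq_def add_mset_commute numeral_3_eq_3 numeral_2_eq_2)

lemma pot_add2_32:
  assumes "pot (seq a b c k (t + 1) (m + 1))" shows "pot (seq a b c (k + 1) (t + 2) m)"
  using pot_add_vertex[of "{#2, 1#}" "{#a, b, c#} + replicate_mset k 3 + replicate_mset t 2 + replicate_mset m 1"]
    assms by (simp add: seq_def add_mset_commute numeral_3_eq_3 numeral_2_eq_2)

lemma pot_add2_22:
  assumes "pot (seq a b c k t (m + 2))" shows "pot (seq a b c k (t + 3) m)"
  using pot_add_vertex[of "{#1, 1#}" "{#a, b, c#} + replicate_mset k 3 + replicate_mset t 2 + replicate_mset m 1"]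
    assms by (simp add: seq_def add_mset_commute numeral_3_eq_3 numeral_2_eq_2)

lemma pot_add3:
  assumes "pot (seq a b c k t m)" shows "pot (seq (a + 1) (b + 1) (c + 1) (k + 1) t m)"
  using pot_add_vertex[of "{#a, b, c#}" "replicate_mset k 3 + replicate_mset t 2 + replicate_mset m 1"]
    assms by (simp add: seq_def add_mset_commute numeral_3_eq_3 numeral_2_eq_2)

lemma pot_add3_3:
  assumes "pot (seq a b c k (t + 1) m)" shows "pot (seq (a + 1) (b + 1) c (k + 2) t m)"
  using pot_add_vertex[of "{#a, b, 2#}" "{#c#} + replicate_mset k 3 + replicate_mset t 2 + replicate_mset m 1"]
    assms by (simp add: seq_def add_mset_commute numeral_3_eq_3 numeral_2_eq_2)

lemma pot_add3_33:
  assumes "pot (seq a b c k (t + 2) m)" shows "pot (seq (a + 1) b c (k + 3) t m)"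
  using pot_add_vertex[of "{#a, 2, 2#}" "{#b, c#} + replicate_mset k 3 + replicate_mset t 2 + replicate_mset m 1"]
    assms by (simp add: seq_def add_mset_commute numeral_3_eq_3 numeral_2_eq_2)

lemma pot_add3_333:
  assumes "pot (seq a b c k (t + 3) m)" shows "pot (seq a b c (k + 4) t m)"
  using pot_add_vertex[of "{#2, 2, 2#}" "{#a, b, c#} + replicate_mset k 3 + replicate_mset t 2 + replicate_mset m 1"]
    assms by (simp add: seq_def add_mset_commute numeral_3_eq_3 numeral_2_eq_2 numeral_Bit0)

text \<open>The prism with no, one, or two adjacent rim edges. Bounds and parity allow no other
  sequence with \<open>k = 3\<close> and \<open>t = m = 0\<close>, so the induction ends
  here.\<close>

lemma pot_order_6:
  "pot (seq 3 3 3 3 0 0)" "pot (seq 4 4 3 3 0 0)" "pot (seq 5 4 4 3 0 0)"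
  using pot_prism_rim[of "\<lambda>i. False"] pot_prism_rim[of "\<lambda>i. i = 0"] pot_prism_rim[of "\<lambda>i. i < 2"]
  by (simp_all add: seq_def add_mset_commute eval_nat_numeral)

text \<open>
  With \<open>n = k + t + m + 3\<close> vertices these are the degree and edge-counting bounds for one, two and
  three of the large vertices; the sporadic sequences are those of condition (9).
\<close>

definition lin :: "nat \<Rightarrow> nat \<Rightarrow> nat \<Rightarrow> nat \<Rightarrow> nat \<Rightarrow> nat \<Rightarrow> bool" where
  "lin a b c k t m \<longleftrightarrow> b \<le> a \<and> c \<le> b \<and> 3 \<le> c \<and> 3 \<le> k \<and> even (a + b + c + k + m) \<and>
     a \<le> k + t + m + 2 \<and>
     (a = k + t + m + 2 \<longrightarrow> 4 \<le> c) \<and>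
     (a = k + t + m + 1 \<longrightarrow> 4 \<le> b) \<and>
     a + b \<le> 2 * k + 2 * t + m + 3 \<and>
     (a + b = 2 * k + 2 * t + m + 3 \<longrightarrow> 4 \<le> c) \<and>
     a + b + c \<le> 3 * k + 2 * t + m + 4"

definition sporadic :: "nat \<Rightarrow> nat \<Rightarrow> nat \<Rightarrow> nat \<Rightarrow> nat \<Rightarrow> nat \<Rightarrow> bool" where
  "sporadic a b c k t m \<longleftrightarrow>
     a = 3 \<and> b = 3 \<and> c = 3 \<and> (k = 3 \<and> (t = 1 \<or> t = 2) \<and> m = 0 \<or> k = 5 \<and> t = 0 \<and> m = 0 \<or>
       k = 4 \<and> t = 0 \<and> m = 1 \<or> k = 5 \<and> t = 1 \<and> m = 0 \<or> k = 4 \<and> t = 1 \<and> m = 1 \<or>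
       k = 6 \<and> t = 0 \<and> m = 1 \<or> k = 5 \<and> t = 0 \<and> m = 2) \<or>
     a = 4 \<and> b = 3 \<and> c = 3 \<and> (k = 4 \<and> t = 1 \<and> m = 0 \<or> k = 6 \<and> t = 0 \<and> m = 0 \<or>
       k = 5 \<and> t = 0 \<and> m = 1) \<or>
     a = 4 \<and> b = 4 \<and> c = 3 \<and> k = 5 \<and> t = 0 \<and> m = 0 \<or>
     (k = 4 \<or> k = 5) \<and> t = 0 \<and>
       (a = k + m + 2 \<and> b = 4 \<and> c = 4 \<or> a = k + m + 1 \<and> b = 4 \<and> c = 3 \<or> a = k + m \<and> b = 3 \<and> c = 3)"

definition good :: "nat \<Rightarrow> nat \<Rightarrow> nat \<Rightarrow> nat \<Rightarrow> nat \<Rightarrow> nat \<Rightarrow> bool" where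
  "good a b c k t m \<longleftrightarrow> lin a b c k t m \<and> \<not> sporadic a b c k t m"

section \<open>Removing a term 1\<close>

lemma good_add1_a:
  assumes "good (a + 1) b c k t (m + 1)" and "b \<le> a"
  shows "good a b c k t m \<or> 4 \<le> k \<and> good (a + 1) b c (k - 1) (t + 1) m \<or>
    1 \<le> t \<and> good (a + 1) b c k (t - 1) (m + 1)"
proof -
  \<comment> \<open>Both sides of each inequality drop by the same amount, so only a sporadic result
    has to be avoided. In that event the leaf is taken from a vertex of degree 3 or 2, which gives
    the other disjuncts.\<close>
  have "lin a b c k t m" using assms unfolding good_def lin_def by (auto simp: algebra_simps)
  moreover have "4 \<le> k \<and> good (a + 1) b c (k - 1) (t + 1) m \<or>
    1 \<le> t \<and> good (a + 1) b c k (t - 1) (m + 1)" if "sporadic a b c k t m"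
    using that assms unfolding sporadic_def
    by (elim disjE conjE; simp add: good_def lin_def sporadic_def)
  ultimately show ?thesis unfolding good_def by blast
qed

text \<open>When the two largest terms agree, the second is lowered to keep the order. Now
  \<open>a\<close> stays while the number of vertices drops, so the conditions on top values of
  \<open>a\<close> need an argument.\<close>

lemma good_add1_b:
  assumes "good (b + 1) (b + 1) c k t (m + 1)" and "c \<le> b"
  shows "good (b + 1) b c k t m \<or> 4 \<le> k \<and> good (b + 1) (b + 1) c (k - 1) (t + 1) m \<or>
    1 \<le> t \<and> good (b + 1) (b + 1) c k (t - 1) (m + 1)"
proof -
  \<comment> \<open>A failure would force 4, 4, 3 with three more threes and one leaf, a sequence of
    odd sum.\<close>
  have "4 \<le> b" if "b + 1 = k + t + m + 1"
  proof (rule ccontr)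
    assume "\<not> 4 \<le> b"
    with that assms have "b = 3" "c = 3" "k = 3" "t = 0" "m = 0" by (auto simp: good_def lin_def)
    with assms show False by (simp add: good_def lin_def)
  qed
  then have "lin (b + 1) b c k t m"
    using assms unfolding good_def lin_def
    by (elim conjE, intro conjI impI; ((simp; fail) | linarith | (erule mp, linarith)))
  moreover have "4 \<le> k \<and> good (b + 1) (b + 1) c (k - 1) (t + 1) m \<or>
    1 \<le> t \<and> good (b + 1) (b + 1) c k (t - 1) (m + 1)" if "sporadic (b + 1) b c k t m"
    using that assms unfolding sporadic_def
    by (elim disjE conjE; simp add: good_def lin_def sporadic_def)
  ultimately show ?thesis unfolding good_def by blast
qed

lemma good_add1_c:
  assumes "good (c + 1) (c + 1) (c + 1) k t (m + 1)" and "3 \<le> c"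
  shows "good (c + 1) (c + 1) c k t m \<or> 4 \<le> k \<and> good (c + 1) (c + 1) (c + 1) (k - 1) (t + 1) m \<or>
    1 \<le> t \<and> good (c + 1) (c + 1) (c + 1) k (t - 1) (m + 1)"
proof -
  have "lin (c + 1) (c + 1) c k t m"
    using assms unfolding good_def lin_def
    by (elim conjE, intro conjI impI; ((simp; fail) | linarith | (erule mp, linarith)))
  moreover have "4 \<le> k \<and> good (c + 1) (c + 1) (c + 1) (k - 1) (t + 1) m \<or>
    1 \<le> t \<and> good (c + 1) (c + 1) (c + 1) k (t - 1) (m + 1)" if "sporadic (c + 1) (c + 1) c k t m"
    using that assms unfolding sporadic_def
    by (elim disjE conjE; simp add: good_def lin_def sporadic_def)
  ultimately show ?thesis unfolding good_def by blast
qed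

text \<open>No large term can be lowered here. The leaf is taken from a surplus 3 if
  \<open>k > 3\<close> and from a term 2 if \<open>k = 3\<close>. If there is no term 2 either,
  parity makes the number of leaves even and two of them go as a separate edge.\<close>

lemma good_add1_333:
  assumes "good 3 3 3 k t (m + 1)"
  shows "4 \<le> k \<and> good 3 3 3 (k - 1) (t + 1) m \<or> k = 3 \<and> 1 \<le> t \<and> good 3 3 3 k (t - 1) (m + 1) \<or>
    k = 3 \<and> t = 0 \<and> 1 \<le> m \<and> good 3 3 3 k t (m - 1)"
proof (cases "k = 3")
  case True
  then have "odd m" using assms by (auto simp: good_def lin_def)
  then obtain m' where "m = m' + 1" by (cases m) auto
  then show ?thesis
    using assms True by (cases "t = 0") (auto simp: good_def lin_def sporadic_def)
next
  case False
  then have "4 \<le> k" using assms by (auto simp: good_def lin_def)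
  then obtain k' where k: "k = k' + 4" by (metis add.commute le_Suc_ex)
  have "good 3 3 3 (k' + 3) (t + 1) m"
    using assms unfolding good_def lin_def sporadic_def k by (auto simp: algebra_simps)
  then show ?thesis using k by (simp add: add.commute)
qed

text \<open>Lowering the last of the largest terms keeps the three large ones sorted; this dictates
  the case distinction.\<close>

lemma pot_step_1:
  assumes g: "good a b c k t (m + 1)"
    and IH: "\<And>a b c k' t' m'. k' + t' + m' < k + t + m + 1 \<Longrightarrow> good a b c k' t' m' \<Longrightarrow> pot (seq a b c k' t' m')"
  shows "pot (seq a b c k t (m + 1))"
proof -
  have three: ?thesis if "4 \<le> k" "good a b c (k - 1) (t + 1) m"
    using pot_add1_3[of a b c "k - 1" t m] IH[OF _ that(2)] that(1) by simp
  have two: ?thesis if "1 \<le> t" "good a b c k (t - 1) (m + 1)"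
    using pot_add1_2[of a b c k "t - 1" m] IH[OF _ that(2)] that(1) by simp
  have ord: "b \<le> a" "c \<le> b" "3 \<le> c" using g by (auto simp: good_def lin_def)
  consider (a) "b < a" | (b) "a = b" "c < b" | (c) "a = b" "b = c" "3 < c" | (n) "a = 3" "b = 3" "c = 3"
    using ord by linarith
  then show ?thesis
  proof cases
    case a
    then obtain a' where a': "a = a' + 1" by (metis add.commute add_lessD1 less_imp_Suc_add plus_1_eq_Suc add_Suc_right)
    have "?thesis" if "good a' b c k t m"
      using pot_add1[OF IH[OF _ that]] a' by simp
    with good_add1_a[of a' b c k t m] g a a' three two show ?thesis by auto
  next
    case b
    then obtain b' where b': "b = b' + 1" by (cases b) auto
    have "?thesis" if "good (b' + 1) b' c k t m"
    proof -
      have "pot (seq b' (b' + 1) c k t m)" using IH[OF _ that] seq_swap(1) by simp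
      from pot_add1[OF this] show ?thesis using b b' by simp
    qed
    with good_add1_b[of b' c k t m] g b b' three two show ?thesis by auto
  next
    case c
    then obtain c' where c': "c = c' + 1" by (cases c) auto
    have "?thesis" if "good (c' + 1) (c' + 1) c' k t m"
    proof -
      have "pot (seq c' (c' + 1) (c' + 1) k t m)" using IH[OF _ that] by (metis seq_swap less_add_one)
      from pot_add1[OF this] show ?thesis using c c' by simp
    qed
    with good_add1_c[of c' k t m] g c c' three two show ?thesis by auto
  next
    case n
    have "?thesis" if "t = 0" "1 \<le> m" "good 3 3 3 k t (m - 1)"
      using pot_add1_1[OF IH[OF _ that(3)]] that n by simp
    with good_add1_333[of k t m] g n three two show ?thesis by auto
  qed
qed

text \<open>The sporadic sequences with \<open>m = 0\<close>, as a list on which claims are checked by evaluation.\<close>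

definition sporadic_no_leaf :: "(nat \<times> nat \<times> nat \<times> nat \<times> nat) list" where
  "sporadic_no_leaf =
    [(3, 3, 3, 3, 1), (3, 3, 3, 3, 2), (3, 3, 3, 5, 0), (3, 3, 3, 5, 1), (4, 3, 3, 4, 1),
     (4, 3, 3, 6, 0), (4, 4, 3, 5, 0), (6, 4, 4, 4, 0), (7, 4, 4, 5, 0), (5, 4, 3, 4, 0),
     (6, 4, 3, 5, 0), (4, 3, 3, 4, 0), (5, 3, 3, 5, 0)]"

lemma sporadic_no_leaf: "sporadic a b c k t 0 \<Longrightarrow> (a, b, c, k, t) \<in> set sporadic_no_leaf"
  unfolding sporadic_def sporadic_no_leaf_def
  apply (elim disjE conjE)
                   apply (simp_all only: list.set prod.inject insert_iff empty_iff)
                   apply simp_all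
  done

section \<open>Removing a term 2 when there is no term 1\<close>

lemma good_add2_ab:
  assumes "good (a + 1) (b + 1) c k (t + 1) 0" and "c \<le> b"
  shows "good a b c k t 0 \<or> good a (b + 1) c (k - 1) (t + 1) 0 \<or>
    1 \<le> t \<and> (good a (b + 1) c k (t - 1) 1 \<or> good (b + 1) a c k (t - 1) 1) \<or>
    5 \<le> k \<and> good (a + 1) (b + 1) c (k - 2) (t + 2) 0"
\<comment> \<open>Lowering \<open>a\<close> and \<open>b\<close> keeps every bound of
  \<open>lin\<close> but one: on \<open>k + t + 3\<close> vertices, \<open>a = k + t + 1\<close>
  demands \<open>b \<ge> 4\<close>. The other disjuncts replace the neighbour \<open>b\<close> by a
  term 3 or a term 2, or both neighbours by terms 3.\<close>
proof (cases "a = k + t + 1 \<and> b = 3")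
  case True
  then have a: "a = k + t + 1" "b = 3" "c = 3" and k: "3 \<le> k" and e: "odd t"
    using assms by (auto simp: good_def lin_def)
  show ?thesis
  proof (cases "k = 3")
    case True
    \<comment> \<open>No surplus 3 exists, but \<open>t\<close> is odd, so a further term 2 is
      available as a neighbour.\<close>
    obtain t' where "t = t' + 1" using e by (cases t) auto
    then show ?thesis using assms a True e by (auto simp: good_def lin_def sporadic_def)
  next
    case False
    then have "4 \<le> k" using k by simp
    then obtain k' where k': "k = k' + 4" by (metis add.commute le_Suc_ex)
    then have "good a (b + 1) c (k - 1) (t + 1) 0"
      using assms a by (simp add: good_def lin_def sporadic_def)
    then show ?thesis by blast
  qed
next
  case False
  then have "a = k + t + 1 \<longrightarrow> b \<noteq> 3" by blast
  then have "lin a b c k t 0"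
    using assms unfolding good_def lin_def
    by (elim conjE, intro conjI impI; ((simp; fail) | linarith | (erule mp, linarith)))
  moreover have "list_all (\<lambda>(a, b, c, k, t). good (a + 1) (b + 1) c k (t + 1) 0 \<longrightarrow> c \<le> b \<longrightarrow> 
      good a (b + 1) c (k - 1) (t + 1) 0 \<or>
      1 \<le> t \<and> (good a (b + 1) c k (t - 1) 1 \<or> good (b + 1) a c k (t - 1) 1) \<or>
      5 \<le> k \<and> good (a + 1) (b + 1) c (k - 2) (t + 2) 0) sporadic_no_leaf"
    by code_simp
  then have ?thesis if "sporadic a b c k t 0"
    using sporadic_no_leaf[OF that] assms unfolding list_all_iff by fast
  ultimately show ?thesis unfolding good_def by blast
qed

text \<open>Up to order this also lowers the two largest terms, but the result stays sorted. A bound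
  breaks only if the lowered \<open>a\<close> still requires adjacency to all others while the
  lowered \<open>c\<close> is 3.\<close>

lemma good_add2_ac:
  assumes "good (a + 1) (c + 1) (c + 1) k (t + 1) 0" and "c < a" "3 \<le> c"
  shows "good a (c + 1) c k t 0 \<or> good a (c + 1) (c + 1) (k - 1) (t + 1) 0 \<or>
    1 \<le> t \<and> good a (c + 1) (c + 1) k (t - 1) 1"
proof (cases "a = k + t + 2 \<and> c = 3")
  case True
  then have a: "a = k + t + 2" "c = 3" and k: "3 \<le> k" and e: "odd t"
    using assms by (auto simp: good_def lin_def)
  show ?thesis
  proof (cases "k = 3")
    case True
    obtain t' where "t = t' + 1" using e by (cases t) auto
    then show ?thesis using assms a True e by (auto simp: good_def lin_def sporadic_def)
  next
    case False
    then have "4 \<le> k" using k by simp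
    then obtain k' where k': "k = k' + 4" by (metis add.commute le_Suc_ex)
    then have "good a (c + 1) (c + 1) (k - 1) (t + 1) 0"
      using assms a by (simp add: good_def lin_def sporadic_def)
    then show ?thesis by blast
  qed
next
  case False
  then have "a = k + t + 2 \<longrightarrow> c \<noteq> 3" by blast
  then have "lin a (c + 1) c k t 0"
    using assms unfolding good_def lin_def
    by (elim conjE, intro conjI impI; ((simp; fail) | linarith | (erule mp, linarith)))
  moreover have "list_all (\<lambda>(a, b, c, k, t). b = c + 1 \<longrightarrow> good (a + 1) b b k (t + 1) 0 \<longrightarrow> 
      good a b b (k - 1) (t + 1) 0 \<or>
      1 \<le> t \<and> good a b b k (t - 1) 1) sporadic_no_leaf"
    by code_simp
  then have ?thesis if "sporadic a (c + 1) c k t 0"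
    using sporadic_no_leaf[OF that] assms unfolding list_all_iff by fast
  ultimately show ?thesis unfolding good_def by blast
qed

lemma good_add2_bc:
  assumes "good (c + 1) (c + 1) (c + 1) k (t + 1) 0" and "3 \<le> c"
  shows "good (c + 1) c c k t 0 \<or> good (c + 1) (c + 1) c (k - 1) (t + 1) 0"
proof -
  \<comment> \<open>A failure would force 4, 4, 4 with three more threes and one term 2, again of
    odd sum.\<close>
  have "4 \<le> c" if "c + 1 = k + t + 1"
  proof (rule ccontr)
    assume "\<not> 4 \<le> c"
    with that assms have "c = 3" "k = 3" "t = 0" by (auto simp: good_def lin_def)
    with assms show False by (simp add: good_def lin_def)
  qed
  then have "lin (c + 1) c c k t 0"
    using assms unfolding good_def lin_def
    by (elim conjE, intro conjI impI; ((simp; fail) | linarith | (erule mp, linarith)))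
  moreover have "list_all (\<lambda>(a, b, c, k, t). a = c + 1 \<longrightarrow> b = c \<longrightarrow> good a a a k (t + 1) 0 \<longrightarrow> good a a c (k - 1) (t + 1) 0) sporadic_no_leaf"
    by code_simp
  then have ?thesis if "sporadic (c + 1) c c k t 0"
    using sporadic_no_leaf[OF that] assms unfolding list_all_iff by fast
  ultimately show ?thesis unfolding good_def by blast
qed

text \<open>The other two large terms are 3 and cannot drop. So the second neighbour is a surplus 3
  or a term 2, or both neighbours are small and \<open>a\<close> is left alone.\<close>

lemma good_add2_a33:
  assumes "good (a + 1) 3 3 k (t + 1) 0" and "3 \<le> a"
  shows "good a 3 3 (k - 1) (t + 1) 0 \<or> 1 \<le> t \<and> good a 3 3 k (t - 1) 1 \<or>
    5 \<le> k \<and> good (a + 1) 3 3 (k - 2) (t + 2) 0 \<or> 1 \<le> t \<and> 4 \<le> k \<and> good (a + 1) 3 3 (k - 1) t 1"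
proof (cases "k = 3")
  case True
  then have "a \<le> 3 + t" "even a" using assms by (auto simp: good_def lin_def)
  \<comment> \<open>\<open>a\<close> is even, hence at least 4, and \<open>a \<le> 3 + t\<close>
    then provides a further term 2.\<close>
  then have "t \<noteq> 0" using assms(2) by (cases "a = 3") auto
  then obtain t' where "t = t' + 1" by (cases t) auto
  then have "good a 3 3 3 t' 1"
    using assms True unfolding good_def lin_def sporadic_def by auto
  then show ?thesis using True \<open>t = t' + 1\<close> by simp
next
  case False
  then have "4 \<le> k" using assms by (auto simp: good_def lin_def)
  then obtain k' where k': "k = k' + 4" by (metis add.commute le_Suc_ex)
  have "lin a 3 3 (k' + 3) (t + 1) 0"
    using assms unfolding good_def lin_def k'
    by (elim conjE, intro conjI impI; ((simp; fail) | linarith | (erule mp, linarith)))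
  moreover have "list_all (\<lambda>(a, b, c, k, t). 1 \<le> t \<longrightarrow> b = 3 \<longrightarrow> c = 3 \<longrightarrow> good (a + 1) 3 3 (k + 1) t 0 \<longrightarrow> 
      2 \<le> t \<and> good a 3 3 (k + 1) (t - 2) 1 \<or>
      4 \<le> k \<and> good (a + 1) 3 3 (k - 1) (t + 1) 0 \<or>
      2 \<le> t \<and> good (a + 1) 3 3 k (t - 1) 1) sporadic_no_leaf"
    by code_simp
  then have ?thesis if "sporadic a 3 3 (k' + 3) (t + 1) 0"
    using sporadic_no_leaf[OF that] assms unfolding list_all_iff k'
    by (auto simp: add.commute dest!: bspec)
  ultimately show ?thesis unfolding good_def k' by (auto simp: add.commute)
qed

text \<open>The removed vertex is joined to two surplus threes. For \<open>k = 3\<close> it is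
  joined to two terms 2, and there are enough of these because the prism sequence with one or two
  terms 2 is sporadic.\<close>

lemma good_add2_333:
  assumes "good 3 3 3 k (t + 1) 0"
  shows "5 \<le> k \<and> good 3 3 3 (k - 2) (t + 2) 0 \<or> 2 \<le> t \<and> good 3 3 3 k (t - 2) 2"
proof (cases "k = 3")
  case True
  then have "t \<noteq> 0" "t \<noteq> 1" using assms by (auto simp: good_def lin_def sporadic_def)
  then have "2 \<le> t" by simp
  then obtain t' where "t = t' + 2" by (metis add.commute le_Suc_ex)
  then show ?thesis using True by (simp add: good_def lin_def sporadic_def)
next
  case False
  then have "4 \<le> k" "k \<noteq> 4" using assms by (auto simp: good_def lin_def)
  then have "5 \<le> k" by simp
  then obtain k' where k': "k = k' + 5" by (metis add.commute le_Suc_ex)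
  have "good 3 3 3 (k' + 3) (t + 2) 0"
    using assms unfolding good_def lin_def sporadic_def k' by auto
  then show ?thesis using k' by (simp add: add.commute)
qed

lemma pot_step_2:
  assumes g: "good a b c k (t + 1) 0"
    and IH: "\<And>a b c k' t' m'. k' + t' + m' < k + t + 1 \<Longrightarrow> good a b c k' t' m' \<Longrightarrow> pot (seq a b c k' t' m')"
  shows "pot (seq a b c k (t + 1) 0)"
proof -
  have k3: "3 \<le> k" and ord: "b \<le> a" "c \<le> b" "3 \<le> c" using g by (auto simp: good_def lin_def)
  have a3: "pot (seq (x + 1) y z k (t + 1) 0)" if "good x y z (k - 1) (t + 1) 0 \<or> good y x z (k - 1) (t + 1) 0 \<or>
    good y z x (k - 1) (t + 1) 0" for x y z
  proof -
    have "pot (seq x y z (k - 1) (t + 1) 0)"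
      using that IH[of "k - 1" "t + 1" 0 x y z] IH[of "k - 1" "t + 1" 0 y x z] IH[of "k - 1" "t + 1" 0 y z x] k3
        seq_swap(1)[of x y z "k - 1" "t + 1" 0] seq_swap(2)[of y z x "k - 1" "t + 1" 0] by auto
    then show ?thesis using pot_add2_3[of x y z "k - 1" t 0] k3 by simp
  qed
  have a2: "pot (seq (x + 1) y z k (t + 1) 0)" if "1 \<le> t" "good x y z k (t - 1) 1 \<or> good y x z k (t - 1) 1" for x y z
  proof -
    have "pot (seq x y z k (t - 1) 1)"
      using that IH[of k "t - 1" 1 x y z] IH[of k "t - 1" 1 y x z] seq_swap(1)[of x y z k "t - 1" 1] by auto
    then show ?thesis using pot_add2_2[of x y z k "t - 1" 0] that by (simp add: numeral_2_eq_2)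
  qed
  have a33: ?thesis if "5 \<le> k" "good a b c (k - 2) (t + 2) 0"
  proof -
    have "2 \<le> k" using that(1) by simp
    then obtain k' where "k = k' + 2" by (metis add.commute le_Suc_ex)
    with pot_add2_33[OF IH[of k' "t + 2" 0]] that show ?thesis by simp
  qed
  have a32: ?thesis if "1 \<le> t" "4 \<le> k" "good a b c (k - 1) t 1"
  proof -
    have "k \<noteq> 0" "t \<noteq> 0" using that by auto
    then obtain k' t' where "k = k' + 1" "t = t' + 1" by (metis Suc_eq_plus1 not0_implies_Suc)
    with pot_add2_32[of a b c k' t' 0] IH[of k' t 1] that show ?thesis by simp
  qed
  have a22: ?thesis if "2 \<le> t" "good a b c k (t - 2) 2"
  proof -
    from that(1) obtain t' where t': "t = t' + 2" by (metis add.commute le_Suc_ex)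
    have "pot (seq a b c k t' 2)" using IH[of k t' 2] that t' by simp
    then have "pot (seq a b c k (t' + 3) 0)" using pot_add2_22[of a b c k t' 0] by (simp only: add_0)
    moreover have "t + 1 = t' + 3" using t' by simp
    ultimately show ?thesis by (simp only:)
  qed
  consider (ab) "c < b" | (ac) "b < a" "b = c" "3 < c" | (bc) "a = b" "b = c" "3 < c"
    | (a) "3 < a" "b = 3" "c = 3" | (n) "a = 3" "b = 3" "c = 3"
    using ord by linarith
  then show ?thesis
  proof cases
    case ab
    have "a \<noteq> 0" "b \<noteq> 0" using ab ord by auto
    then obtain a' b' where ab': "a = a' + 1" "b = b' + 1" by (metis Suc_eq_plus1 not0_implies_Suc)
    have ?thesis if "good a' b' c k t 0"
      using pot_add2[OF IH[OF _ that]] ab' by simp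
    with good_add2_ab[of a' b' c k t] g ab ab' a3[of a' b c] a2[of a' b c] a33 show ?thesis by auto
  next
    case ac
    have "a \<noteq> 0" "c \<noteq> 0" using ac ord by auto
    then obtain a' c' where ac': "a = a' + 1" "c = c' + 1" by (metis Suc_eq_plus1 not0_implies_Suc)
    have ?thesis if "good a' (c' + 1) c' k t 0"
    proof -
      have "pot (seq a' c' (c' + 1) k t 0)" using IH[OF _ that] by (simp add: seq_swap)
      from pot_add2[OF this] show ?thesis using ac ac' by simp
    qed
    with good_add2_ac[of a' c' k t] g ac ac' a3[of a' b c] a2[of a' b c] show ?thesis by auto
  next
    case bc
    obtain c' where c': "c = c' + 1" using bc ord by (cases c) auto
    have ?thesis if "good (c' + 1) c' c' k t 0"
    proof -
      have "pot (seq c' c' (c' + 1) k t 0)" using IH[OF _ that] seq_swap(1)[of c' "c' + 1" c'] seq_swap(2)[of c' c' "c' + 1"] by simp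
      from pot_add2[OF this] show ?thesis using bc c' by simp
    qed
    with good_add2_bc[of c' k t] g bc c' a3[of c' b c] show ?thesis by auto
  next
    case a
    obtain a' where a': "a = a' + 1" using a by (cases a) auto
    with good_add2_a33[of a' k t] g a a3[of a' 3 3] a2[of a' 3 3] a33 a32 show ?thesis by auto
  next
    case n
    with good_add2_333[of k t] g a33 a22 show ?thesis by auto
  qed
qed

section \<open>Removing a term 3 when no term is smaller\<close>

lemma good_add3_abc:
  assumes "good (a + 1) (b + 1) (c + 1) (k + 1) 0 0" and "3 \<le> c" and k: "3 \<le> k"
  shows "good a b c k 0 0 \<or> 4 \<le> k \<and> (good a b (c + 1) (k - 1) 1 0 \<or> good a (b + 1) c (k - 1) 1 0) \<or>
    5 \<le> k \<and> (good a (b + 1) (c + 1) (k - 2) 2 0 \<or> good (a + 1) (b + 1) c (k - 2) 2 0)"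
\<comment> \<open>On \<open>k + 3\<close> vertices, \<open>a = k + 2\<close> means adjacency to all
  others and demands \<open>c \<ge> 4\<close>. In this bad case \<open>b\<close> is odd: for
  \<open>b = 3\<close> two surplus threes replace \<open>b\<close> and \<open>c\<close> as
  neighbours, and for \<open>b \<ge> 5\<close> one surplus 3 replaces \<open>c\<close>.\<close>
proof (cases "a = k + 2 \<and> c = 3")
  case True
  then have a: "a = k + 2" "c = 3" and b: "3 \<le> b" "b \<le> k + 1" "odd b"
    using assms by (auto simp: good_def lin_def)
  show ?thesis
  proof (cases "b = 3")
    case True
    have "k \<noteq> 3" "k \<noteq> 4" using assms True a by (auto simp: good_def lin_def sporadic_def)
    then have "5 \<le> k" using k by simp
    then obtain k' where k': "k = k' + 5" by (metis add.commute le_Suc_ex)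
    have "good a (b + 1) (c + 1) (k - 2) 2 0"
      using assms True a unfolding k' good_def lin_def sporadic_def by auto
    then show ?thesis using k' by simp
  next
    case False
    have "b \<noteq> 4" using b(3) by auto
    then have "5 \<le> b" using b(1) False by simp
    then have "4 \<le> k" using b by simp
    then obtain k' where k': "k = k' + 4" by (metis add.commute le_Suc_ex)
    have "good a b (c + 1) (k - 1) 1 0"
      using assms a b \<open>5 \<le> b\<close> unfolding k' good_def lin_def sporadic_def by auto
    then show ?thesis using k' by simp
  qed
next
  case False
  then have "a = k + 2 \<longrightarrow> c \<noteq> 3" by blast
  moreover have "4 \<le> c" if "a + b = 2 * k + 3"
  proof -
    have "a \<le> k + 2" "b \<le> a" using assms by (auto simp: good_def lin_def)
    with that have "a = k + 2" by linarith
    with False assms show ?thesis by auto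
  qed
  moreover have "4 \<le> b" if "a = k + 1"
  proof (rule ccontr)
    assume "\<not> 4 \<le> b"
    with assms have "b = 3" "c = 3" by (auto simp: good_def lin_def)
    with that assms show False by (auto simp: good_def lin_def)
  qed
  ultimately have "lin a b c k 0 0"
    using assms unfolding good_def lin_def
    by (elim conjE, intro conjI impI; ((simp; fail) | linarith | (erule mp, linarith)))
  moreover have "list_all (\<lambda>(a, b, c, k, t). t = 0 \<longrightarrow> good (a + 1) (b + 1) (c + 1) (k + 1) 0 0 \<longrightarrow>
      4 \<le> k \<and> (good a b (c + 1) (k - 1) 1 0 \<or> good a (b + 1) c (k - 1) 1 0) \<or>
      5 \<le> k \<and> (good a (b + 1) (c + 1) (k - 2) 2 0 \<or> good (a + 1) (b + 1) c (k - 2) 2 0)) sporadic_no_leaf"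
    by code_simp
  then have ?thesis if "sporadic a b c k 0 0"
    using sporadic_no_leaf[OF that] assms unfolding list_all_iff by fast
  ultimately show ?thesis unfolding good_def by blast
qed

text \<open>As \<open>c = 3\<close> cannot drop, the neighbours are \<open>a\<close>,
  \<open>b\<close> and one surplus 3, or \<open>a\<close> and two of them, or three of them.\<close>

lemma good_add3_ab:
  assumes "good (a + 1) (b + 1) 3 (k + 1) 0 0" and "3 \<le> b" and k: "3 \<le> k"
  shows "4 \<le> k \<and> good a b 3 (k - 1) 1 0 \<or>
    5 \<le> k \<and> good a (b + 1) 3 (k - 2) 2 0 \<or> 6 \<le> k \<and> good (a + 1) (b + 1) 3 (k - 3) 3 0"
proof -
  \<comment> \<open>Here bounds and parity leave only 5, 4 followed by five threes, which is
    sporadic.\<close>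
  have "k \<noteq> 3"
  proof
    assume 3: "k = 3"
    then have "a \<le> 4" "b \<le> a" "odd (a + b)" and s: "\<not> sporadic (a + 1) (b + 1) 3 4 0 0"
      using assms by (auto simp: good_def lin_def sporadic_def)
    with assms(2) have "a = 4 \<and> b = 3" by presburger
    with s show False by (simp add: sporadic_def)
  qed
  with k have k4: "4 \<le> k" by simp
  show ?thesis
  proof (cases "a = k + 1 \<and> b = 3")
    case True
    then have "k \<noteq> 4" using assms by (auto simp: good_def sporadic_def)
    then have "5 \<le> k" using k4 by simp
    then obtain k' where k': "k = k' + 5" by (metis add.commute le_Suc_ex)
    have "good a (b + 1) 3 (k - 2) 2 0"
      using assms True unfolding k' good_def lin_def sporadic_def by auto
    then show ?thesis using k' by simp
  next
    case False
    then have "a = k + 1 \<longrightarrow> b \<noteq> 3" by blast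
    obtain k' where k': "k = k' + 4" using k4 by (metis add.commute le_Suc_ex)
    have "lin a b 3 (k' + 3) 1 0"
      using assms False unfolding good_def lin_def k' by auto
    moreover have "list_all (\<lambda>(a, b, c, k, t). t = 1 \<longrightarrow> c = 3 \<longrightarrow> good (a + 1) (b + 1) 3 (k + 2) 0 0 \<longrightarrow>
        4 \<le> k \<and> good a (b + 1) 3 (k - 1) 2 0 \<or> 5 \<le> k \<and> good (a + 1) (b + 1) 3 (k - 2) 3 0) sporadic_no_leaf"
      by code_simp
    then have "4 \<le> k' + 3 \<and> good a (b + 1) 3 (k' + 3 - 1) 2 0 \<or> 5 \<le> k' + 3 \<and> good (a + 1) (b + 1) 3 (k' + 3 - 2) 3 0"
      if "sporadic a b 3 (k' + 3) 1 0"
      using sporadic_no_leaf[OF that] assms unfolding list_all_iff k'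
      by (auto simp: add.commute dest!: bspec)
    ultimately show ?thesis unfolding good_def k' by (auto simp: add.commute)
  qed
qed

lemma pot_step_3:
  assumes g: "good a b c (k + 1) 0 0" and k: "3 \<le> k"
    and IH: "\<And>a b c k' t' m'. k' + t' + m' < k + 1 \<Longrightarrow> good a b c k' t' m' \<Longrightarrow> pot (seq a b c k' t' m')"
  shows "pot (seq a b c (k + 1) 0 0)"
proof -
  have ord: "b \<le> a" "c \<le> b" "3 \<le> c" using g by (auto simp: good_def lin_def)
  have ab3: "pot (seq (x + 1) (y + 1) z (k + 1) 0 0)"
    if "4 \<le> k" "good x y z (k - 1) 1 0 \<or> good x z y (k - 1) 1 0 \<or> good z x y (k - 1) 1 0" for x y z
  proof -
    have "pot (seq x y z (k - 1) 1 0)"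
      using that IH[of "k - 1" 1 0 x y z] IH[of "k - 1" 1 0 x z y] IH[of "k - 1" 1 0 z x y]
        seq_swap(2)[of x y z "k - 1" 1 0] seq_swap(1)[of x z y "k - 1" 1 0] by auto
    then have "pot (seq (x + 1) (y + 1) z (k - 1 + 2) 0 0)" using pot_add3_3[of x y z "k - 1" 0 0] by simp
    moreover have "k - 1 + 2 = k + 1" using k by simp
    ultimately show ?thesis by (simp only:)
  qed
  have a33: "pot (seq (x + 1) y z (k + 1) 0 0)"
    if "5 \<le> k" "good x y z (k - 2) 2 0 \<or> good y z x (k - 2) 2 0" for x y z
  proof -
    have "pot (seq x y z (k - 2) 2 0)"
      using that IH[of "k - 2" 2 0 x y z] IH[of "k - 2" 2 0 y z x]
        seq_swap(1)[of x y z "k - 2" 2 0] seq_swap(2)[of y z x "k - 2" 2 0] by auto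
    then have "pot (seq (x + 1) y z (k - 2 + 3) 0 0)" using pot_add3_33[of x y z "k - 2" 0 0] by (simp only: add_0)
    moreover have "k - 2 + 3 = k + 1" using k by simp
    ultimately show ?thesis by (simp only:)
  qed
  have a333: "pot (seq x y z (k + 1) 0 0)" if "6 \<le> k" "good x y z (k - 3) 3 0" for x y z
  proof -
    have "pot (seq x y z (k - 3) 3 0)" using that IH[of "k - 3" 3 0 x y z] by auto
    then have "pot (seq x y z (k - 3 + 4) 0 0)" using pot_add3_333[of x y z "k - 3" 0 0] by (simp only: add_0)
    moreover have "k - 3 + 4 = k + 1" using k by simp
    ultimately show ?thesis by (simp only:)
  qed
  consider (abc) "3 < c" | (ab) "3 < b" "c = 3" | (a) "3 < a" "b = 3" "c = 3" | (n) "a = 3" "b = 3" "c = 3"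
    using ord by linarith
  then show ?thesis
  proof cases
    case abc
    then have "a \<noteq> 0" "b \<noteq> 0" "c \<noteq> 0" using ord by auto
    then obtain a' b' c' where abc': "a = a' + 1" "b = b' + 1" "c = c' + 1" by (metis Suc_eq_plus1 not0_implies_Suc)
    have s: "seq (b' + 1) (a' + 1) (c' + 1) l t m = seq (a' + 1) (b' + 1) (c' + 1) l t m"
      "seq (c' + 1) (a' + 1) (b' + 1) l t m = seq (a' + 1) (b' + 1) (c' + 1) l t m"
      "seq (a' + 1) (c' + 1) (b' + 1) l t m = seq (a' + 1) (b' + 1) (c' + 1) l t m" for l t m
      by (simp_all add: seq_def add_mset_commute)
    have "pot (seq a b c (k + 1) 0 0)" if "good a' b' c' k 0 0"
      using pot_add3[OF IH[OF _ that]] abc' by simp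
    moreover have "pot (seq a b c (k + 1) 0 0)" if "5 \<le> k" "good (a' + 1) (b' + 1) c' (k - 2) 2 0"
      using a33[of c' "a' + 1" "b' + 1"] that abc' s by simp
    moreover have "pot (seq a b c (k + 1) 0 0)" if "5 \<le> k" "good a' (b' + 1) (c' + 1) (k - 2) 2 0"
      using a33[of a' "b' + 1" "c' + 1"] that abc' by simp
    moreover have "pot (seq a b c (k + 1) 0 0)" if "4 \<le> k" "good a' b' (c' + 1) (k - 1) 1 0"
      using ab3[of a' b' "c' + 1"] that abc' by simp
    moreover have "pot (seq a b c (k + 1) 0 0)" if "4 \<le> k" "good a' (b' + 1) c' (k - 1) 1 0"
      using ab3[of a' c' "b' + 1"] that abc' s by simp
    ultimately show ?thesis using good_add3_abc[of a' b' c' k] g k abc abc' by auto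
  next
    case ab
    then have "a \<noteq> 0" "b \<noteq> 0" using ord by auto
    then obtain a' b' where ab': "a = a' + 1" "b = b' + 1" by (metis Suc_eq_plus1 not0_implies_Suc)
    with good_add3_ab[of a' b' k] g k ab ab3[of a' b' 3] a33[of a' "b' + 1" 3] a333[of "a' + 1" "b' + 1" 3]
    show ?thesis by auto
  next
    case a
    have f: "a \<le> k + 1" "odd (a + k)" "\<not> sporadic a 3 3 (k + 1) 0 0"
      using g a by (auto simp: good_def lin_def)
    have "k \<noteq> 3"
    proof
      assume "k = 3"
      with f(1) a have "a = 4" by simp
      with f(3) \<open>k = 3\<close> show False by (simp add: sporadic_def)
    qed
    moreover have "k \<noteq> 4"
    proof
      assume "k = 4"
      with f(1,2) a have "a = 5" by presburger
      with f(3) \<open>k = 4\<close> show False by (simp add: sporadic_def)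
    qed
    ultimately have "k \<noteq> 3" "k \<noteq> 4" by blast+
    with k have "5 \<le> k" by simp
    obtain a' where a': "a = a' + 1" using a by (cases a) auto
    from \<open>5 \<le> k\<close> obtain k' where k': "k = k' + 5" by (metis add.commute le_Suc_ex)
    have "good a' 3 3 (k - 2) 2 0"
      using g a unfolding a' k' good_def lin_def sporadic_def by auto
    with a33[of a' 3 3] \<open>5 \<le> k\<close> a a' show ?thesis by simp
  next
    case n
    have "even k" "k \<noteq> 4" using g n by (auto simp: good_def lin_def sporadic_def)
    with k have "6 \<le> k" by presburger
    then obtain k' where k': "k = k' + 6" by (metis add.commute le_Suc_ex)
    have "good 3 3 3 (k - 3) 3 0"
      using g n unfolding k' good_def lin_def sporadic_def by auto
    with a333[of 3 3 3] \<open>6 \<le> k\<close> n show ?thesis by simp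
  qed
qed

theorem good_imp_pot: "good a b c k t m \<Longrightarrow> pot (seq a b c k t m)"
proof (induction "k + t + m" arbitrary: a b c k t m rule: less_induct)
  case less
  have k3: "3 \<le> k" using less.prems by (simp add: good_def lin_def)
  consider (m) m' where "m = m' + 1" | (t) t' where "m = 0" "t = t' + 1" | (k) k' where "m = 0" "t = 0" "k = k' + 1" "3 \<le> k'"
    | (b) "m = 0" "t = 0" "k = 3"
  proof -
    assume *: "\<And>m'. m = m' + 1 \<Longrightarrow> thesis" "\<And>t'. m = 0 \<Longrightarrow> t = t' + 1 \<Longrightarrow> thesis"
      "\<And>k'. m = 0 \<Longrightarrow> t = 0 \<Longrightarrow> k = k' + 1 \<Longrightarrow> 3 \<le> k' \<Longrightarrow> thesis"
      "m = 0 \<Longrightarrow> t = 0 \<Longrightarrow> k = 3 \<Longrightarrow> thesis"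
    show thesis
    proof (cases m)
      case (Suc m') then show ?thesis using *(1)[of m'] by simp
    next
      case m0: 0
      show ?thesis
      proof (cases t)
        case (Suc t') then show ?thesis using *(2)[of t'] m0 by simp
      next
        case 0
        have "k = 3 \<or> k = k - 1 + 1 \<and> 3 \<le> k - 1" using k3 by linarith
        then show ?thesis using *(3,4) m0 0 by blast
      qed
    qed
  qed
  then show ?case
  proof cases
    case m
    show ?thesis unfolding m
    proof (rule pot_step_1)
      show "good a b c k t (m' + 1)" using less.prems m by simp
    qed (use m less.hyps in auto)
  next
    case t
    show ?thesis unfolding t
    proof (rule pot_step_2)
      show "good a b c k (t' + 1) 0" using less.prems t by simp
    qed (use t less.hyps in auto)
  next
    case k
    show ?thesis unfolding k(1-3)
    proof (rule pot_step_3)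
      show "good a b c (k' + 1) 0 0" using less.prems k by simp
    qed (use k less.hyps in auto)
  next
    case b
    then have abc: "a \<le> 5" "b \<le> a" "c \<le> b" "3 \<le> c" "a = 5 \<longrightarrow> 4 \<le> c" "a = 4 \<longrightarrow> 4 \<le> b"
      "a + b \<le> 9" "a + b + c \<le> 13" "even (a + b + c + 3)"
      using less.prems by (auto simp: good_def lin_def)
    have "a = 3 \<and> b = 3 \<and> c = 3 \<or> a = 4 \<and> b = 4 \<and> c = 3 \<or> a = 5 \<and> b = 4 \<and> c = 4"
      using abc by presburger
    then show ?thesis using b pot_order_6 by auto
  qed
qed

section \<open>Sequences whose fourth term is at least four\<close>

text \<open>Deleting the vertex and attaching it to the same terms undo each other, because the
  lowered terms were positive.\<close>

lemma pot_remove_top: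
  assumes "graphical ({#size D#} + D + R)" and "\<And>x y. x \<in># D \<Longrightarrow> y \<in># R \<Longrightarrow> y \<le> x"
    and "graphical (image_mset (\<lambda>x. x - 1) D + R) \<Longrightarrow> pot (image_mset (\<lambda>x. x - 1) D + R)"
  shows "pot ({#size D#} + D + R)"
proof -
  from graphical_remove[OF assms(1,2)]
  have gr: "graphical (image_mset (\<lambda>x. x - 1) D + R)" and pos: "\<forall>x \<in># D. 1 \<le> x" by auto
  have "image_mset Suc (image_mset (\<lambda>x. x - 1) D) = image_mset (\<lambda>x. x) D"
    unfolding multiset.map_comp by (rule image_mset_cong) (use pos in auto)
  with pot_add_vertex[OF assms(3)[OF gr]] show ?thesis by simp
qed

text \<open>Counting terms expresses \<open>d 4 \<ge> 4\<close> and \<open>d 6 \<ge> 3\<close>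
  without sorting the sequence again after its largest terms are lowered.\<close>

definition big :: "nat multiset \<Rightarrow> bool" where
  "big M \<longleftrightarrow> 4 \<le> size {#x \<in># M. 4 \<le> x#} \<and> 6 \<le> size {#x \<in># M. 3 \<le> x#}"

lemma bigI:
  assumes "4 \<le> a" "4 \<le> b" "4 \<le> c" "4 \<le> d" "3 \<le> e" "3 \<le> f"
  shows "big ({#a, b, c, d, e, f#} + M)"
proof -
  have "3 \<le> a" "3 \<le> b" "3 \<le> c" "3 \<le> d" using assms by linarith+
  then show ?thesis using assms unfolding big_def by (simp split: if_split)
qed

lemma big_sorted:
  assumes "big (mset (y1 # y2 # y3 # y4 # y5 # y6 # ys))"
    and "sorted_wrt (\<ge>) (y1 # y2 # y3 # y4 # y5 # y6 # ys)"
  shows "4 \<le> y4" "3 \<le> y6"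
proof -
  show "4 \<le> y4"
  proof (rule ccontr)
    assume "\<not> 4 \<le> y4"
    then have z: "filter_mset ((\<le>) 4) (mset ys) = {#}" and h: "\<not> 4 \<le> y5" "\<not> 4 \<le> y6"
      using assms(2) by (force simp: filter_mset_eq_conv)+
    have "size (filter_mset ((\<le>) 4) (mset (y1 # y2 # y3 # y4 # y5 # y6 # ys))) \<le> 3"
      using \<open>\<not> 4 \<le> y4\<close> by (simp add: z h)
    with assms(1) show False unfolding big_def by linarith
  qed
  show "3 \<le> y6"
  proof (rule ccontr)
    assume "\<not> 3 \<le> y6"
    then have z: "filter_mset ((\<le>) 3) (mset ys) = {#}"
      using assms(2) by (force simp: filter_mset_eq_conv)
    have "size (filter_mset ((\<le>) 3) (mset (y1 # y2 # y3 # y4 # y5 # y6 # ys))) \<le> 5"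
      using \<open>\<not> 3 \<le> y6\<close> by (simp add: z)
    with assms(1) show False unfolding big_def by linarith
  qed
qed

lemma graphical_seq:
  assumes "graphical (seq a b c k t m)"
  shows "even (a + b + c + k + m)" "a \<le> k + t + m + 2" "b \<le> k + t + m + 2"
proof -
  have "even (sum_mset (seq a b c k t m))" by (rule graphical_even[OF assms])
  then show "even (a + b + c + k + m)" by (simp add: seq_def) blast
  have "size (seq a b c k t m) = k + t + m + 3" by (simp add: seq_def)
  then show "a \<le> k + t + m + 2" "b \<le> k + t + m + 2"
    using graphical_less_size[OF assms, of a] graphical_less_size[OF assms, of b] by (auto simp: seq_def)
qed

lemma small_mset:
  assumes "\<And>x. x \<in># Y \<Longrightarrow> 1 \<le> x \<and> x \<le> (3 :: nat)"
  shows "\<exists>k t m. Y = replicate_mset k 3 + replicate_mset t 2 + replicate_mset m 1 \<and>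
    ((\<forall>x \<in># Y. 2 \<le> x) \<longrightarrow> m = 0) \<and> ((\<forall>x \<in># Y. 3 \<le> x) \<longrightarrow> m = 0 \<and> t = 0)"
proof -
  let ?k = "count Y 3" and ?t = "count Y 2" and ?m = "count Y 1"
  have "Y = replicate_mset ?k 3 + replicate_mset ?t 2 + replicate_mset ?m 1"
  proof (rule multiset_eqI)
    fix x
    show "count Y x = count (replicate_mset ?k 3 + replicate_mset ?t 2 + replicate_mset ?m 1) x"
    proof (cases "x \<in># Y")
      case True
      then have "x = 1 \<or> x = 2 \<or> x = 3" using assms[of x] by linarith
      then show ?thesis by auto
    next
      case False
      then show ?thesis by (auto simp: not_in_iff)
    qed
  qed
  moreover have "(\<forall>x \<in># Y. 2 \<le> x) \<longrightarrow> ?m = 0" "(\<forall>x \<in># Y. 3 \<le> x) \<longrightarrow> ?m = 0 \<and> ?t = 0"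
    by (auto simp: count_eq_zero_iff)
  ultimately show ?thesis by blast
qed

section \<open>Sequences for which lowering the largest terms leads to an exception\<close>

lemma pot_special_7: "pot {#6, 4, 4, 4, 3, 3, 2#}"
proof -
  have "pot ({#5, 3#} + {#4, 4, 3, 3#})"
    using pot_order_6(3) by (simp add: seq_def add_mset_commute numeral_3_eq_3)
  from pot_add_vertex[OF this] show ?thesis by (simp add: add_mset_commute eval_nat_numeral)
qed

text \<open>Deleting the 2 and lowering the 7 and a 4 would leave the sporadic 6, 4, 4, 3, 3, 3, 3.
  So the vertex of degree 2 is joined to the 7 and to a 3. The sequence after this one is treated
  alike.\<close>

lemma pot_special_8: "pot {#7, 4, 4, 4, 3, 3, 3, 2#}"
proof -
  have "pot ({#6, 2#} + {#4, 4, 4, 3, 3#})" using pot_special_7 by (simp add: add_mset_commute)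
  from pot_add_vertex[OF this] show ?thesis by (simp add: add_mset_commute eval_nat_numeral)
qed

lemma pot_special_9: "pot {#8, 4, 4, 4, 3, 3, 3, 3, 2#}"
proof -
  have "pot ({#7, 2#} + {#4, 4, 4, 3, 3, 3#})" using pot_special_8 by (simp add: add_mset_commute)
  from pot_add_vertex[OF this] show ?thesis by (simp add: add_mset_commute eval_nat_numeral)
qed

text \<open>
  For this family, deleting a 3 and decreasing the three largest terms gives a sequence that is not
  potentially prism-graphic, so two vertices are attached at a time instead.
\<close>

lemma pot_two_dominating: "pot ({#2 * j + 5, 2 * j + 5, 4, 4#} + replicate_mset (2 * j + 2) 3)"
proof (induction j)
  case 0
  show ?case
    using pot_prism_rim[of "\<lambda>i. i \<noteq> 0 \<and> i \<noteq> 1 \<and> i \<noteq> 2"] by (simp add: add_mset_commute eval_nat_numeral)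
next
  case (Suc j)
  from Suc have "pot ({#2 * j + 5, 2 * j + 5#} + ({#4, 4#} + replicate_mset (2 * j + 2) 3))"
    by (simp add: add_mset_commute eval_nat_numeral)
  from pot_add_vertex[OF this]
  have "pot ({#2 * j + 6, 2 * j + 6, 2#} + ({#4, 4#} + replicate_mset (2 * j + 2) 3))"
    by (simp add: add_mset_commute eval_nat_numeral)
  \<comment> \<open>The second new vertex also joins the first one, so that both end with degree
    3.\<close>
  from pot_add_vertex[OF this] show ?case by (simp add: add_mset_commute eval_nat_numeral)
qed

text \<open>Parity and the bound 5 leave ten sequences. Eight are prisms with rim edges; in the
  other two at least four vertices are adjacent to all others, which forbids a term 3.\<close>

lemma pot_order_6_big:
  assumes gr: "graphical {#y1, y2, y3, y4, y5, y6#}"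
    and y: "y2 \<le> y1" "y3 \<le> y2" "y4 \<le> y3" "y5 \<le> y4" "y6 \<le> y5" "4 \<le> y4" "3 \<le> y6"
  shows "pot {#y1, y2, y3, y4, y5, y6#}"
proof -
  have y5: "y1 \<le> 5" using graphical_less_size[OF gr, of y1] by simp
  have ev: "even (y1 + y2 + y3 + y4 + y5 + y6)" using graphical_even[OF gr] by (simp add: add.assoc)
  have n1: "\<not> graphical {#5, 5, 5, 5, 3, 3#}"
  proof
    assume "graphical {#5, 5, 5, 5, 3, 3#}"
    then have "graphical {#4, 4, 4, 2, 2#}" using graphical_remove[of "{#5, 5, 5, 3, 3#}" "{#}"] by (simp add: add_mset_commute eval_nat_numeral)
    then have "graphical {#3, 3, 1, 1#}" using graphical_remove[of "{#4, 4, 2, 2#}" "{#}"] by (simp add: add_mset_commute eval_nat_numeral)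
    then have "graphical {#2, 0, 0#}" using graphical_remove[of "{#3, 1, 1#}" "{#}"] by (simp add: add_mset_commute eval_nat_numeral)
    then show False using graphical_remove[of "{#0, 0#}" "{#}"] by (simp add: add_mset_commute eval_nat_numeral)
  qed
  have n2: "\<not> graphical {#5, 5, 5, 5, 5, 3#}"
  proof
    assume "graphical {#5, 5, 5, 5, 5, 3#}"
    then have "graphical {#4, 4, 4, 4, 2#}" using graphical_remove[of "{#5, 5, 5, 5, 3#}" "{#}"] by (simp add: add_mset_commute eval_nat_numeral)
    then have "graphical {#3, 3, 3, 1#}" using graphical_remove[of "{#4, 4, 4, 2#}" "{#}"] by (simp add: add_mset_commute eval_nat_numeral)
    then have "graphical {#2, 2, 0#}" using graphical_remove[of "{#3, 3, 1#}" "{#}"] by (simp add: add_mset_commute eval_nat_numeral)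
    then show False using graphical_remove[of "{#2, 0#}" "{#}"] by (simp add: add_mset_commute eval_nat_numeral)
  qed
  have "pot {#5, 5, 5, 5, 5, 5#}" "pot {#5, 5, 5, 5, 4, 4#}" "pot {#5, 5, 4, 4, 4, 4#}" "pot {#4, 4, 4, 4, 4, 4#}"
    "pot {#5, 5, 5, 4, 4, 3#}" "pot {#5, 4, 4, 4, 4, 3#}" "pot {#5, 5, 4, 4, 3, 3#}" "pot {#4, 4, 4, 4, 3, 3#}"
    using pot_prism_rim[of "\<lambda>i. True"] pot_prism_rim[of "\<lambda>i. i \<noteq> 0"]
      pot_prism_rim[of "\<lambda>i. i \<noteq> 0 \<and> i \<noteq> 2"] pot_prism_rim[of "\<lambda>i. i \<noteq> 0 \<and> i \<noteq> 2 \<and> i \<noteq> 4"]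
      pot_prism_rim[of "\<lambda>i. i \<noteq> 0 \<and> i \<noteq> 1"] pot_prism_rim[of "\<lambda>i. i \<noteq> 0 \<and> i \<noteq> 1 \<and> i \<noteq> 3"]
      pot_prism_rim[of "\<lambda>i. i \<noteq> 0 \<and> i \<noteq> 1 \<and> i \<noteq> 2"] pot_prism_rim[of "\<lambda>i. i \<noteq> 0 \<and> i \<noteq> 1 \<and> i \<noteq> 3 \<and> i \<noteq> 4"]
    by (simp_all add: add_mset_commute eval_nat_numeral)
  note P = this
  have four: "x = 4 \<or> x = 5" if "4 \<le> x" "x \<le> 5" for x :: nat using that by linarith
  have three: "x = 3 \<or> x = 4 \<or> x = 5" if "3 \<le> x" "x \<le> 5" for x :: nat using that by linarith
  have "y1 = 4 \<or> y1 = 5" "y2 = 4 \<or> y2 = 5" "y3 = 4 \<or> y3 = 5" "y4 = 4 \<or> y4 = 5"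
    "y5 = 3 \<or> y5 = 4 \<or> y5 = 5" "y6 = 3 \<or> y6 = 4 \<or> y6 = 5"
    using y y5 by (auto intro!: four three)
  then show ?thesis using ev gr n1 n2 P y
    by (elim disjE) simp_all
qed

text \<open>Lowering two fours would give the sporadic sequence of two fours and six threes; the
  vertex of degree 2 is joined to a 4 and a 3.\<close>

lemma pot_special_9_fours: "pot {#4, 4, 4, 4, 3, 3, 3, 3, 2#}"
proof -
  have "good 4 4 4 4 1 0" by code_simp
  then have "pot ({#3, 2#} + {#4, 4, 4, 3, 3, 3#})"
    using good_imp_pot by (force simp: seq_def add_mset_commute eval_nat_numeral)
  from pot_add_vertex[OF this] show ?thesis by (simp add: add_mset_commute eval_nat_numeral)
qed

text \<open>In all ten sequences, deleting a 3 and lowering the three largest terms leaves a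
  sporadic one. The vertex of degree 3 is joined to another triple, in which one neighbour is itself
  a term 3.\<close>

lemma pot_special_min_3:
  "pot {#5, 4, 4, 4, 3, 3, 3, 3, 3#}" "pot {#6, 4, 4, 4, 3, 3, 3, 3#}" "pot {#7, 4, 4, 4, 3, 3, 3, 3, 3#}"
  "pot {#7, 4, 4, 4, 4, 3, 3, 3#}" "pot {#8, 4, 4, 4, 4, 3, 3, 3, 3#}"
  "pot {#4, 4, 4, 4, 3, 3, 3, 3, 3, 3#}" "pot {#4, 4, 4, 4, 3, 3, 3, 3#}" "pot {#4, 4, 4, 4, 4, 3, 3, 3, 3#}"
  "pot {#7, 5, 4, 4, 3, 3, 3, 3#}" "pot {#8, 5, 4, 4, 3, 3, 3, 3, 3#}"
proof -
  have "good 4 4 4 4 1 0" "good 5 4 4 3 1 0" "good 6 4 4 4 1 0" "good 4 4 3 5 1 0" "good 4 4 3 3 1 0"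
    by code_simp+
  then have s: "pot (seq 4 4 4 4 1 0)" "pot (seq 5 4 4 3 1 0)" "pot (seq 6 4 4 4 1 0)" "pot (seq 4 4 3 5 1 0)"
    "pot (seq 4 4 3 3 1 0)" by (simp_all only: good_imp_pot)
  have "pot ({#4, 3, 2#} + {#4, 4, 3, 3, 3#})" "pot ({#3, 3, 2#} + {#4, 4, 4, 3, 3#})"
    using s(1) by (simp_all add: seq_def add_mset_commute eval_nat_numeral)
  note p = this[THEN pot_add_vertex]
  have "pot ({#5, 3, 2#} + {#4, 4, 3, 3#})"
    using s(2) by (simp_all add: seq_def add_mset_commute eval_nat_numeral)
  note q = this[THEN pot_add_vertex]
  have "pot ({#6, 3, 2#} + {#4, 4, 3, 3, 3#})"
    using s(3) by (simp_all add: seq_def add_mset_commute eval_nat_numeral)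
  note r = this[THEN pot_add_vertex]
  have "pot ({#3, 3, 2#} + {#4, 4, 3, 3, 3, 3#})"
    using s(4) by (simp_all add: seq_def add_mset_commute eval_nat_numeral)
  note u = this[THEN pot_add_vertex]
  have "pot ({#3, 3, 2#} + {#4, 4, 3, 3#})"
    using s(5) by (simp_all add: seq_def add_mset_commute eval_nat_numeral)
  note v = this[THEN pot_add_vertex]
  have "pot ({#6, 3, 2#} + {#4, 4, 4, 3#})" "pot ({#6, 4, 2#} + {#4, 4, 3, 3#})"
    using pot_special_7 by (simp_all add: add_mset_commute eval_nat_numeral)
  note w = this[THEN pot_add_vertex]
  have "pot ({#7, 3, 2#} + {#4, 4, 4, 3, 3#})" "pot ({#7, 4, 2#} + {#4, 4, 3, 3, 3#})"
    using pot_special_8 by (simp_all add: add_mset_commute eval_nat_numeral)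
  note x = this[THEN pot_add_vertex]
  show "pot {#5, 4, 4, 4, 3, 3, 3, 3, 3#}" "pot {#4, 4, 4, 4, 4, 3, 3, 3, 3#}"
    using p by (simp_all add: add_mset_commute eval_nat_numeral)
  show "pot {#6, 4, 4, 4, 3, 3, 3, 3#}"
    using q by (simp add: add_mset_commute eval_nat_numeral)
  show "pot {#7, 4, 4, 4, 3, 3, 3, 3, 3#}"
    using r by (simp add: add_mset_commute eval_nat_numeral)
  show "pot {#4, 4, 4, 4, 3, 3, 3, 3, 3, 3#}"
    using u by (simp add: add_mset_commute eval_nat_numeral)
  show "pot {#4, 4, 4, 4, 3, 3, 3, 3#}"
    using v by (simp add: add_mset_commute eval_nat_numeral)
  show "pot {#7, 4, 4, 4, 4, 3, 3, 3#}" "pot {#7, 5, 4, 4, 3, 3, 3, 3#}"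
    using w by (simp_all add: add_mset_commute eval_nat_numeral)
  show "pot {#8, 4, 4, 4, 4, 3, 3, 3, 3#}" "pot {#8, 5, 4, 4, 3, 3, 3, 3, 3#}"
    using x by (simp_all add: add_mset_commute eval_nat_numeral)
qed

text \<open>Here \<open>\<delta>\<close> is the smallest term, \<open>y1, \<dots>, y6\<close> are the largest ones and \<open>Y\<close> is the rest.\<close>

locale min_removal =
  fixes y1 y2 y3 y4 y5 y6 :: nat and Y :: "nat multiset" and \<delta> :: nat
  assumes gr: "graphical ({#\<delta>#} + ({#y1, y2, y3, y4, y5, y6#} + Y))"
    and ord: "y2 \<le> y1" "y3 \<le> y2" "y4 \<le> y3" "y5 \<le> y4" "y6 \<le> y5" "4 \<le> y4" "3 \<le> y6" "\<delta> \<le> y6"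
    and Y: "\<And>x. x \<in># Y \<Longrightarrow> \<delta> \<le> x \<and> x \<le> y6"
    and IH: "\<And>M. graphical M \<Longrightarrow> big M \<Longrightarrow> size M = 6 + size Y \<Longrightarrow> pot M"
begin

lemma mono:
  "y3 \<le> y1" "y4 \<le> y1" "y5 \<le> y1" "y6 \<le> y1" "y4 \<le> y2" "y5 \<le> y2" "y6 \<le> y2"
  "y5 \<le> y3" "y6 \<le> y3" "y6 \<le> y4"
  using ord by (meson order_trans)+

lemma Y_le: "x \<in># Y \<Longrightarrow> x \<le> y1 \<and> x \<le> y2 \<and> x \<le> y3 \<and> x \<le> y4 \<and> x \<le> y5 \<and> x \<le> y6"
  using Y[of x] ord mono by linarith

lemma Y_small:
  assumes "\<And>x. x \<in># Y \<Longrightarrow> x \<le> 3" "1 \<le> \<delta>"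
  obtains k t m where "Y = replicate_mset k 3 + replicate_mset t 2 + replicate_mset m 1"
    "2 \<le> \<delta> \<Longrightarrow> m = 0" "3 \<le> \<delta> \<Longrightarrow> m = 0 \<and> t = 0"
proof -
  have ge: "\<delta> \<le> x" if "x \<in># Y" for x using Y[OF that] by blast
  have "1 \<le> x \<and> x \<le> 3" if "x \<in># Y" for x using ge[OF that] assms(1)[OF that] assms(2) by linarith
  then obtain k t m where *: "Y = replicate_mset k 3 + replicate_mset t 2 + replicate_mset m 1"
    "(\<forall>x \<in># Y. 2 \<le> x) \<longrightarrow> m = 0" "(\<forall>x \<in># Y. 3 \<le> x) \<longrightarrow> m = 0 \<and> t = 0"
    using small_mset[of Y] by blast
  have "m = 0" if "2 \<le> \<delta>" using * that ge by (meson le_trans)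
  moreover have "m = 0 \<and> t = 0" if "3 \<le> \<delta>" using * that ge by (meson le_trans)
  ultimately show thesis using *(1) by (intro that)
qed

lemma Y_threes:
  assumes "\<And>x. x \<in># Y \<Longrightarrow> x \<le> 3" "\<delta> = 3"
  obtains k where "Y = replicate_mset k 3"
proof -
  have "1 \<le> \<delta>" using assms(2) by simp
  from Y_small[OF assms(1) this] obtain k t m
    where "Y = replicate_mset k 3 + replicate_mset t 2 + replicate_mset m 1" "3 \<le> \<delta> \<Longrightarrow> m = 0 \<and> t = 0"
    by metis
  then show thesis using assms(2) by (intro that) simp
qed

text \<open>The alternative to \<open>big\<close> in the last premise serves the rests whose fourth
  term has dropped to 3.\<close>

lemma pot_top:
  assumes "{#y1, y2, y3, y4, y5, y6#} + Y = D + R" and "size D = \<delta>"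
    and "\<And>x y. x \<in># D \<Longrightarrow> y \<in># R \<Longrightarrow> y \<le> x"
    and "graphical (image_mset (\<lambda>x. x - 1) D + R) \<Longrightarrow>
      big (image_mset (\<lambda>x. x - 1) D + R) \<or> pot (image_mset (\<lambda>x. x - 1) D + R)"
  shows "pot ({#\<delta>#} + ({#y1, y2, y3, y4, y5, y6#} + Y))"
proof -
  have s: "size (image_mset (\<lambda>x. x - 1) D + R) = 6 + size Y"
    using arg_cong[OF assms(1), of size] by simp
  have "pot ({#size D#} + D + R)"
  proof (rule pot_remove_top)
    show "graphical ({#size D#} + D + R)" using gr by (simp only: assms(1,2) add.assoc)
    show "pot (image_mset (\<lambda>x. x - 1) D + R)" if "graphical (image_mset (\<lambda>x. x - 1) D + R)"
      using assms(4)[OF that] IH[OF that _ s] by blast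
  qed (rule assms(3))
  then show ?thesis by (simp only: assms(1,2) add.assoc)
qed

lemma pot_min_1:
  assumes "\<delta> = 1"
  shows "pot ({#\<delta>#} + ({#y1, y2, y3, y4, y5, y6#} + Y))"
proof (rule pot_top)
  let ?N = "image_mset (\<lambda>x. x - 1) {#y1#} + ({#y2, y3, y4, y5, y6#} + Y)"
  assume g: "graphical ?N"
  \<comment> \<open>Either \<open>y1\<close> stays at least 4 when lowered, or \<open>y5\<close>
    takes its place among the four large terms, or there are exactly four fours and the rest falls
    to the case of fourth term 3.\<close>
  consider (a) "5 \<le> y1" | (b) "4 \<le> y5" | (c) "y1 = 4" "y5 = 3" using ord by linarith
  then show "big ?N \<or> pot ?N"
  proof cases
    case a
    then have "big ({#y1 - 1, y2, y3, y4, y5, y6#} + Y)" using ord by (intro bigI) linarith+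
    then show ?thesis by (simp add: add_mset_commute)
  next
    case b
    then have "big ({#y2, y3, y4, y5, y1 - 1, y6#} + Y)" using ord by (intro bigI) linarith+
    then show ?thesis by (simp add: add_mset_commute)
  next
    case c
    then have y: "y1 = 4" "y2 = 4" "y3 = 4" "y4 = 4" "y5 = 3" "y6 = 3" using ord by linarith+
    then obtain k t m where Y': "Y = replicate_mset k 3 + replicate_mset t 2 + replicate_mset m 1"
      using Y_small Y_le assms by (metis le_refl)
    have "?N = seq 4 4 4 (k + 3) t m" unfolding Y' y
      by (simp add: seq_def add_mset_commute eval_nat_numeral)
    moreover from this g have "good 4 4 4 (k + 3) t m"
      using graphical_seq(1)[of 4 4 4 "k + 3" t m] by (auto simp: good_def lin_def sporadic_def)
    ultimately show ?thesis using good_imp_pot by metis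
  qed
next
  fix x y assume "x \<in># {#y1#}" "y \<in># {#y2, y3, y4, y5, y6#} + Y"
  then have "x = y1 \<or> x = y1" "y = y2 \<or> y = y3 \<or> y = y4 \<or> y = y5 \<or> y = y6 \<or> y \<in># Y" by auto
  then show "y \<le> x" using ord mono Y_le[of y] by (elim disjE) simp_all
qed (simp_all add: assms)

lemma pot_min_2:
  assumes "\<delta> = 2"
  shows "pot ({#\<delta>#} + ({#y1, y2, y3, y4, y5, y6#} + Y))"
proof -
  let ?M = "{#\<delta>#} + ({#y1, y2, y3, y4, y5, y6#} + Y)"
  let ?N = "image_mset (\<lambda>x. x - 1) {#y1, y2#} + ({#y3, y4, y5, y6#} + Y)"
  \<comment> \<open>The disjunct \<open>pot ?M\<close> is for the few sequences whose
    \<open>?N\<close> is sporadic; they are realized without \<open>?N\<close>.\<close>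
  have "pot ?M \<or> big ?N \<or> pot ?N" if g: "graphical ?N"
  proof -
    consider (a) "5 \<le> y2" | (b) "5 \<le> y1" "4 \<le> y5" | (c) "4 \<le> y6"
      | (s) "y2 = 4" "y6 = 3" "y5 = 3 \<or> y1 = 4 \<and> y5 = 4"
      using order_trans[OF ord(6) mono(5)] ord(1,5,7) mono(6) by linarith
    then show ?thesis
    proof cases
      case a
      then have "big ({#y1 - 1, y2 - 1, y3, y4, y5, y6#} + Y)" using ord by (intro bigI) linarith+
      then show ?thesis by (simp add: add_mset_commute)
    next
      case b
      then have "big ({#y1 - 1, y3, y4, y5, y2 - 1, y6#} + Y)" using ord by (intro bigI) linarith+
      then show ?thesis by (simp add: add_mset_commute)
    next
      case c
      then have "big ({#y3, y4, y5, y6, y1 - 1, y2 - 1#} + Y)" using ord by (intro bigI) linarith+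
      then show ?thesis by (simp add: add_mset_commute)
    next
      case s
      then have y: "y2 = 4" "y3 = 4" "y4 = 4" "y6 = 3" using ord by linarith+
      then obtain k t where Y': "Y = replicate_mset k 3 + replicate_mset t 2"
        using Y_small Y_le assms by (metis le_refl one_le_numeral add_0_right replicate_mset_0)
      show ?thesis
      proof (cases "y5 = 3")
        case y5: True
        show ?thesis
        proof (cases "y1 = 4")
          case True
          have N: "?N = seq 4 4 3 (k + 3) t 0" unfolding Y' y y5 True
            by (simp add: seq_def add_mset_commute eval_nat_numeral)
          then have e: "even k" using g graphical_seq(1)[of 4 4 3 "k + 3" t 0] by simp
          show ?thesis
          proof (cases "k = 2 \<and> t = 0")
            case True
            then show ?thesis using pot_special_9_fours assms unfolding y y5 Y' \<open>y1 = 4\<close>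
              by (simp add: add_mset_commute eval_nat_numeral)
          next
            case False
            then have "good 4 4 3 (k + 3) t 0" using e by (auto simp: good_def lin_def sporadic_def)
            then show ?thesis using good_imp_pot N by metis
          qed
        next
          case False
          define a where "a = y1 - 1"
          have "5 \<le> y1" using ord y False by simp
          then have a: "y1 = a + 1" "4 \<le> a" unfolding a_def by simp_all
          have N: "?N = seq a 4 4 (k + 3) t 0" unfolding Y' y y5 a
            by (simp add: seq_def add_mset_commute eval_nat_numeral)
          then have e: "even (a + k + 3)" "a \<le> k + t + 5"
            using g graphical_seq[of a 4 4 "k + 3" t 0] by auto
          have good: "good a 4 4 (k + 3) t 0" if "\<not> (a = k + 5 \<and> t = 0 \<and> (k = 1 \<or> k = 2))"
            using e a that by (auto simp: good_def lin_def sporadic_def)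
          consider "good a 4 4 (k + 3) t 0" | "a = 6" "k = 1" "t = 0" | "a = 7" "k = 2" "t = 0"
            using good by fastforce
          then show ?thesis
          proof cases
            case 1
            then show ?thesis using good_imp_pot N by metis
          next
            case 2
            then show ?thesis using pot_special_8 assms unfolding y y5 a Y'
              by (simp add: add_mset_commute eval_nat_numeral)
          next
            case 3
            then show ?thesis using pot_special_9 assms unfolding y y5 a Y'
              by (simp add: add_mset_commute eval_nat_numeral)
          qed
        qed
      next
        case False
        then have y15: "y1 = 4" "y5 = 4" using s by auto
        have "?N = seq 4 4 4 (k + 3) t 0" unfolding Y' y y15
          by (simp add: seq_def add_mset_commute eval_nat_numeral)
        moreover from this g have "good 4 4 4 (k + 3) t 0"
          using graphical_seq(1)[of 4 4 4 "k + 3" t 0] by (auto simp: good_def lin_def sporadic_def)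
        ultimately show ?thesis using good_imp_pot by metis
      qed
    qed
  qed
  moreover have "pot ?M" if "graphical ?N \<Longrightarrow> big ?N \<or> pot ?N"
  proof (rule pot_top[of "{#y1, y2#}" "{#y3, y4, y5, y6#} + Y"])
    fix x y assume "x \<in># {#y1, y2#}" "y \<in># {#y3, y4, y5, y6#} + Y"
    then have "x = y1 \<or> x = y2" "y = y3 \<or> y = y4 \<or> y = y5 \<or> y = y6 \<or> y \<in># Y" by auto
    then show "y \<le> x" using ord mono Y_le[of y] by (elim disjE) simp_all
  qed (use that in \<open>simp_all add: assms\<close>)
  ultimately show ?thesis by blast
qed

lemma pot_min_3:
  assumes "\<delta> = 3"
  shows "pot ({#\<delta>#} + ({#y1, y2, y3, y4, y5, y6#} + Y))"
proof -
  let ?M = "{#\<delta>#} + ({#y1, y2, y3, y4, y5, y6#} + Y)"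
  let ?N = "image_mset (\<lambda>x. x - 1) {#y1, y2, y3#} + ({#y4, y5, y6#} + Y)"
  have "pot ?M \<or> big ?N \<or> pot ?N" if g: "graphical ?N"
  proof -
    have y34: "4 \<le> y3" using ord by linarith
    consider (a) "5 \<le> y3" | (b) "5 \<le> y2" "4 \<le> y5" | (c) "5 \<le> y1" "4 \<le> y6"
      | (s1) "y3 = 4" "5 \<le> y2" "y5 = 3" | (s2) "y2 = 4" "5 \<le> y1" "y6 = 3"
      | (s3) "y1 = 4" "y6 = 3" | (s4) "y1 = 4" "y6 = 4"
      using y34 ord(1,2,5,7) mono(4) mono(8) by linarith
    then show ?thesis
    proof cases
      case a
      then have "big ({#y1 - 1, y2 - 1, y3 - 1, y4, y5, y6#} + Y)" using ord by (intro bigI) linarith+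
      then show ?thesis by (simp add: add_mset_commute)
    next
      case b
      then have "big ({#y1 - 1, y2 - 1, y4, y5, y3 - 1, y6#} + Y)" using ord by (intro bigI) linarith+
      then show ?thesis by (simp add: add_mset_commute)
    next
      case c
      then have "big ({#y1 - 1, y4, y5, y6, y2 - 1, y3 - 1#} + Y)" using ord by (intro bigI) linarith+
      then show ?thesis by (simp add: add_mset_commute)
    next
      case s1
      then have y: "y3 = 4" "y4 = 4" "y5 = 3" "y6 = 3" using ord by linarith+
      then obtain k where Y': "Y = replicate_mset k 3"
        using Y_threes Y_le assms by metis
      define a b where "a = y1 - 1" and "b = y2 - 1"
      have ab: "y1 = a + 1" "y2 = b + 1" "b \<le> a" "4 \<le> b" unfolding a_def b_def using s1 ord(1) by linarith+
      have N: "?N = seq a b 4 (k + 3) 0 0" unfolding Y' y ab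
        by (simp add: seq_def add_mset_commute eval_nat_numeral)
      then have e: "even (a + b + k + 7)" "a \<le> k + 5"
        using g graphical_seq[of a b 4 "k + 3" 0 0] by auto
      have good: "good a b 4 (k + 3) 0 0"
        if "\<not> (a = k + 5 \<and> b = k + 5)" "\<not> (a = k + 5 \<and> b = 4 \<and> (k = 1 \<or> k = 2))"
        using e ab that by (auto simp: good_def lin_def sporadic_def)
      consider "good a b 4 (k + 3) 0 0" | (full) "a = k + 5" "b = k + 5" | "a = 6" "b = 4" "k = 1" | "a = 7" "b = 4" "k = 2"
        using good by fastforce
      then show ?thesis
      proof cases
        case 1
        then show ?thesis using good_imp_pot N by metis
      next
        \<comment> \<open>\<open>?N\<close> would have two vertices adjacent to all others, which
          breaks the bound on \<open>a + b\<close>. Parity makes \<open>k\<close> odd, so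
          \<open>?M\<close> belongs to the family of \<open>pot_two_dominating\<close>.\<close>
        case full
        with e(1) have "odd k" by simp
        then obtain j where "k = 2 * j + 1" by (rule oddE)
        then show ?thesis using pot_two_dominating[of "j + 1"] full assms unfolding y ab Y'
          by (simp add: add_mset_commute eval_nat_numeral)
      next
        case 3
        then show ?thesis using pot_special_min_3(9) assms unfolding y ab Y'
          by (simp add: add_mset_commute eval_nat_numeral)
      next
        case 4
        then show ?thesis using pot_special_min_3(10) assms unfolding y ab Y'
          by (simp add: add_mset_commute eval_nat_numeral)
      qed
    next
      case s2
      then have y: "y2 = 4" "y3 = 4" "y4 = 4" "y6 = 3" and y5: "y5 = 3 \<or> y5 = 4" using ord by linarith+
      then obtain k where Y': "Y = replicate_mset k 3"
        using Y_threes Y_le assms by metis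
      define a where "a = y1 - 1"
      have a: "y1 = a + 1" "4 \<le> a" unfolding a_def using s2 by linarith+
      show ?thesis
      proof (cases "y5 = 3")
        case y5: True
        have N: "?N = seq a 4 3 (k + 3) 0 0" unfolding Y' y a y5
          by (simp add: seq_def add_mset_commute eval_nat_numeral)
        then have e: "even (a + k)" "a \<le> k + 5"
          using g graphical_seq[of a 4 3 "k + 3" 0 0] by auto
        then have "a \<noteq> k + 5" by auto
        then have good: "good a 4 3 (k + 3) 0 0"
          if "\<not> (a = 4 \<and> k = 2)" "\<not> (a = k + 4 \<and> (k = 1 \<or> k = 2))"
          using e a that by (auto simp: good_def lin_def sporadic_def)
        consider "good a 4 3 (k + 3) 0 0" | "a = 4" "k = 2" | "a = 5" "k = 1" | "a = 6" "k = 2"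
          using good by fastforce
        then show ?thesis
        proof cases
          case 1
          then show ?thesis using good_imp_pot N by metis
        next
          case 2
          then show ?thesis using pot_special_min_3(1) assms unfolding y a Y' y5
            by (simp add: add_mset_commute eval_nat_numeral)
        next
          case 3
          then show ?thesis using pot_special_min_3(2) assms unfolding y a Y' y5
            by (simp add: add_mset_commute eval_nat_numeral)
        next
          case 4
          then show ?thesis using pot_special_min_3(3) assms unfolding y a Y' y5
            by (simp add: add_mset_commute eval_nat_numeral)
        qed
      next
        case False
        then have y5: "y5 = 4" using y5 by simp
        have N: "?N = seq a 4 4 (k + 3) 0 0" unfolding Y' y a y5
          by (simp add: seq_def add_mset_commute eval_nat_numeral)
        then have e: "odd (a + k)" "a \<le> k + 5"
          using g graphical_seq[of a 4 4 "k + 3" 0 0] by auto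
        have good: "good a 4 4 (k + 3) 0 0" if "\<not> (a = k + 5 \<and> (k = 1 \<or> k = 2))"
          using e a that by (auto simp: good_def lin_def sporadic_def)
        consider "good a 4 4 (k + 3) 0 0" | "a = 6" "k = 1" | "a = 7" "k = 2"
          using good by fastforce
        then show ?thesis
        proof cases
          case 1
          then show ?thesis using good_imp_pot N by metis
        next
          case 2
          then show ?thesis using pot_special_min_3(4) assms unfolding y a Y' y5
            by (simp add: add_mset_commute eval_nat_numeral)
        next
          case 3
          then show ?thesis using pot_special_min_3(5) assms unfolding y a Y' y5
            by (simp add: add_mset_commute eval_nat_numeral)
        qed
      qed
    next
      case s3
      then have y: "y1 = 4" "y2 = 4" "y3 = 4" "y4 = 4" "y6 = 3" and y5: "y5 = 3 \<or> y5 = 4" using ord by linarith+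
      then obtain k where Y': "Y = replicate_mset k 3"
        using Y_threes Y_le assms by metis
      show ?thesis
      proof (cases "y5 = 3")
        case y5: True
        have N: "?N = seq 4 3 3 (k + 3) 0 0" unfolding Y' y y5
          by (simp add: seq_def add_mset_commute eval_nat_numeral)
        then have e: "odd k"
          using g graphical_seq(1)[of 4 3 3 "k + 3" 0 0] by auto
        then have "good 4 3 3 (k + 3) 0 0" if "k \<noteq> 1" "k \<noteq> 3"
          using that odd_pos[OF e] by (auto simp: good_def lin_def sporadic_def)
        then consider "good 4 3 3 (k + 3) 0 0" | "k = 3" | "k = 1" by blast
        then show ?thesis
        proof cases
          case 1
          then show ?thesis using good_imp_pot N by metis
        next
          case 2
          then show ?thesis using pot_special_min_3(6) assms unfolding y Y' y5
            by (simp add: add_mset_commute eval_nat_numeral)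
        next
          case 3
          then show ?thesis using pot_special_min_3(7) assms unfolding y Y' y5
            by (simp add: add_mset_commute eval_nat_numeral)
        qed
      next
        case False
        then have y5: "y5 = 4" using y5 by simp
        have N: "?N = seq 4 4 3 (k + 3) 0 0" unfolding Y' y y5
          by (simp add: seq_def add_mset_commute eval_nat_numeral)
        then have e: "even k"
          using g graphical_seq(1)[of 4 4 3 "k + 3" 0 0] by auto
        then have "good 4 4 3 (k + 3) 0 0" if "k \<noteq> 2"
          using that by (auto simp: good_def lin_def sporadic_def)
        then consider "good 4 4 3 (k + 3) 0 0" | "k = 2" by blast
        then show ?thesis
        proof cases
          case 1
          then show ?thesis using good_imp_pot N by metis
        next
          case 2
          then show ?thesis using pot_special_min_3(8) assms unfolding y Y' y5
            by (simp add: add_mset_commute eval_nat_numeral)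
        qed
      qed
    next
      case s4
      then have y: "y1 = 4" "y2 = 4" "y3 = 4" "y4 = 4" "y5 = 4" "y6 = 4" using ord by linarith+
      show ?thesis
      \<comment> \<open>After the decrease \<open>y4\<close>, \<open>y5\<close>, \<open>y6\<close>
        are still 4, so one more such term in \<open>Y\<close> keeps the sequence
        \<open>big\<close>.\<close>
      proof (cases "\<exists>x \<in># Y. 4 \<le> x")
        case True
        then obtain x Y' where "4 \<le> x" "Y = {#x#} + Y'" by (metis add_mset_add_single insert_DiffM2 add.commute)
        moreover from this have "big ({#y4, y5, y6, x, y1 - 1, y2 - 1#} + ({#y3 - 1#} + Y'))"
          using y by (intro bigI) simp_all
        ultimately show ?thesis by (simp add: add_mset_commute)
      next
        case False
        then have "\<And>x. x \<in># Y \<Longrightarrow> x \<le> 3" by force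
        then obtain k where Y': "Y = replicate_mset k 3"
          using Y_threes assms by metis
        have "?N = seq 4 4 4 (k + 3) 0 0" unfolding Y' y
          by (simp add: seq_def add_mset_commute eval_nat_numeral)
        moreover from this g have "good 4 4 4 (k + 3) 0 0"
          using graphical_seq(1)[of 4 4 4 "k + 3" 0 0] by (auto simp: good_def lin_def sporadic_def)
        ultimately show ?thesis using good_imp_pot by metis
      qed
    qed
  qed
  moreover have "pot ?M" if "graphical ?N \<Longrightarrow> big ?N \<or> pot ?N"
  proof (rule pot_top[of "{#y1, y2, y3#}" "{#y4, y5, y6#} + Y"])
    fix x y assume "x \<in># {#y1, y2, y3#}" "y \<in># {#y4, y5, y6#} + Y"
    then have "x = y1 \<or> x = y2 \<or> x = y3" "y = y4 \<or> y = y5 \<or> y = y6 \<or> y \<in># Y" by auto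
    then show "y \<le> x" using ord mono Y_le[of y] by (elim disjE) simp_all
  qed (use that in \<open>simp_all add: assms\<close>)
  ultimately show ?thesis by blast
qed

lemma pot_min_4:
  assumes "\<delta> = 4"
  shows "pot ({#\<delta>#} + ({#y1, y2, y3, y4, y5, y6#} + Y))"
proof -
  let ?M = "{#\<delta>#} + ({#y1, y2, y3, y4, y5, y6#} + Y)"
  let ?N = "image_mset (\<lambda>x. x - 1) {#y1, y2, y3, y4#} + ({#y5, y6#} + Y)"
  have y56: "4 \<le> y6" "4 \<le> y5" using ord assms by linarith+
  have "big ?N \<or> pot ?N" if g: "graphical ?N"
  proof (cases "5 \<le> y2")
    case True
    then have "big ({#y1 - 1, y2 - 1, y5, y6, y3 - 1, y4 - 1#} + Y)" using ord y56 by (intro bigI) linarith+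
    then show ?thesis by (simp add: add_mset_commute)
  next
    case False
    then have y: "y2 = 4" "y3 = 4" "y4 = 4" "y5 = 4" "y6 = 4" using ord y56 by linarith+
    show ?thesis
    proof (cases Y)
      case empty
      have "y1 - 1 < 6" using graphical_less_size[OF g, of "y1 - 1"] by (simp add: empty)
      moreover have "even (y1 - 1 + 17)" using graphical_even[OF g] by (simp add: empty y)
      ultimately have "y1 = 4 \<or> y1 = 6" using ord y by presburger
      then show ?thesis using pot_order_6(2,3) unfolding y empty
        by (elim disjE) (simp_all add: seq_def add_mset_commute eval_nat_numeral)
    next
      case (add x Y')
      then have x: "x = 4" using Y[of x] assms y by simp
      show ?thesis
      proof (cases "5 \<le> y1")
        case True
        then have "big ({#y1 - 1, y5, y6, x, y2 - 1, y3 - 1#} + ({#y4 - 1#} + Y'))"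
          using x y by (intro bigI) simp_all
        then show ?thesis by (simp add: add add_mset_commute)
      next
        case False
        then have y1: "y1 = 4" using ord y by simp
        show ?thesis
        proof (cases Y')
          case empty
          have "good 4 4 4 4 0 0" by code_simp
          then have "pot (seq 4 4 4 4 0 0)" by (rule good_imp_pot)
          then show ?thesis unfolding add empty y y1 x
            by (simp add: seq_def add_mset_commute eval_nat_numeral)
        next
          case (add z Y'')
          have "z = 4" using Y[of z] \<open>Y = add_mset x Y'\<close> add assms y by simp
          with x y y1 have "big ({#y5, y6, x, z, y1 - 1, y2 - 1#} + ({#y3 - 1, y4 - 1#} + Y''))"
            by (intro bigI) simp_all
          then show ?thesis by (simp add: \<open>Y = add_mset x Y'\<close> add add_mset_commute)
        qed
      qed
    qed
  qed
  then show "pot ?M"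
  proof (rule pot_top[of "{#y1, y2, y3, y4#}" "{#y5, y6#} + Y", rotated 3])
    fix x y assume "x \<in># {#y1, y2, y3, y4#}" "y \<in># {#y5, y6#} + Y"
    then have "x = y1 \<or> x = y2 \<or> x = y3 \<or> x = y4" "y = y5 \<or> y = y6 \<or> y \<in># Y" by auto
    then show "y \<le> x" using ord mono Y_le[of y] by (elim disjE) simp_all
  qed (simp_all add: assms)
qed

end

theorem graphical_big_imp_pot:
  assumes "graphical M" "big M"
  shows "pot M"
  using assms
proof (induction "size M" arbitrary: M rule: less_induct)
  case less
  define xs where "xs = rev (sorted_list_of_multiset M)"
  have M: "M = mset xs" by (simp add: xs_def)
  have srt: "sorted_wrt (\<ge>) xs"
    by (simp add: xs_def sorted_wrt_rev)
  have "6 \<le> size {#x \<in># M. 3 \<le> x#}" using less.prems(2) by (simp add: big_def)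
  also have "\<dots> \<le> size M" by (simp add: size_filter_mset_lesseq)
  finally have len: "6 \<le> length xs" by (simp add: M)
  have split6: "\<exists>y1 y2 y3 y4 y5 y6 ys. us = y1 # y2 # y3 # y4 # y5 # y6 # ys" if "6 \<le> length us" for us :: "nat list"
    using that by (auto simp: Suc_le_length_iff eval_nat_numeral)
  show ?case
  proof (cases "length xs = 6")
    case True
    obtain y1 y2 y3 y4 y5 y6 ys where xs: "xs = y1 # y2 # y3 # y4 # y5 # y6 # ys" using split6[OF len] by blast
    then have "ys = []" using True by simp
    then show ?thesis
      using pot_order_6_big[of y1 y2 y3 y4 y5 y6] big_sorted[of y1 y2 y3 y4 y5 y6 ys] less.prems srt
      unfolding M xs by simp
  next
    case False
    then obtain us \<delta> where us: "xs = us @ [\<delta>]" using len by (cases xs rule: rev_cases) auto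
    have lu: "6 \<le> length us" using len False us by simp
    obtain y1 y2 y3 y4 y5 y6 ys where ys: "us = y1 # y2 # y3 # y4 # y5 # y6 # ys" using split6[OF lu] by blast
    have su: "sorted_wrt (\<ge>) us" and du: "\<forall>x \<in> set us. \<delta> \<le> x" using srt unfolding us by (auto simp: sorted_wrt_append)
    have M': "M = {#\<delta>#} + ({#y1, y2, y3, y4, y5, y6#} + mset ys)" unfolding M us ys by (simp add: add_mset_commute)
    have b: "4 \<le> y4" "3 \<le> y6"
      using big_sorted[of y1 y2 y3 y4 y5 y6 "ys @ [\<delta>]"] less.prems(2) srt unfolding M us ys by simp_all
    interpret min_removal y1 y2 y3 y4 y5 y6 "mset ys" \<delta>
    proof
      show "graphical ({#\<delta>#} + ({#y1, y2, y3, y4, y5, y6#} + mset ys))" using less.prems(1) M' by simp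
      show "pot N" if "graphical N" "big N" "size N = 6 + size (mset ys)" for N
        using less.hyps[of N] that M' by simp
    qed (use su du b ys in auto)
    consider "\<delta> = 0" | "\<delta> = 1" | "\<delta> = 2" | "\<delta> = 3" | "\<delta> = 4" | "5 \<le> \<delta>" by linarith
    then show ?thesis
    proof cases
      case 1
      have "big ({#y1, y2, y3, y4, y5, y6#} + mset ys)" using b mono ord by (intro bigI) linarith+
      then have "pot ({#\<delta>#} + ({#y1, y2, y3, y4, y5, y6#} + mset ys))"
        by (intro pot_top[of "{#}" "{#y1, y2, y3, y4, y5, y6#} + mset ys"]) (simp_all add: 1)
      then show ?thesis unfolding M' .
    next
      \<comment> \<open>Terms of at least 5 stay at least 4 when lowered, so the rest is
        \<open>big\<close> again.\<close>
      case 6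
      have "\<delta> \<in># M" by (simp add: M')
      then have le: "\<delta> \<le> length us" using graphical_less_size[OF less.prems(1)] by (fastforce simp: M us)
      have mus: "mset us = {#y1, y2, y3, y4, y5, y6#} + mset ys" by (simp add: ys)
      let ?D = "mset (take \<delta> us)" and ?R = "mset (drop \<delta> us)"
      have dr: "mset us = ?D + ?R" by (metis append_take_drop_id mset_append)
      have "pot ({#\<delta>#} + ({#y1, y2, y3, y4, y5, y6#} + mset ys))"
      proof (rule pot_top[of ?D ?R])
        show "size ?D = \<delta>" using le by simp
        show "y \<le> x" if "x \<in># ?D" "y \<in># ?R" for x y
          using su that by (metis append_take_drop_id set_mset_mset sorted_wrt_append)
        have "4 \<le> x" if "x \<in># image_mset (\<lambda>x. x - 1) ?D + ?R" for x
        proof -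
          have "\<forall>z \<in> set us. 5 \<le> z" using du 6 by auto
          with that show ?thesis by (fastforce dest: in_set_takeD in_set_dropD)
        qed
        then have "filter_mset ((\<le>) 4) (image_mset (\<lambda>x. x - 1) ?D + ?R) = image_mset (\<lambda>x. x - 1) ?D + ?R"
          "filter_mset ((\<le>) 3) (image_mset (\<lambda>x. x - 1) ?D + ?R) = image_mset (\<lambda>x. x - 1) ?D + ?R"
          unfolding filter_mset_eq_conv by fastforce+
        moreover have "size (image_mset (\<lambda>x. x - 1) ?D + ?R) = length us" using le by simp
        ultimately have "big (image_mset (\<lambda>x. x - 1) ?D + ?R)" unfolding big_def using lu by simp
        then show "big (image_mset (\<lambda>x. x - 1) ?D + ?R) \<or> pot (image_mset (\<lambda>x. x - 1) ?D + ?R)" by blast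
      qed (use dr mus in simp)
      then show ?thesis unfolding M' .
    qed (use pot_min_1 pot_min_2 pot_min_3 pot_min_4 M' in simp_all)
  qed
qed

section \<open>Sequences whose fourth term is three: necessity\<close>

lemma prism_nbr: "i \<in> {0..<6} \<Longrightarrow> \<exists>j. (i, j) \<in> parcs K6_minus_C6"
proof -
  assume "i \<in> {0..<6}"
  then have "i = 0 \<or> i = 1 \<or> i = 2 \<or> i = 3 \<or> i = 4 \<or> i = 5" by auto
  then have "(i, (i + 2) mod 6) \<in> parcs K6_minus_C6" by (elim disjE) (simp_all add: K6_minus_C6_def)
  then show ?thesis by blast
qed

lemma prism_in_vertices:
  "sgraph V E \<Longrightarrow> prism_at E g \<Longrightarrow> i \<in> {0..<6} \<Longrightarrow> g i \<in> V"
  using prism_nbr[of i] sgraph_mem unfolding prism_at_def by metis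

text \<open>\<open>w\<close> takes over those prism neighbours of \<open>g i\<close> that it lacks
  and pays with as many private neighbours, which the degree condition provides.\<close>

lemma prism_replace:
  assumes G: "sgraph V E" and g: "prism_at E g" and w: "w \<in> V" "w \<notin> g ` {0..<6}"
    and i: "i \<in> {0..<6}" and le: "deg E (g i) \<le> deg E w"
  shows "\<exists>E'. sgraph V E' \<and> deg E' = deg E \<and> prism_at E' (g(i := w))"
proof -
  let ?u = "g i"
  have inj: "inj_on g {0..<6}" and edge: "\<And>x y. (x, y) \<in> parcs K6_minus_C6 \<Longrightarrow> (g x, g y) \<in> E"
    using g unfolding prism_at_def by auto
  have K: "x \<in> {0..<6} \<and> y \<in> {0..<6} \<and> x \<noteq> y" if "(x, y) \<in> parcs K6_minus_C6" for x y
    using that by (auto simp: K6_minus_C6_def)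
  have Ksym: "(y, x) \<in> parcs K6_minus_C6" if "(x, y) \<in> parcs K6_minus_C6" for x y
    using that by (auto simp: K6_minus_C6_def)
  have uw: "?u \<noteq> w" using w i by blast
  define Q where "Q = g ` (parcs K6_minus_C6 `` {i}) - E `` {w} - {w}"
  have Q: "Q \<subseteq> E `` {?u} - E `` {w} - {w}" unfolding Q_def using edge by auto
  obtain Z where Z: "Z \<subseteq> E `` {w} - E `` {?u} - {?u}" "card Z = card Q"
    using exists_private_nbrs[OF G le Q uw] by blast
  interpret exchangeable V E ?u w Q Z
    using G uw w Q Z by unfold_locales auto
  let ?E = "exchange E ?u w Q Z"
  have "sgraph V ?E"
    by (rule sgraph_exchange) (rule prism_in_vertices[OF G g i])
  moreover have "deg ?E = deg E" using deg_exchange by blast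
  moreover have "prism_at ?E (g(i := w))"
    unfolding prism_at_def
  proof (intro conjI allI impI)
    show "inj_on (g(i := w)) {0..<6}"
      using inj w unfolding inj_on_def by (metis fun_upd_apply image_eqI)
    fix x y assume xy: "(x, y) \<in> parcs K6_minus_C6"
    note Kxy = K[OF xy] and Exy = edge[OF xy] and Eyx = edge[OF Ksym[OF xy]]
    have gu: "g z \<noteq> ?u" if "z \<in> {0..<6}" "z \<noteq> i" for z using inj i that unfolding inj_on_def by blast
    have gw: "g z \<noteq> w" if "z \<in> {0..<6}" for z using w that by blast
    show "((g(i := w)) x, (g(i := w)) y) \<in> ?E"
    proof (cases "x = i \<or> y = i")
      case False
      \<comment> \<open>The exchange touches only edges at \<open>g i\<close> and \<open>w\<close>,
        and neither is an end of this edge.\<close>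
      then show ?thesis using Exy Kxy gu gw unfolding exchange_def by auto
    next
      case True
      have "(w, g y) \<in> ?E \<and> (g y, w) \<in> ?E" if "(i, y) \<in> parcs K6_minus_C6" for y
      proof (cases "(w, g y) \<in> E")
        case True
        \<comment> \<open>\<open>g y\<close> is a common neighbour of \<open>g i\<close> and
          \<open>w\<close>, so it lies neither in \<open>Q\<close> nor in \<open>Z\<close> and its
          edge to \<open>w\<close> is kept.\<close>
        then have "g y \<notin> Q" "g y \<notin> Z" "w \<notin> Z" "w \<notin> Q" "g y \<noteq> ?u"
          using Q Z edge[OF that] sgraph_irrefl[OF G] K[OF that] gu by auto
        then show ?thesis using True sgraph_sym[OF G True] uw unfolding exchange_def by auto
      next
        case False
        then have "g y \<in> Q" using that gw K[OF that] unfolding Q_def by auto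
        then show ?thesis unfolding exchange_def by auto
      qed
      with True xy Kxy Ksym[OF xy] show ?thesis by auto
    qed
  qed
  ultimately show ?thesis by blast
qed

text \<open>While some \<open>w\<close> of \<open>W\<close> is missed, one of the six prism vertices
  lies outside \<open>W\<close>, since \<open>W\<close> has fewer than six elements, and can give
  way to \<open>w\<close>.\<close>

lemma prism_cover:
  assumes "sgraph V E" and "prism_at E g" and "W \<subseteq> V" and "card W < 6"
    and "\<And>w x. w \<in> W \<Longrightarrow> x \<in> V - W \<Longrightarrow> deg E x \<le> deg E w"
  shows "\<exists>E' g'. sgraph V E' \<and> deg E' = deg E \<and> prism_at E' g' \<and> W \<subseteq> g' ` {0..<6}"
  using assms
proof (induction "card (W - g ` {0..<6})" arbitrary: E g rule: less_induct)
  case less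
  show ?case
  proof (cases "W \<subseteq> g ` {0..<6}")
    case True
    then show ?thesis using less.prems by blast
  next
    case False
    then obtain w where w: "w \<in> W" "w \<notin> g ` {0..<6}" by blast
    have finW: "finite W" using less.prems(1,3) finite_subset unfolding sgraph_def by blast
    have inj: "inj_on g {0..<6}" using less.prems(2) by (simp add: prism_at_def)
    have "\<not> g ` {0..<6} \<subseteq> W"
      using less.prems(4) card_mono[OF finW, of "g ` {0..<6}"] card_image[OF inj] by auto
    then obtain i where i: "i \<in> {0..<6}" "g i \<notin> W" by blast
    have gV: "g i \<in> V"
      by (rule prism_in_vertices[OF less.prems(1,2) i(1)])
    have "deg E (g i) \<le> deg E w" using less.prems(5)[OF w(1)] gV i by blast
    from prism_replace[OF less.prems(1,2) _ w(2) i(1) this]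
    obtain E' where E': "sgraph V E'" "deg E' = deg E" "prism_at E' (g(i := w))"
      using w(1) less.prems(3) by blast
    have "W - (g(i := w)) ` {0..<6} \<subset> W - g ` {0..<6}"
    proof
      show "W - (g(i := w)) ` {0..<6} \<subseteq> W - g ` {0..<6}"
        using i by (auto simp: image_iff)
      have "w \<in> (g(i := w)) ` {0..<6}" using i by (auto simp: image_iff)
      then show "W - (g(i := w)) ` {0..<6} \<noteq> W - g ` {0..<6}" using w by blast
    qed
    then have "card (W - (g(i := w)) ` {0..<6}) < card (W - g ` {0..<6})"
      using finW by (meson finite_Diff psubset_card_mono)
    from less.hyps[OF this E'(1,3) less.prems(3,4)] less.prems(5) E'(2) show ?thesis by simp
  qed
qed

lemma sum_card_swap:
  assumes "sgraph V E" "finite X" "finite Y"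
  shows "(\<Sum>u\<in>X. card (E `` {u} \<inter> Y)) = (\<Sum>u\<in>Y. card (E `` {u} \<inter> X))"
proof -
  have c: "card (E `` {u} \<inter> Z) = (\<Sum>z\<in>Z. of_bool ((u, z) \<in> E))" if "finite Z" for u Z
  proof -
    have "E `` {u} \<inter> Z = Z \<inter> {z. (u, z) \<in> E}" by auto
    then show ?thesis using that by simp
  qed
  have "(\<Sum>u\<in>X. card (E `` {u} \<inter> Y)) = (\<Sum>u\<in>X. \<Sum>y\<in>Y. of_bool ((u, y) \<in> E))"
    using c[OF assms(3)] by simp
  also have "\<dots> = (\<Sum>y\<in>Y. \<Sum>u\<in>X. of_bool ((u, y) \<in> E))" by (rule sum.swap)
  also have "\<dots> = (\<Sum>y\<in>Y. \<Sum>u\<in>X. of_bool ((y, u) \<in> E))"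
    using sgraph_sym[OF assms(1)] by (intro sum.cong refl) (auto simp: of_bool_def)
  also have "\<dots> = (\<Sum>u\<in>Y. card (E `` {u} \<inter> X))"
    using c[OF assms(2)] by simp
  finally show ?thesis .
qed

text \<open>
  The numbers \<open>x\<close>, \<open>y\<close>, \<open>z\<close> count the edges between the large vertices that do not belong to the
  prism, \<open>\<alpha>\<close>, \<open>\<beta>\<close>, \<open>\<gamma>\<close> the edges from these vertices to the outside of the prism, which contains
  \<open>s\<close> vertices of degree three, and \<open>e\<close> those that lead to outside vertices of degree at most two.
\<close>

lemma residual_good:
  assumes a: "a = 3 + x + y + \<alpha>" and b: "b = 3 + x + z + \<beta>" and c: "c = 3 + y + z + \<gamma>"
    and ord: "b \<le> a" "c \<le> b"
    and x: "x \<le> 1" "y \<le> 1" "z \<le> 1" "x + y + z \<le> 2"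
    and A: "\<alpha> \<le> s + t + m" and AB: "\<alpha> + \<beta> \<le> 2 * s + 2 * t + m"
    and ABC: "\<alpha> + \<beta> + \<gamma> \<le> 3 * s + 2 * t + m"
    and T: "3 * s + 2 * e \<le> s * (s - 1) + (\<alpha> + \<beta> + \<gamma>) + 2 * t + m" and e: "\<alpha> \<le> s + e"
    and TU: "3 * s \<le> s * (s + t + m - 1) + (\<alpha> + \<beta> + \<gamma>)"
    and U: "3 * s + 2 * t + m \<le> (s + t + m) * (s + t + m - 1) + (\<alpha> + \<beta> + \<gamma>)"
    and ev: "even (a + b + c + (s + 3) + m)"
  shows "good a b c (s + 3) t m"
proof -
  have "lin a b c (s + 3) t m"
    unfolding lin_def
  proof (intro conjI impI)
    show "4 \<le> c" if "a = s + 3 + t + m + 2" using that a c x A by linarith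
    show "4 \<le> b" if "a = s + 3 + t + m + 1" using that a b c ord x A by linarith
    show "4 \<le> c" if "a + b = 2 * (s + 3) + 2 * t + m + 3"
    proof -
      have "3 \<le> 2 * x + y + z" using that a b AB by simp
      with x(1) have "1 \<le> y + z" by linarith
      then show ?thesis using c by simp
    qed
  qed (use ev ord in simp_all, use a b c x A AB ABC in linarith)+
  \<comment> \<open>A sporadic tuple fixes \<open>s\<close> and \<open>t\<close>, and then one of
    the degree counts \<open>T\<close>, \<open>TU\<close>, \<open>U\<close> fails. In the families
    with free \<open>m\<close>, the bound \<open>e\<close> is needed: at most \<open>s\<close> of
    the \<open>\<alpha>\<close> edges avoid the leaves.\<close>
  moreover have "\<not> sporadic a b c (s + 3) t m"
  proof
    assume "sporadic a b c (s + 3) t m"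
    then show False
      unfolding sporadic_def
      apply (elim disjE conjE)
      using a b c x A T e TU U
                       apply simp_all
      done
  qed
  ultimately show ?thesis by (simp add: good_def)
qed

text \<open>
  \<open>A\<close>, \<open>B\<close>, \<open>C\<close> are the large vertices of the prism; the vertices outside of the prism are
  partitioned by their degrees into \<open>T\<close>, \<open>L2\<close> and \<open>L1\<close>.
\<close>

locale residual =
  fixes V :: "'a set" and E A B C T L2 L1
  assumes graph: "sgraph V E" and fin: "finite T" "finite L2" "finite L1"
    and disj: "T \<inter> L2 = {}" "T \<inter> L1 = {}" "L2 \<inter> L1 = {}" "A \<notin> T \<union> L2 \<union> L1" "B \<notin> T \<union> L2 \<union> L1"
      "C \<notin> T \<union> L2 \<union> L1" "A \<noteq> B" "A \<noteq> C" "B \<noteq> C"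
    and nbrs: "\<And>u. u \<in> T \<union> L2 \<union> L1 \<Longrightarrow> E `` {u} \<subseteq> {A, B, C} \<union> (T \<union> L2 \<union> L1)"
    and deg3: "\<And>u. u \<in> T \<Longrightarrow> deg E u = 3" and deg2: "\<And>u. u \<in> L2 \<Longrightarrow> deg E u = 2"
    and deg1: "\<And>u. u \<in> L1 \<Longrightarrow> deg E u = 1"
begin

abbreviation "U \<equiv> T \<union> L2 \<union> L1"
abbreviation "L \<equiv> L2 \<union> L1"

definition cnt where "cnt X u = card (E `` {u} \<inter> X)"

lemma finite_nbrs: "finite (E `` {u})" by (rule sgraph_finite_nbrs[OF graph])

lemma cnt_Un: "X \<inter> Y = {} \<Longrightarrow> cnt (X \<union> Y) u = cnt X u + cnt Y u"
  unfolding cnt_def Int_Un_distrib by (rule card_Un_disjoint) (auto simp: finite_nbrs)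

lemma deg_eq: "u \<in> U \<Longrightarrow> deg E u = cnt {A, B, C} u + cnt U u"
proof -
  assume "u \<in> U"
  then have "E `` {u} \<inter> ({A, B, C} \<union> U) = E `` {u}" using nbrs by blast
  then have "deg E u = cnt ({A, B, C} \<union> U) u" by (simp only: cnt_def deg_def)
  then show ?thesis using cnt_Un[of "{A, B, C}" U u] disj by simp
qed

lemma cnt_ABC: "cnt {A, B, C} u = cnt {A} u + cnt {B} u + cnt {C} u"
proof -
  have "{A, B, C} = {A} \<union> ({B} \<union> {C})" by auto
  then have "cnt {A, B, C} u = cnt ({A} \<union> ({B} \<union> {C})) u" by (simp only:)
  also have "\<dots> = cnt {A} u + cnt ({B} \<union> {C}) u" by (rule cnt_Un) (use disj in auto)
  also have "cnt ({B} \<union> {C}) u = cnt {B} u + cnt {C} u" by (rule cnt_Un) (use disj in auto)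
  finally show ?thesis by simp
qed

lemma cnt_single: "cnt {x} u \<le> 1"
  unfolding cnt_def using card_mono[of "{x}" "E `` {u} \<inter> {x}"] by simp

lemma cnt_self: "finite X \<Longrightarrow> u \<in> X \<Longrightarrow> cnt X u \<le> card X - 1"
proof -
  assume "finite X" "u \<in> X"
  moreover have "E `` {u} \<inter> X \<subseteq> X - {u}" using sgraph_irrefl[OF graph] by auto
  ultimately show ?thesis unfolding cnt_def using card_mono[of "X - {u}"] by simp
qed

lemma sum_cnt: "finite X \<Longrightarrow> (\<Sum>u\<in>X. cnt {x} u) = cnt X x"
  unfolding cnt_def using sum_card_swap[OF graph, of X "{x}"] by simp

lemma sum_U: "(\<Sum>u\<in>U. f u) = (\<Sum>u\<in>T. f u) + (\<Sum>u\<in>L. f u)" for f :: "'a \<Rightarrow> nat"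
  using fin disj by (subst Un_assoc, subst sum.union_disjoint) auto

lemma sum_L: "(\<Sum>u\<in>L. f u) = (\<Sum>u\<in>L2. f u) + (\<Sum>u\<in>L1. f u)" for f :: "'a \<Rightarrow> nat"
  using fin disj by (subst sum.union_disjoint) auto

lemma card_U: "card U = card T + card L2 + card L1"
  using sum_U[of "\<lambda>_. 1"] sum_L[of "\<lambda>_. 1"] by simp

lemma sum_deg_T: "(\<Sum>u\<in>T. deg E u) = 3 * card T"
  by (simp add: deg3)

lemma sum_deg_L: "(\<Sum>u\<in>L. deg E u) = 2 * card L2 + card L1"
  by (simp add: sum_L deg2 deg1)

lemma sum_cnt_ABC: "(\<Sum>u\<in>U. cnt {A, B, C} u) = cnt U A + cnt U B + cnt U C"
  using fin by (simp add: cnt_ABC sum.distrib sum_cnt)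

lemma cnt_U_le: "cnt U x \<le> card U"
  unfolding cnt_def using fin by (intro card_mono) auto

text \<open>A leaf can serve only one of \<open>A\<close> and \<open>B\<close>; any other outside
  vertex may serve both.\<close>

lemma cnt_U_two: "cnt U A + cnt U B \<le> 2 * card T + 2 * card L2 + card L1"
proof -
  have "cnt U A + cnt U B = (\<Sum>u\<in>U. cnt {A} u + cnt {B} u)"
    using fin by (simp add: sum.distrib sum_cnt)
  also have "\<dots> = (\<Sum>u\<in>T. cnt {A} u + cnt {B} u) + ((\<Sum>u\<in>L2. cnt {A} u + cnt {B} u) + (\<Sum>u\<in>L1. cnt {A} u + cnt {B} u))"
    by (simp only: sum_U sum_L)
  also have "\<dots> \<le> (\<Sum>u\<in>T. 2) + ((\<Sum>u\<in>L2. 2) + (\<Sum>u\<in>L1. 1))"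
  proof (intro add_mono sum_mono)
    fix u
    have "cnt {A} u + cnt {B} u \<le> 1 + 1" by (intro add_mono cnt_single)
    then show "cnt {A} u + cnt {B} u \<le> 2" "cnt {A} u + cnt {B} u \<le> 2" by simp_all
    assume "u \<in> L1"
    then have "deg E u = cnt {A, B, C} u + cnt U u" "deg E u = 1" using deg_eq deg1 by auto
    then show "cnt {A} u + cnt {B} u \<le> 1" by (simp add: cnt_ABC)
  qed
  finally show ?thesis by simp
qed

lemma cnt_U_three: "cnt U A + cnt U B + cnt U C \<le> 3 * card T + 2 * card L2 + card L1"
proof -
  have "cnt U A + cnt U B + cnt U C \<le> (\<Sum>u\<in>U. deg E u)"
    unfolding sum_cnt_ABC[symmetric] by (intro sum_mono) (simp add: deg_eq)
  then show ?thesis using sum_U[of "deg E"] sum_deg_T sum_deg_L by simp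
qed

text \<open>The edges from \<open>T\<close> to \<open>L\<close> number at most the degree sum of
  \<open>L\<close> minus its edges to the large vertices, and the latter are also lost to
  \<open>T\<close> in the total of the large vertices. Hence the factor 2.\<close>

lemma count_T:
  "3 * card T + 2 * (\<Sum>u\<in>L. cnt {A, B, C} u) \<le>
    card T * (card T - 1) + (cnt U A + cnt U B + cnt U C) + 2 * card L2 + card L1"
proof -
  have TL: "cnt U u = cnt T u + cnt L u" for u
    using cnt_Un[of T L u] disj by (simp add: Un_assoc Int_Un_distrib)
  have "3 * card T = (\<Sum>u\<in>T. cnt {A, B, C} u) + (\<Sum>u\<in>T. cnt T u) + (\<Sum>u\<in>T. cnt L u)"
    unfolding sum_deg_T[symmetric] using deg_eq TL by (simp add: sum.distrib)
  moreover have "2 * card L2 + card L1 = (\<Sum>u\<in>L. cnt {A, B, C} u) + (\<Sum>u\<in>L. cnt T u) + (\<Sum>u\<in>L. cnt L u)"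
    unfolding sum_deg_L[symmetric] sum.distrib[symmetric] by (intro sum.cong refl) (use deg_eq TL in auto)
  moreover have "(\<Sum>u\<in>T. cnt L u) = (\<Sum>u\<in>L. cnt T u)"
    unfolding cnt_def by (rule sum_card_swap[OF graph]) (use fin in auto)
  moreover have "(\<Sum>u\<in>T. cnt T u) \<le> (\<Sum>u\<in>T. card T - 1)"
    using cnt_self fin by (intro sum_mono) auto
  moreover have "(\<Sum>u\<in>T. cnt {A, B, C} u) + (\<Sum>u\<in>L. cnt {A, B, C} u) = cnt U A + cnt U B + cnt U C"
    unfolding sum_cnt_ABC[symmetric] by (simp only: sum_U)
  ultimately show ?thesis by simp
qed

text \<open>\<open>A\<close> has at most one edge to each vertex of \<open>T\<close>, so a large
  degree of \<open>A\<close> forces edges into \<open>L\<close>, which \<open>count_T\<close>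
  penalizes.\<close>

lemma cnt_U_A: "cnt U A \<le> card T + (\<Sum>u\<in>L. cnt {A, B, C} u)"
proof -
  have "cnt U A = (\<Sum>u\<in>T. cnt {A} u) + (\<Sum>u\<in>L. cnt {A} u)"
    using sum_cnt[of U A] fin by (simp only: sum_U) simp
  also have "\<dots> \<le> (\<Sum>u\<in>T. 1) + (\<Sum>u\<in>L. cnt {A, B, C} u)"
    by (intro add_mono sum_mono) (use cnt_single in \<open>simp_all add: cnt_ABC\<close>)
  finally show ?thesis by simp
qed

lemma count_TU: "3 * card T \<le> card T * (card U - 1) + (cnt U A + cnt U B + cnt U C)"
proof -
  have "3 * card T = (\<Sum>u\<in>T. cnt {A, B, C} u) + (\<Sum>u\<in>T. cnt U u)"
    unfolding sum_deg_T[symmetric] using deg_eq by (simp add: sum.distrib)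
  also have "(\<Sum>u\<in>T. cnt U u) \<le> (\<Sum>u\<in>T. card U - 1)"
    by (intro sum_mono cnt_self) (use fin in auto)
  also have "(\<Sum>u\<in>T. cnt {A, B, C} u) \<le> cnt U A + cnt U B + cnt U C"
    unfolding sum_cnt_ABC[symmetric] sum_U by simp
  finally show ?thesis by simp
qed

lemma count_U: "3 * card T + 2 * card L2 + card L1 \<le> card U * (card U - 1) + (cnt U A + cnt U B + cnt U C)"
proof -
  have "3 * card T + 2 * card L2 + card L1 = (\<Sum>u\<in>U. deg E u)"
    using sum_deg_T sum_deg_L by (simp add: sum_U)
  also have "\<dots> = (\<Sum>u\<in>U. cnt {A, B, C} u) + (\<Sum>u\<in>U. cnt U u)"
    unfolding sum.distrib[symmetric] by (intro sum.cong refl) (rule deg_eq)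
  also have "(\<Sum>u\<in>U. cnt U u) \<le> (\<Sum>u\<in>U. card U - 1)"
    by (intro sum_mono cnt_self) (use fin in auto)
  finally show ?thesis using sum_cnt_ABC by simp
qed

end

lemma prism_nbrs_card: "i \<in> {0..<6} \<Longrightarrow> card (parcs K6_minus_C6 `` {i}) = 3"
proof -
  assume i: "i \<in> {0..<6}"
  have "out_arcs (with_proj K6_minus_C6) i = Pair i ` (parcs K6_minus_C6 `` {i})"
    by (auto simp: out_arcs_def)
  then have "out_degree (with_proj K6_minus_C6) i = card (parcs K6_minus_C6 `` {i})"
    unfolding out_degree_def by (simp add: card_image inj_on_def)
  then show ?thesis using out_degree_K6_minus_C6[of i] i by (simp add: K6_minus_C6_def)
qed

text \<open>Non-adjacent vertices of the prism are consecutive on the 6-cycle, hence of opposite parity.\<close>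

lemma prism_no_independent_triple:
  assumes "i \<in> {0..<6}" "j \<in> {0..<6}" "l \<in> {0..<6}" "i \<noteq> j" "i \<noteq> l" "j \<noteq> l"
  shows "(i, j) \<in> parcs K6_minus_C6 \<or> (i, l) \<in> parcs K6_minus_C6 \<or> (j, l) \<in> parcs K6_minus_C6"
proof (rule ccontr)
  have par: "even x \<noteq> even y" if "x \<in> {0..<6}" "y \<in> {0..<6}" "x \<noteq> y" "(x, y) \<notin> parcs K6_minus_C6" for x y
  proof -
    have "y = (x + 1) mod 6 \<or> x = (y + 1) mod 6" using that by (auto simp: K6_minus_C6_def)
    then show ?thesis by presburger
  qed
  assume "\<not> ?thesis"
  then show False using par[of i j] par[of i l] par[of j l] assms by blast
qed

theorem pot_imp_good:
  assumes pot: "pot (seq a b c k t m)" and ord: "b \<le> a" "c \<le> b" "3 \<le> c"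
  shows "3 \<le> k \<and> good a b c k t m"
proof -
  obtain V :: "nat set" and E0 and g0 :: "nat \<Rightarrow> nat"
    where G0: "sgraph V E0" and d: "degs V E0 = seq a b c k t m" and g0: "prism_at E0 g0"
    using pot unfolding pot_def by blast
  have fV: "finite V" using G0 by (simp add: sgraph_def)
  \<comment> \<open>The sum is nested to the right so that each splitting peels off one large vertex
    or one degree class.\<close>
  have "image_mset (deg E0) (mset_set V) =
      {#a#} + ({#b#} + ({#c#} + (replicate_mset k 3 + (replicate_mset t 2 + replicate_mset m 1))))"
    using d by (simp add: degs_def seq_def)
  from split_image_mset_set[OF fV this] obtain VA V1 where 1: "V = VA \<union> V1" "VA \<inter> V1 = {}"
    "image_mset (deg E0) (mset_set VA) = {#a#}"
    "image_mset (deg E0) (mset_set V1) = {#b#} + ({#c#} + (replicate_mset k 3 + (replicate_mset t 2 + replicate_mset m 1)))"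
    by metis
  then have "finite V1" using fV by simp
  from split_image_mset_set[OF this 1(4)] obtain VB V2 where 2: "V1 = VB \<union> V2" "VB \<inter> V2 = {}"
    "image_mset (deg E0) (mset_set VB) = {#b#}"
    "image_mset (deg E0) (mset_set V2) = {#c#} + (replicate_mset k 3 + (replicate_mset t 2 + replicate_mset m 1))"
    by metis
  then have "finite V2" using \<open>finite V1\<close> by simp
  from split_image_mset_set[OF this 2(4)] obtain VC V3 where 3: "V2 = VC \<union> V3" "VC \<inter> V3 = {}"
    "image_mset (deg E0) (mset_set VC) = {#c#}"
    "image_mset (deg E0) (mset_set V3) = replicate_mset k 3 + (replicate_mset t 2 + replicate_mset m 1)"
    by metis
  then have "finite V3" using \<open>finite V2\<close> by simp
  from split_image_mset_set[OF this 3(4)] obtain T0 V4 where 4: "V3 = T0 \<union> V4" "T0 \<inter> V4 = {}"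
    "image_mset (deg E0) (mset_set T0) = replicate_mset k 3"
    "image_mset (deg E0) (mset_set V4) = replicate_mset t 2 + replicate_mset m 1"
    by metis
  then have "finite V4" using \<open>finite V3\<close> by simp
  from split_image_mset_set[OF this 4(4)] obtain L2 L1 where 5: "V4 = L2 \<union> L1" "L2 \<inter> L1 = {}"
    "image_mset (deg E0) (mset_set L2) = replicate_mset t 2"
    "image_mset (deg E0) (mset_set L1) = replicate_mset m 1"
    by metis
  have fin: "finite VA" "finite VB" "finite VC" "finite T0" "finite L2" "finite L1"
    using fV 1(1) 2(1) 3(1) 4(1) 5(1) by auto
  have one: "\<exists>v. X = {v} \<and> deg E0 v = r" if "image_mset (deg E0) (mset_set X) = {#r#}" "finite X" for X r
  proof -
    have "card X = 1" using arg_cong[OF that(1), of size] by simp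
    then obtain v where "X = {v}" by (rule card_1_singletonE)
    then show ?thesis using that by simp
  qed
  have many: "card X = l \<and> (\<forall>v\<in>X. deg E0 v = r)"
    if "image_mset (deg E0) (mset_set X) = replicate_mset l r" "finite X" for X l r
  proof
    show "card X = l" using arg_cong[OF that(1), of size] by simp
    show "\<forall>v\<in>X. deg E0 v = r"
    proof
      fix v assume "v \<in> X"
      then have "deg E0 v \<in># image_mset (deg E0) (mset_set X)" using that(2) by simp
      then show "deg E0 v = r" unfolding that(1) by (auto split: if_splits)
    qed
  qed
  obtain A B C where ABC: "VA = {A}" "VB = {B}" "VC = {C}"
    and dABC: "deg E0 A = a" "deg E0 B = b" "deg E0 C = c"
    using one[OF 1(3) fin(1)] one[OF 2(3) fin(2)] one[OF 3(3) fin(3)] by blast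
  have cards: "card T0 = k" "card L2 = t" "card L1 = m"
    and dT: "\<And>v. v \<in> T0 \<Longrightarrow> deg E0 v = 3" "\<And>v. v \<in> L2 \<Longrightarrow> deg E0 v = 2" "\<And>v. v \<in> L1 \<Longrightarrow> deg E0 v = 1"
    using many[OF 4(3) fin(4)] many[OF 5(3) fin(5)] many[OF 5(4) fin(6)] by auto
  have V: "V = {A, B, C} \<union> T0 \<union> L2 \<union> L1" using 1(1) 2(1) 3(1) 4(1) 5(1) ABC by auto
  have ne: "A \<noteq> B" "A \<noteq> C" "B \<noteq> C" "A \<notin> T0 \<union> L2 \<union> L1" "B \<notin> T0 \<union> L2 \<union> L1" "C \<notin> T0 \<union> L2 \<union> L1"
    "T0 \<inter> L2 = {}" "T0 \<inter> L1 = {}" "L2 \<inter> L1 = {}"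
    using 1(1,2) 2(1,2) 3(1,2) 4(1,2) 5(1,2) ABC by auto
  let ?W = "{A, B, C}"
  have "\<exists>E' g'. sgraph V E' \<and> deg E' = deg E0 \<and> prism_at E' g' \<and> ?W \<subseteq> g' ` {0..<6}"
  proof (rule prism_cover[OF G0 g0])
    show "?W \<subseteq> V" using V by auto
    show "card ?W < 6" using ne by simp
    fix w x assume "w \<in> ?W" "x \<in> V - ?W"
    then have "3 \<le> deg E0 w" "deg E0 x \<le> 3" using V dT dABC ord by force+
    then show "deg E0 x \<le> deg E0 w" by linarith
  qed
  then obtain E g where G: "sgraph V E" and dE: "deg E = deg E0" and g: "prism_at E g"
    and WP: "?W \<subseteq> g ` {0..<6}" by blast
  note dABC = dABC[folded dE] and dT = dT[folded dE]
  let ?P = "g ` {0..<6}"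
  define N where "N i = g ` (parcs K6_minus_C6 `` {i})" for i
  have inj: "inj_on g {0..<6}" and edge: "\<And>x y. (x, y) \<in> parcs K6_minus_C6 \<Longrightarrow> (g x, g y) \<in> E"
    using g unfolding prism_at_def by auto
  have K: "x \<in> {0..<6} \<and> y \<in> {0..<6} \<and> x \<noteq> y" if "(x, y) \<in> parcs K6_minus_C6" for x y
    using that by (auto simp: K6_minus_C6_def)
  have Ksym: "(y, x) \<in> parcs K6_minus_C6" if "(x, y) \<in> parcs K6_minus_C6" for x y
    using that by (auto simp: K6_minus_C6_def)
  have finE: "finite (E `` {v})" for v by (rule sgraph_finite_nbrs[OF G])
  have N: "N i \<subseteq> E `` {g i}" "N i \<subseteq> ?P" for i unfolding N_def using edge K by auto
  have cN: "card (N i) = 3" if "i \<in> {0..<6}" for i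
  proof -
    have "inj_on g (parcs K6_minus_C6 `` {i})" by (rule inj_on_subset[OF inj]) (use K in auto)
    then show ?thesis unfolding N_def using prism_nbrs_card[OF that] by (simp add: card_image)
  qed
  have Nmem: "g j \<in> N i \<longleftrightarrow> (i, j) \<in> parcs K6_minus_C6" if "j \<in> {0..<6}" for i j
    unfolding N_def using inj that K unfolding inj_on_def by blast
  have PV: "?P \<subseteq> V" using prism_in_vertices[OF G g] by blast
  have P3: "3 \<le> deg E v" if "v \<in> ?P" for v
  proof -
    from that obtain i where i: "i \<in> {0..<6}" "v = g i" by blast
    have "card (N i) \<le> card (E `` {g i})" by (rule card_mono[OF finE N(1)])
    then show ?thesis using cN[OF i(1)] i by (simp add: deg_def)
  qed
  have PL: "?P \<inter> (L2 \<union> L1) = {}" using P3 dT by force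
  \<comment> \<open>The three other prism vertices: they have degree 3, which the prism uses up, so
    no vertex outside the prism is adjacent to them.\<close>
  define Q where "Q = ?P - ?W"
  have OT: "Q \<subseteq> T0" unfolding Q_def using PV V PL by auto
  have cardP: "card ?P = 6" using card_image[OF inj] by simp
  have cardO: "card Q = 3" unfolding Q_def using card_Diff_subset[OF _ WP] cardP ne by simp
  have k3: "3 \<le> k" using card_mono[OF fin(4) OT] cardO cards by simp
  have ON: "E `` {g i} = N i" if "i \<in> {0..<6}" "g i \<in> Q" for i
  proof -
    have "card (E `` {g i}) = 3" using that OT dT(1) by (auto simp: deg_def)
    then show ?thesis using card_subset_eq[OF finE N(1)] cN[OF that(1)] by metis
  qed
  define T where "T = T0 - Q"
  have cT: "card T = k - 3" unfolding T_def using card_Diff_subset[OF _ OT] cardO cards fin OT finite_subset by metis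
  have finT: "finite T" using fin(4) by (simp add: T_def)
  let ?U = "T \<union> L2 \<union> L1"
  have PQ: "?P = ?W \<union> Q" unfolding Q_def using WP by blast
  have VP: "V = ?P \<union> ?U" "?P \<inter> ?U = {}"
    unfolding PQ T_def using V OT ne by auto
  have Uno: "E `` {u} \<subseteq> ?W \<union> ?U" if "u \<in> ?U" for u
  proof
    fix v assume v: "v \<in> E `` {u}"
    then have "v \<in> V" using sgraph_mem[OF G] by blast
    moreover have "v \<notin> Q"
    proof
      assume vQ: "v \<in> Q"
      then obtain i where i: "i \<in> {0..<6}" "v = g i" unfolding Q_def by blast
      have "u \<in> E `` {g i}" using v i sgraph_sym[OF G] by blast
      then have "u \<in> ?P" using ON[OF i(1)] vQ i N(2) by blast
      then show False using VP that by blast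
    qed
    ultimately show "v \<in> ?W \<union> ?U" using VP Q_def by blast
  qed
  interpret residual V E A B C T L2 L1
  proof
    show "sgraph V E" by (rule G)
    show "\<And>u. u \<in> T \<union> L2 \<union> L1 \<Longrightarrow> E `` {u} \<subseteq> {A, B, C} \<union> (T \<union> L2 \<union> L1)"
      by (rule Uno)
  qed (use finT fin ne dT in \<open>auto simp: T_def\<close>)
  \<comment> \<open>This is 1 exactly for an edge outside the prism copy; for pairs of large
    vertices it supplies \<open>x\<close>, \<open>y\<close>, \<open>z\<close> of
    \<open>residual_good\<close>.\<close>
  define X :: "nat \<Rightarrow> nat \<Rightarrow> nat" where "X i j = of_bool (g j \<in> E `` {g i} - N i)" for i j
  define \<alpha> where "\<alpha> v = card (E `` {v} \<inter> ?U)" for v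
  have deg: "deg E (g i) = 3 + X i j + X i l + \<alpha> (g i)"
    if "{g i, g j, g l} = ?W" "i \<in> {0..<6}" "j \<in> {0..<6}" "l \<in> {0..<6}" "g j \<noteq> g l" for i j l
  proof -
    let ?R = "E `` {g i} - N i"
    have sub: "?R \<subseteq> {g j, g l} \<union> ?U"
    proof
      fix v assume v: "v \<in> ?R"
      then have "v \<in> V" using sgraph_mem[OF G] by blast
      \<comment> \<open>All edges at a vertex of \<open>Q\<close> belong to the prism, so such a
        neighbour of \<open>g i\<close> would already lie in \<open>N i\<close>.\<close>
      moreover have "v \<notin> Q"
      proof
        assume vQ: "v \<in> Q"
        then obtain h where h: "h \<in> {0..<6}" "v = g h" unfolding Q_def by blast
        have "g i \<in> E `` {g h}" using v h sgraph_sym[OF G] by blast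
        then have "g i \<in> N h" using ON[OF h(1)] vQ h(2) by (simp only:)
        then have "(h, i) \<in> parcs K6_minus_C6" using Nmem[OF that(2)] by simp
        then have "v \<in> N i" using Ksym Nmem[OF h(1)] h by blast
        then show False using v by blast
      qed
      moreover have "v \<noteq> g i" using v sgraph_irrefl[OF G] by blast
      ultimately show "v \<in> {g j, g l} \<union> ?U" using VP Q_def that(1) by blast
    qed
    have jl: "g j \<notin> ?U" "g l \<notin> ?U" using VP(2) that(3,4) by blast+
    have NU: "N i \<inter> ?U = {}" using VP(2) N(2) by blast
    have "?R = (?R \<inter> {g j}) \<union> ((?R \<inter> {g l}) \<union> (E `` {g i} \<inter> ?U))" using sub NU by blast
    then have "card ?R = card ((?R \<inter> {g j}) \<union> ((?R \<inter> {g l}) \<union> (E `` {g i} \<inter> ?U)))" by (rule arg_cong)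
    also have "\<dots> = card (?R \<inter> {g j}) + card ((?R \<inter> {g l}) \<union> (E `` {g i} \<inter> ?U))"
      by (rule card_Un_disjoint) (use finE that(5) jl in auto)
    also have "card ((?R \<inter> {g l}) \<union> (E `` {g i} \<inter> ?U)) = card (?R \<inter> {g l}) + card (E `` {g i} \<inter> ?U)"
      by (rule card_Un_disjoint) (use finE jl in auto)
    finally have "card ?R = card (?R \<inter> {g j}) + (card (?R \<inter> {g l}) + \<alpha> (g i))" unfolding \<alpha>_def .
    moreover have "card (?R \<inter> {y}) = of_bool (y \<in> ?R)" for y by (cases "y \<in> ?R") auto
    moreover have "card ?R = card (E `` {g i}) - card (N i)"
      by (rule card_Diff_subset[OF _ N(1)]) (rule finite_subset[OF N(1) finE])
    moreover have "card (N i) \<le> card (E `` {g i})" by (rule card_mono[OF finE N(1)])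
    ultimately show ?thesis using cN[OF that(2)] unfolding X_def deg_def by simp
  qed
  have X_sym: "X i j = X j i" if "i \<in> {0..<6}" "j \<in> {0..<6}" for i j
  proof -
    have "g j \<in> E `` {g i} \<longleftrightarrow> g i \<in> E `` {g j}" using sgraph_sym[OF G] by blast
    moreover have "g j \<in> N i \<longleftrightarrow> g i \<in> N j" using Nmem that Ksym by blast
    ultimately show ?thesis by (simp add: X_def)
  qed
  have X_prism: "X i j = 0" if "(i, j) \<in> parcs K6_minus_C6" for i j
    using that Nmem K unfolding X_def by simp
  have X_le: "X i j \<le> 1" for i j by (simp add: X_def)
  obtain i j l where ijl: "i \<in> {0..<6}" "j \<in> {0..<6}" "l \<in> {0..<6}" "A = g i" "B = g j" "C = g l"
    using WP by auto
  have dist: "i \<noteq> j" "i \<noteq> l" "j \<noteq> l" using ne ijl by auto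
  have tot: "X i j + X i l + X j l \<le> 2"
    using prism_no_independent_triple[OF ijl(1-3) dist] X_prism X_le[of i j] X_le[of i l] X_le[of j l] by fastforce
  have da: "a = 3 + X i j + X i l + \<alpha> A" using deg[of i j l] dABC ijl ne by simp
  have "{g j, g i, g l} = ?W" using ijl by auto
  then have db: "b = 3 + X i j + X j l + \<alpha> B"
    using deg[of j i l] dABC ijl ne X_sym[OF ijl(1,2)] by simp
  have "{g l, g i, g j} = ?W" using ijl by auto
  then have dc: "c = 3 + X i l + X j l + \<alpha> C"
    using deg[of l i j] dABC ijl ne X_sym[OF ijl(1,3)] X_sym[OF ijl(2,3)] by simp
  obtain s where s: "k = s + 3" using k3 by (metis add.commute le_Suc_ex)
  have cT': "card T = s" using cT s by simp
  have cU: "card ?U = s + t + m" using card_U cT' cards by simp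
  have "good a b c (s + 3) t m"
  proof (rule residual_good[OF da db dc ord(1,2) X_le X_le X_le tot])
    show "\<alpha> A \<le> s + t + m" using cnt_U_le[of A] cU by (simp add: \<alpha>_def cnt_def)
    show "\<alpha> A + \<alpha> B \<le> 2 * s + 2 * t + m" using cnt_U_two cT' cards by (simp add: \<alpha>_def cnt_def)
    show "\<alpha> A + \<alpha> B + \<alpha> C \<le> 3 * s + 2 * t + m" using cnt_U_three cT' cards by (simp add: \<alpha>_def cnt_def)
    show "3 * s + 2 * (\<Sum>u\<in>L2 \<union> L1. card (E `` {u} \<inter> ?W)) \<le> s * (s - 1) + (\<alpha> A + \<alpha> B + \<alpha> C) + 2 * t + m"
      using count_T cT' cards by (simp add: \<alpha>_def cnt_def)
    show "\<alpha> A \<le> s + (\<Sum>u\<in>L2 \<union> L1. card (E `` {u} \<inter> ?W))"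
      using cnt_U_A cT' by (simp add: \<alpha>_def cnt_def)
    show "3 * s \<le> s * (s + t + m - 1) + (\<alpha> A + \<alpha> B + \<alpha> C)"
      using count_TU cT' cU by (simp add: \<alpha>_def cnt_def)
    show "3 * s + 2 * t + m \<le> (s + t + m) * (s + t + m - 1) + (\<alpha> A + \<alpha> B + \<alpha> C)"
      using count_U cT' cards cU by (simp add: \<alpha>_def cnt_def)
    show "even (a + b + c + (s + 3) + m)"
      using graphical_seq(1)[OF pot_graphical[OF pot]] s by simp
  qed
  then show ?thesis using s by simp
qed

section \<open>The characterization\<close>

lemma realization_sgraph:
  assumes "realization G \<pi>"
  shows "sgraph (pverts G) (parcs G)" "degs (pverts G) (parcs G) = mset \<pi>"
proof -
  interpret pair_graph G using assms by (simp add: realization_def)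
  show "sgraph (pverts G) (parcs G)"
    unfolding sgraph_def
  proof (intro conjI)
    show "parcs G \<subseteq> pverts G \<times> pverts G" using arc_fst_in_verts arc_snd_in_verts by fastforce
    show "sym (parcs G)" using pair_sym_arcs by (simp add: symmetric_def)
    show "irrefl (parcs G)" using pair_no_loops by (force simp: irrefl_def)
  qed simp
  have "out_degree (with_proj G) v = deg (parcs G) v" for v
  proof -
    have "out_arcs (with_proj G) v = Pair v ` (parcs G `` {v})" by (auto simp: out_arcs_def)
    then show ?thesis unfolding out_degree_def deg_def by (simp add: card_image inj_on_def)
  qed
  then have "out_degree (with_proj G) = deg (parcs G)" by (rule ext)
  then show "degs (pverts G) (parcs G) = mset \<pi>" using assms by (simp add: realization_def degs_def)
qed

lemma sgraph_realization:
  assumes "sgraph V E" "degs V E = mset \<pi>"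
  shows "realization \<lparr>pverts = V, parcs = E\<rparr> \<pi>"
proof -
  let ?G = "\<lparr>pverts = V, parcs = E\<rparr>"
  have E: "E \<subseteq> V \<times> V" "finite V" "sym E" "irrefl E" using assms(1) by (auto simp: sgraph_def)
  have "pair_graph ?G"
    by unfold_locales (use E in \<open>auto simp: symmetric_def irrefl_def intro: finite_subset[of E "V \<times> V"]\<close>)
  moreover have "out_degree (with_proj ?G) v = deg E v" for v
  proof -
    have "out_arcs (with_proj ?G) v = Pair v ` (E `` {v})" by (auto simp: out_arcs_def)
    then show ?thesis unfolding out_degree_def deg_def by (simp add: card_image inj_on_def)
  qed
  then have "out_degree (with_proj ?G) = deg E" by (rule ext)
  ultimately show ?thesis using assms(2) by (simp add: realization_def degs_def)
qed

lemma graphic_graphical: "graphic \<pi> \<Longrightarrow> graphical (mset \<pi>)"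
  unfolding graphic_def graphical_def using realization_sgraph by blast

text \<open>Since \<open>with_proj\<close> makes tail and head the projections, the arc map of an
  isomorphism is determined by its vertex map. An injection on the six vertices therefore carries
  all the information.\<close>

lemma contains_prism:
  assumes "pair_graph G"
  shows "contains_subgraph G K6_minus_C6 \<longleftrightarrow> (\<exists>g. prism_at (parcs G) g)"
proof
  assume "contains_subgraph G K6_minus_C6"
  then obtain S :: "nat pair_pre_digraph" and f where sub: "subgraph (with_proj S) (with_proj G)"
    and iso: "pre_digraph.digraph_isomorphism (with_proj K6_minus_C6) f"
    and S: "with_proj S = app_iso f (with_proj K6_minus_C6)"
    unfolding contains_subgraph_def digraph_iso_def by blast
  have inj: "inj_on (iso_verts f) {0..<6}"
    using iso unfolding pre_digraph.digraph_isomorphism_def by (simp add: K6_minus_C6_def)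
  have t: "iso_tail f = fst" "iso_head f = snd"
    using arg_cong[OF S, of tail] arg_cong[OF S, of head] by simp_all
  have "(iso_verts f i, iso_verts f j) \<in> parcs G" if ij: "(i, j) \<in> parcs K6_minus_C6" for i j
  proof -
    have "iso_verts f i = fst (iso_arcs f (i, j))" "iso_verts f j = snd (iso_arcs f (i, j))"
      using iso ij t unfolding pre_digraph.digraph_isomorphism_def by fastforce+
    then have "(iso_verts f i, iso_verts f j) = iso_arcs f (i, j)" by simp
    also have "\<dots> \<in> arcs (with_proj S)" unfolding S using ij by simp
    also have "arcs (with_proj S) \<subseteq> arcs (with_proj G)" using sub by (simp add: subgraph_def)
    finally show ?thesis by simp
  qed
  with inj show "\<exists>g. prism_at (parcs G) g" unfolding prism_at_def by blast
next
  assume "\<exists>g. prism_at (parcs G) g"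
  then obtain g where inj: "inj_on g {0..<6}" and edge: "\<And>i j. (i, j) \<in> parcs K6_minus_C6 \<Longrightarrow> (g i, g j) \<in> parcs G"
    unfolding prism_at_def by blast
  interpret pair_graph G by (rule assms)
  interpret K: pair_graph K6_minus_C6 by (rule pair_graph_K6_minus_C6)
  define f where "f = \<lparr>iso_verts = g, iso_arcs = map_prod g g, iso_head = snd, iso_tail = fst\<rparr>"
  define S where "S = \<lparr>pverts = g ` pverts K6_minus_C6, parcs = map_prod g g ` parcs K6_minus_C6\<rparr>"
  have Kv: "pverts K6_minus_C6 = {0..<6}" by (simp add: K6_minus_C6_def)
  have Ka: "parcs K6_minus_C6 \<subseteq> {0..<6} \<times> {0..<6}" by (auto simp: K6_minus_C6_def)
  have "inj_on (map_prod g g) (parcs K6_minus_C6)"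
    by (rule inj_on_subset[OF map_prod_inj_on[OF inj inj] Ka])
  then have "pre_digraph.digraph_isomorphism (with_proj K6_minus_C6) f"
    unfolding pre_digraph.digraph_isomorphism_def f_def using inj Kv K.wf_digraph_axioms by auto
  moreover have "with_proj S = app_iso f (with_proj K6_minus_C6)"
    by (simp add: S_def f_def app_iso_def with_proj_def)
  ultimately have "digraph_iso (with_proj K6_minus_C6) (with_proj S)"
    unfolding digraph_iso_def by blast
  moreover have "pair_wf_digraph S"
    by unfold_locales (use Ka in \<open>auto simp: S_def Kv\<close>)
  then have "subgraph (with_proj S) (with_proj G)"
  proof -
    assume "pair_wf_digraph S"
    then interpret S: pair_wf_digraph S .
    have "wf_digraph (with_proj S)" by (rule S.wf_digraph_axioms)
    moreover have arcs: "parcs S \<subseteq> parcs G" using edge by (auto simp: S_def)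
    moreover have "pverts S \<subseteq> pverts G"
    proof
      fix v assume "v \<in> pverts S"
      then obtain i where i: "i \<in> {0..<6}" "v = g i" by (auto simp: S_def Kv)
      obtain j where "(i, j) \<in> parcs K6_minus_C6" using prism_nbr[OF i(1)] by blast
      then show "v \<in> pverts G" using edge i arc_fst_in_verts[of "(g i, g j)"] by auto
    qed
    ultimately show ?thesis using wf_digraph_axioms by (simp add: subgraph_def compatible_def)
  qed
  ultimately show "contains_subgraph G K6_minus_C6" unfolding contains_subgraph_def by blast
qed

lemma potentially_graphic_pot: "potentially_graphic K6_minus_C6 \<pi> \<longleftrightarrow> pot (mset \<pi>)"
proof
  assume "potentially_graphic K6_minus_C6 \<pi>"
  then obtain G where G: "realization G \<pi>" "contains_subgraph G K6_minus_C6"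
    unfolding potentially_graphic_def by blast
  then have "pair_graph G" by (simp add: realization_def)
  then show "pot (mset \<pi>)"
    using G realization_sgraph[OF G(1)] contains_prism unfolding pot_def by blast
next
  assume "pot (mset \<pi>)"
  then obtain V E and g :: "nat \<Rightarrow> nat" where G: "sgraph V E" "degs V E = mset \<pi>" "prism_at E g"
    unfolding pot_def by blast
  have r: "realization \<lparr>pverts = V, parcs = E\<rparr> \<pi>" by (rule sgraph_realization[OF G(1,2)])
  then have "pair_graph \<lparr>pverts = V, parcs = E\<rparr>" by (simp add: realization_def)
  with r G(3) contains_prism show "potentially_graphic K6_minus_C6 \<pi>"
    unfolding potentially_graphic_def by fastforce
qed

text \<open>Each of the six prism vertices has three neighbours inside the prism already.\<close>

lemma pot_six_large:
  assumes "pot M" shows "6 \<le> size {#x \<in># M. 3 \<le> x#}"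
proof -
  obtain V E and g :: "nat \<Rightarrow> nat" where G: "sgraph V E" and M: "degs V E = M" and g: "prism_at E g"
    using assms unfolding pot_def by blast
  have fV: "finite V" using G by (simp add: sgraph_def)
  have inj: "inj_on g {0..<6}" and edge: "\<And>i j. (i, j) \<in> parcs K6_minus_C6 \<Longrightarrow> (g i, g j) \<in> E"
    using g unfolding prism_at_def by auto
  have "3 \<le> deg E (g i)" if "i \<in> {0..<6}" for i
  proof -
    have "inj_on g (parcs K6_minus_C6 `` {i})"
      by (rule inj_on_subset[OF inj]) (auto simp: K6_minus_C6_def)
    then have "3 = card (g ` (parcs K6_minus_C6 `` {i}))" using prism_nbrs_card[OF that] by (simp add: card_image)
    also have "\<dots> \<le> card (E `` {g i})"
      by (rule card_mono[OF sgraph_finite_nbrs[OF G]]) (use edge in auto)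
    finally show ?thesis by (simp add: deg_def)
  qed
  then have "g ` {0..<6} \<subseteq> {v \<in> V. 3 \<le> deg E v}" using prism_in_vertices[OF G g] by blast
  then have "card (g ` {0..<6}) \<le> card {v \<in> V. 3 \<le> deg E v}" using fV by (intro card_mono) auto
  then have "6 \<le> card {v \<in> V. 3 \<le> deg E v}" using card_image[OF inj] by simp
  moreover have "{#x \<in># M. 3 \<le> x#} = image_mset (deg E) (mset_set {v \<in> V. 3 \<le> deg E v})"
    unfolding M[symmetric] degs_def using fV by (simp add: filter_mset_image_mset filter_mset_mset_set)
  ultimately show ?thesis by simp
qed

section \<open>From the conditions on the list to its parameters\<close>

definition seq_list :: "nat \<Rightarrow> nat \<Rightarrow> nat \<Rightarrow> nat \<Rightarrow> nat \<Rightarrow> nat \<Rightarrow> nat list" where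
  "seq_list a b c k t m = [a, b, c] @ replicate k 3 @ replicate t 2 @ replicate m 1"

lemma mset_seq_list: "mset (seq_list a b c k t m) = seq a b c k t m"
  by (simp add: seq_list_def seq_def)

text \<open>The first three positions are compared directly, so a 3 among them causes no ambiguity,
  and counting determines the rest.\<close>

lemma seq_list_eq_iff:
  "seq_list a b c k t m = seq_list a' b' c' k' t' m' \<longleftrightarrow>
    a = a' \<and> b = b' \<and> c = c' \<and> k = k' \<and> t = t' \<and> m = m'"
proof
  assume e: "seq_list a b c k t m = seq_list a' b' c' k' t' m'"
  then have abc: "a = a'" "b = b'" "c = c'"
    and r: "replicate k 3 @ replicate t 2 @ replicate m 1 = replicate k' 3 @ replicate t' 2 @ replicate m' (1 :: nat)"
    by (simp_all add: seq_list_def)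
  have "count (mset (replicate k 3 @ replicate t 2 @ replicate m 1)) x =
      count (mset (replicate k' 3 @ replicate t' 2 @ replicate m' (1 :: nat))) x" for x
    using r by simp
  from this[of 3] this[of 2] this[of 1] abc
  show "a = a' \<and> b = b' \<and> c = c' \<and> k = k' \<and> t = t' \<and> m = m'" by simp
qed simp

lemma small_list:
  assumes "sorted_wrt (\<ge>) xs" "\<And>x. x \<in> set xs \<Longrightarrow> 1 \<le> x \<and> x \<le> (3 :: nat)"
  shows "\<exists>k t m. xs = replicate k 3 @ replicate t 2 @ replicate m 1"
  using assms
proof (induction xs)
  case Nil
  show ?case by simp
next
  case (Cons x xs)
  then obtain k t m where xs: "xs = replicate k 3 @ replicate t 2 @ replicate m 1" by auto
  have le: "y \<le> x" if "y \<in> set xs" for y using Cons.prems(1) that by simp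
  consider "x = 3" | "x = 2" | "x = 1" using Cons.prems(2)[of x] by fastforce
  then show ?case
  proof cases
    case 1
    then have "x # xs = replicate (Suc k) 3 @ replicate t 2 @ replicate m 1" using xs by simp
    then show ?thesis by blast
  next
    case 2
    then have "k = 0" using le[of 3] xs by auto
    then have "x # xs = replicate 0 3 @ replicate (Suc t) 2 @ replicate m 1" using 2 xs by simp
    then show ?thesis by blast
  next
    case 3
    then have "k = 0" "t = 0" using le[of 3] le[of 2] xs by auto
    then have "x # xs = replicate 0 3 @ replicate 0 2 @ replicate (Suc m) 1" using 3 xs by simp
    then show ?thesis by blast
  qed
qed

lemma sporadic_seq_lists:
  assumes "n = k + t + m + 3"
  shows "seq_list a b c k t m \<in> {
      replicate 6 3 @ [2],
      replicate 2 4 @ replicate 6 3,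
      [4] @ replicate 6 3 @ [2],
      replicate 6 3 @ replicate 2 2,
      replicate 8 3,
      replicate 7 3 @ [1],
      [4] @ replicate 8 3,
      [4] @ replicate 7 3 @ [1],
      replicate 8 3 @ [2],
      replicate 7 3 @ [2, 1],
      replicate 9 3 @ [1],
      replicate 8 3 @ replicate 2 1,
      [n - 1] @ replicate 2 4 @ replicate 4 3 @ replicate (n - 7) 1,
      [n - 1] @ replicate 2 4 @ replicate 5 3 @ replicate (n - 8) 1,
      [n - 2, 4] @ replicate 5 3 @ replicate (n - 7) 1,
      [n - 2, 4] @ replicate 6 3 @ replicate (n - 8) 1,
      [n - 3] @ replicate 6 3 @ replicate (n - 7) 1,
      [n - 3] @ replicate 7 3 @ replicate (n - 8) 1} \<longleftrightarrow> sporadic a b c k t m"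
    (is "?s \<in> ?A \<longleftrightarrow> _")
proof -
  have "?A = {seq_list 3 3 3 3 1 0, seq_list 4 4 3 5 0 0, seq_list 4 3 3 4 1 0, seq_list 3 3 3 3 2 0,
      seq_list 3 3 3 5 0 0, seq_list 3 3 3 4 0 1, seq_list 4 3 3 6 0 0, seq_list 4 3 3 5 0 1,
      seq_list 3 3 3 5 1 0, seq_list 3 3 3 4 1 1, seq_list 3 3 3 6 0 1, seq_list 3 3 3 5 0 2,
      seq_list (n - 1) 4 4 4 0 (n - 7), seq_list (n - 1) 4 4 5 0 (n - 8),
      seq_list (n - 2) 4 3 4 0 (n - 7), seq_list (n - 2) 4 3 5 0 (n - 8),
      seq_list (n - 3) 3 3 4 0 (n - 7), seq_list (n - 3) 3 3 5 0 (n - 8)}" (is "_ = ?B")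
    by (simp add: seq_list_def eval_nat_numeral)
  moreover have "?s \<in> ?B \<longleftrightarrow> sporadic a b c k t m"
  proof -
    \<comment> \<open>The six families depending on \<open>n\<close> have \<open>t = 0\<close> and
      \<open>k = 4\<close> or \<open>k = 5\<close>, where \<open>n - 7\<close> or
      \<open>n - 8\<close> equals \<open>m\<close>. In the third case they fail on \<open>k\<close>
      and \<open>t\<close>, whatever the truncated differences are.\<close>
    consider (4) "k = 4" "t = 0" | (5) "k = 5" "t = 0" | (o) "\<not> (k = 4 \<and> t = 0)" "\<not> (k = 5 \<and> t = 0)" by blast
    then show ?thesis
    proof cases
      case 4
      then have n: "n - 1 = 6 + m" "n - 2 = 5 + m" "n - 3 = 4 + m" "n - 7 = m" using assms by simp_all
      show ?thesis unfolding n 4 seq_list_eq_iff insert_iff empty_iff sporadic_def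
        by simp
    next
      case 5
      then have n: "n - 1 = 7 + m" "n - 2 = 6 + m" "n - 3 = 5 + m" "n - 8 = m" using assms by simp_all
      show ?thesis unfolding n 5 seq_list_eq_iff insert_iff empty_iff sporadic_def
        by simp (rule iffI; elim disjE conjE; simp only: simp_thms)
    next
      case o
      then show ?thesis unfolding seq_list_eq_iff insert_iff empty_iff sporadic_def
        by - (rule iffI; elim disjE conjE FalseE; simp only: simp_thms)
    qed
  qed
  ultimately show ?thesis by simp
qed

text \<open>For \<open>i = 2 * n - (a + b)\<close> the inequality
  \<open>n - i + 3 \<le> 3 + k + t\<close> reads \<open>m + 3 \<le> i\<close>, that is
  \<open>a + b \<le> 2 * k + 2 * t + m + 3\<close>, and the condition after it treats equality. The
  terms 1 begin at position \<open>k + t + 4\<close>, which links this to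
  \<open>d (n - i + 3)\<close> and \<open>d (n - i + 4)\<close>.\<close>

lemma good_iff_conditions:
  assumes n: "n = k + t + m + 3" and k: "3 \<le> k" and ord: "b \<le> a" "c \<le> b" "3 \<le> c"
    and ev: "even (a + b + c + k + m)" and a: "a \<le> n - 1"
  shows "good a b c k t m \<longleftrightarrow>
    (a = n - 1 \<longrightarrow> 4 \<le> c) \<and> (a = n - 2 \<longrightarrow> 4 \<le> b) \<and> b \<noteq> n - 1 \<and>
    (\<forall>i \<in> {3..n - 4}. a + b = 2 * n - i \<longrightarrow> n - i + 3 \<le> 3 + k + t) \<and>
    (\<forall>i \<in> {4..n - 3}. a + b = 2 * n - i \<longrightarrow> 3 + k + t < n - i + 4 \<longrightarrow> 4 \<le> c) \<and>
    a + b + c \<le> n + 2 * k + t + 1 \<and> \<not> sporadic a b c k t m" (is "_ \<longleftrightarrow> ?R")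
proof
  assume g: "good a b c k t m"
  then have ab: "a + b \<le> 2 * k + 2 * t + m + 3" and c4: "a + b = 2 * k + 2 * t + m + 3 \<longrightarrow> 4 \<le> c"
    by (auto simp: good_def lin_def)
  have "n - i + 3 \<le> 3 + k + t" if "i \<in> {3..n - 4}" "a + b = 2 * n - i" for i
    using that ab n by simp
  moreover have "4 \<le> c" if "i \<in> {4..n - 3}" "a + b = 2 * n - i" "3 + k + t < n - i + 4" for i
  proof -
    have "a + b = 2 * k + 2 * t + m + 3" using that ab n by simp
    then show ?thesis using c4 by blast
  qed
  moreover have "b \<noteq> n - 1"
  proof
    assume "b = n - 1"
    then show False using ab ord n by simp
  qed
  ultimately show ?R using g n by (auto simp: good_def lin_def)
next
  assume R: ?R
  then have b: "b \<noteq> n - 1" and c1: "a = n - 1 \<longrightarrow> 4 \<le> c" and b4: "a = n - 2 \<longrightarrow> 4 \<le> b"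
    and i4: "\<And>i. i \<in> {3..n - 4} \<Longrightarrow> a + b = 2 * n - i \<Longrightarrow> n - i + 3 \<le> 3 + k + t"
    and i5: "\<And>i. i \<in> {4..n - 3} \<Longrightarrow> a + b = 2 * n - i \<Longrightarrow> 3 + k + t < n - i + 4 \<Longrightarrow> 4 \<le> c"
    and abc: "a + b + c \<le> n + 2 * k + t + 1" and sp: "\<not> sporadic a b c k t m" by blast+
  have b2: "b + 2 \<le> n" and a1: "a + 1 \<le> n" using b a ord n by linarith+
  have ab: "a + b \<le> 2 * k + 2 * t + m + 3"
  proof (rule ccontr)
    assume c: "\<not> ?thesis"
    define i where "i = 2 * n - (a + b)"
    have i: "a + b + i = 2 * n" using a1 b2 by (simp add: i_def)
    have "3 \<le> i" "i \<le> m + 2" using i a1 b2 c n by linarith+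
    moreover have "n - i + 3 \<le> 3 + k + t"
      using i \<open>3 \<le> i\<close> \<open>i \<le> m + 2\<close> k n by (intro i4) auto
    ultimately show False using n by linarith
  qed
  moreover have "4 \<le> c" if e: "a + b = 2 * k + 2 * t + m + 3"
  \<comment> \<open>For \<open>m = 0\<close> equality means \<open>i = 3\<close>, just below the
    range of \<open>i5\<close>. But then \<open>a = n - 1\<close>, and the condition on that value
    gives \<open>4 \<le> c\<close>.\<close>
  proof (cases "m = 0")
    case True
    then have "a = n - 1" using e a1 b2 n by linarith
    then show ?thesis using c1 by blast
  next
    case False
    then show ?thesis using e k n by (intro i5[of "m + 3"]) auto
  qed
  ultimately have "lin a b c k t m"
    using n k ord ev a c1 b4 abc unfolding lin_def by auto
  then show "good a b c k t m" using sp by (simp add: good_def)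
qed

theorem theorem3p2:
  fixes n :: nat and d :: "nat \<Rightarrow> nat" and \<pi> :: "nat list"
  assumes "n \<ge> 6"
    and "\<pi> = map d [1..<n + 1]"
    and "graphic \<pi>"
    and "\<And>i j. 1 \<le> i \<Longrightarrow> i \<le> j \<Longrightarrow> j \<le> n \<Longrightarrow> d j \<le> d i"
    and "d n \<ge> 1"
  shows "potentially_graphic K6_minus_C6 \<pi> \<longleftrightarrow>
    d 6 \<ge> 3 \<and>
    (\<forall>i \<in> {1, 2}. d 1 = n - i \<longrightarrow> d (4 - i) \<ge> 4) \<and>
    (d 2 = n - 1 \<longrightarrow> d 4 \<ge> 4) \<and>
    (\<forall>i \<in> {3..n - 4}. d 1 + d 2 = 2 * n - i \<and> d (n - i + 3) = 1 \<longrightarrow> d 4 \<ge> 4) \<and>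
    (\<forall>i \<in> {4..n - 3}. d 1 + d 2 = 2 * n - i \<and> d (n - i + 4) = 1 \<longrightarrow> d 3 \<ge> 4) \<and>
    (\<forall>k t. \<pi> = [d 1, d 2, d 3] @ replicate k 3 @ replicate t 2 @ replicate (n - 3 - k - t) 1
        \<longrightarrow> d 1 + d 2 + d 3 \<le> n + 2 * k + t + 1) \<and>
    (\<forall>t. \<pi> = [d 1, d 2] @ replicate 4 3 @ replicate t 2 @ replicate (n - 6 - t) 1
        \<longrightarrow> d 1 + d 2 \<le> n + t + 2) \<and>
    (\<forall>i k t. i \<in> {1..(n - t - 1) div 2} \<and> k \<in> {i + t + 1..n - i} \<and> t \<in> {4..k - i - 1}
        \<longrightarrow> \<pi> \<noteq> [n - i, k, t] @ replicate t 3 @ replicate (k - i - t - 1) 2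
                 @ replicate (n + i - 2 - k) 1) \<and>
    \<pi> \<notin> {
      replicate 6 3 @ [2],
      replicate 2 4 @ replicate 6 3,
      [4] @ replicate 6 3 @ [2],
      replicate 6 3 @ replicate 2 2,
      replicate 8 3,
      replicate 7 3 @ [1],
      [4] @ replicate 8 3,
      [4] @ replicate 7 3 @ [1],
      replicate 8 3 @ [2],
      replicate 7 3 @ [2, 1],
      replicate 9 3 @ [1],
      replicate 8 3 @ replicate 2 1,
      [n - 1] @ replicate 2 4 @ replicate 4 3 @ replicate (n - 7) 1,
      [n - 1] @ replicate 2 4 @ replicate 5 3 @ replicate (n - 8) 1,
      [n - 2, 4] @ replicate 5 3 @ replicate (n - 7) 1,
      [n - 2, 4] @ replicate 6 3 @ replicate (n - 8) 1,
      [n - 3] @ replicate 6 3 @ replicate (n - 7) 1,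
      [n - 3] @ replicate 7 3 @ replicate (n - 8) 1}"
proof -
  note n = assms(1) and \<pi> = assms(2) and mono = assms(4) and pos = assms(5)
  have len: "length \<pi> = n" by (simp add: \<pi>)
  have nth: "\<pi> ! (j - 1) = d j" if "1 \<le> j" "j \<le> n" for j using that by (simp add: \<pi> del: upt_Suc)
  have gr: "graphical (mset \<pi>)" using assms(3) by (rule graphic_graphical)
  have split: "[1..<n + 1] = [1, 2, 3, 4, 5, 6] @ [7..<n + 1]"
  proof -
    have "1 + 6 + (n - 6) = n + 1" using n by simp
    then have "[1..<n + 1] = [1..<1 + 6] @ [1 + 6..<n + 1]"
      using upt_add_eq_append[of 1 "1 + 6" "n - 6"] by simp
    then show ?thesis by (simp add: upt_rec del: upt_Suc)
  qed
  have \<pi>6: "\<pi> = [d 1, d 2, d 3, d 4, d 5, d 6] @ map d [7..<n + 1]" unfolding \<pi> split by simp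
  have ord: "d 2 \<le> d 1" "d 3 \<le> d 2" "d 4 \<le> d 3" "d 5 \<le> d 4" "d 6 \<le> d 5" using mono n by simp_all
  have less: "d 1 < n" using graphical_less_size[OF gr, of "d 1"] len by (simp add: \<pi>6)
  have \<pi>3: "\<pi> ! 3 = d 4" using nth[of 4] n by simp
  \<comment> \<open>A block of threes that covers index 3, counted from 0, fixes the fourth term;
    this rules out the listed shapes when \<open>d 4 \<ge> 4\<close>.\<close>
  have nth3: "d 4 = 3" if "\<pi> = xs @ replicate l 3 @ ys" "length xs \<le> 3" "3 < length xs + l" for xs l ys
  proof -
    have "3 - length xs < l" using that by linarith
    then show ?thesis using that \<pi>3 by (simp add: nth_append)
  qed
  let ?A = "{replicate 6 3 @ [2], replicate 2 4 @ replicate 6 3, [4] @ replicate 6 3 @ [2],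
      replicate 6 3 @ replicate 2 2, replicate 8 3, replicate 7 3 @ [1], [4] @ replicate 8 3,
      [4] @ replicate 7 3 @ [1], replicate 8 3 @ [2], replicate 7 3 @ [2, 1], replicate 9 3 @ [1],
      replicate 8 3 @ replicate 2 1,
      [n - 1] @ replicate 2 4 @ replicate 4 3 @ replicate (n - 7) 1,
      [n - 1] @ replicate 2 4 @ replicate 5 3 @ replicate (n - 8) 1,
      [n - 2, 4] @ replicate 5 3 @ replicate (n - 7) 1,
      [n - 2, 4] @ replicate 6 3 @ replicate (n - 8) 1,
      [n - 3] @ replicate 6 3 @ replicate (n - 7) 1,
      [n - 3] @ replicate 7 3 @ replicate (n - 8) 1}"
  consider (no) "\<not> 3 \<le> d 6" | (big) "3 \<le> d 6" "4 \<le> d 4" | (lin) "3 \<le> d 6" "d 4 = 3"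
    using ord by linarith
  then show ?thesis
  proof cases
    case no
    have "filter ((\<le>) 3) (map d [7..<n + 1]) = []"
    proof -
      have "\<not> 3 \<le> d j" if "7 \<le> j" "j \<le> n" for j using no mono[of 6 j] that by simp
      then show ?thesis by (auto simp: filter_empty_conv)
    qed
    then have "length (filter ((\<le>) 3) \<pi>) \<le> 5" using no unfolding \<pi>6 by simp
    moreover have "size {#x \<in># mset \<pi>. 3 \<le> x#} = length (filter ((\<le>) 3) \<pi>)"
      by (metis mset_filter size_mset)
    ultimately have "\<not> pot (mset \<pi>)" using pot_six_large[of "mset \<pi>"] by fastforce
    then show ?thesis using no potentially_graphic_pot by blast
  next
    case big
    have "big ({#d 1, d 2, d 3, d 4, d 5, d 6#} + mset (map d [7..<n + 1]))"
      using ord big by (intro bigI) linarith+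
    then have "big (mset \<pi>)" unfolding \<pi>6 by simp
    then have "potentially_graphic K6_minus_C6 \<pi>"
      using graphical_big_imp_pot[OF gr] potentially_graphic_pot by blast
    moreover have "\<forall>i \<in> {1, 2}. d 1 = n - i \<longrightarrow> 4 \<le> d (4 - i)" using ord big by simp
    moreover have "\<not> \<pi> = [d 1, d 2, d 3] @ replicate k 3 @ replicate t 2 @ replicate (n - 3 - k - t) 1" for k t
    proof
      assume e: "\<pi> = [d 1, d 2, d 3] @ replicate k 3 @ replicate t 2 @ replicate (n - 3 - k - t) 1"
      then have "drop 3 \<pi> = replicate k 3 @ replicate t 2 @ replicate (n - 3 - k - t) 1"
        using arg_cong[OF e, of "drop 3"] by simp
      moreover have "d 4 \<in> set (drop 3 \<pi>)" by (simp add: \<pi>6)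
      ultimately have "d 4 \<in> {3, 2, 1}" by (auto split: if_splits)
      then show False using big by auto
    qed
    moreover have "\<not> \<pi> = [d 1, d 2] @ replicate 4 3 @ replicate t 2 @ replicate (n - 6 - t) 1" for t
      using nth3[of "[d 1, d 2]" 4] big by force
    moreover have "\<pi> \<noteq> [n - i, k, t] @ replicate t 3 @ replicate (k - i - t - 1) 2 @ replicate (n + i - 2 - k) 1"
      if "t \<in> {4..k - i - 1}" for i k t
      using nth3[of "[n - i, k, t]" t] big that by force
    moreover have "\<pi> \<notin> ?A"
    proof
      assume "\<pi> \<in> ?A"
      then have "\<pi> ! 3 = 3" by (elim insertE emptyE) (simp_all add: nth_append)
      then show False using \<pi>3 big by simp
    qed
    moreover have "4 \<le> d 3" using ord big by linarith
    ultimately show ?thesis using big by blast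
  next
    case lin
    then have d456: "d 4 = 3" "d 5 = 3" "d 6 = 3" using ord by linarith+
    have "sorted_wrt (\<ge>) (map d [7..<n + 1])"
      unfolding sorted_wrt_map by (rule sorted_wrt_mono_rel[OF _ sorted_wrt_upt]) (use mono in auto)
    moreover have "1 \<le> x \<and> x \<le> 3" if "x \<in> set (map d [7..<n + 1])" for x
    proof -
      from that obtain j where j: "7 \<le> j" "j \<le> n" "x = d j" by auto
      then show ?thesis using mono[of 6 j] mono[of j n] d456 pos n by simp
    qed
    ultimately obtain k0 t m where "map d [7..<n + 1] = replicate k0 3 @ replicate t 2 @ replicate m 1"
      using small_list by blast
    then have "\<pi> = seq_list (d 1) (d 2) (d 3) (k0 + 3) t m"
      unfolding \<pi>6 d456 by (simp add: seq_list_def eval_nat_numeral)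
    then obtain k where k: "3 \<le> k" and sl: "\<pi> = seq_list (d 1) (d 2) (d 3) k t m" by (metis le_add2)
    have nk: "n = k + t + m + 3" using arg_cong[OF sl, of length] len by (simp add: seq_list_def)
    have d3: "3 \<le> d 3" using ord lin by linarith
    have "graphical (seq (d 1) (d 2) (d 3) k t m)" using gr unfolding sl mset_seq_list .
    then have ev: "even (d 1 + d 2 + d 3 + k + m)" by (rule graphical_seq)
    have pg: "potentially_graphic K6_minus_C6 \<pi> \<longleftrightarrow> good (d 1) (d 2) (d 3) k t m"
      using potentially_graphic_pot[of \<pi>] mset_seq_list[of "d 1" "d 2" "d 3" k t m, folded sl]
        good_imp_pot pot_imp_good[OF _ ord(1,2) d3] by metis
    have one: "d j = 1 \<longleftrightarrow> 3 + k + t < j" if "4 \<le> j" "j \<le> n" for j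
    proof -
      have "d j = seq_list (d 1) (d 2) (d 3) k t m ! (j - 1)" using nth[of j] that sl by simp
      then show ?thesis using that nk by (auto simp: seq_list_def nth_append nth_Cons' split: if_splits)
    qed
    have one4: "d (n - i + 3) = 1 \<longleftrightarrow> 3 + k + t < n - i + 3" if "i \<in> {3..n - 4}" for i
      using that by (intro one) auto
    have one5: "d (n - i + 4) = 1 \<longleftrightarrow> 3 + k + t < n - i + 4" if "i \<in> {4..n - 3}" for i
      using that by (intro one) auto
    have six: "\<pi> = [d 1, d 2, d 3] @ replicate k' 3 @ replicate t' 2 @ replicate (n - 3 - k' - t') 1 \<longleftrightarrow> k' = k \<and> t' = t"
      for k' t'
      using seq_list_eq_iff[of "d 1" "d 2" "d 3" k t m "d 1" "d 2" "d 3" k' t' "n - 3 - k' - t'"] sl nk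
      by (auto simp: seq_list_def)
    have seven: "d 1 + d 2 \<le> n + t' + 2"
      if "good (d 1) (d 2) (d 3) k t m" "\<pi> = [d 1, d 2] @ replicate 4 3 @ replicate t' 2 @ replicate (n - 6 - t') 1" for t'
    proof -
      have "seq_list (d 1) (d 2) (d 3) k t m = seq_list (d 1) (d 2) 3 3 t' (n - 6 - t')"
        using that(2) unfolding sl[symmetric] by (simp add: seq_list_def eval_nat_numeral)
      then have e: "d 3 = 3" "k = 3" "t = t'" unfolding seq_list_eq_iff by auto
      \<comment> \<open>Equality would need \<open>d 3 \<ge> 4\<close>. Without it the bound drops
        by one, to \<open>n + t' + 2\<close> for \<open>k = 3\<close>.\<close>
      have "d 1 + d 2 \<le> 2 * k + 2 * t + m + 3" "d 1 + d 2 \<noteq> 2 * k + 2 * t + m + 3"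
        using that(1) e by (auto simp: good_def lin_def)
      then show ?thesis using e nk by simp
    qed
    have eight: "\<pi> \<noteq> [n - i, k', t'] @ replicate t' 3 @ replicate (k' - i - t' - 1) 2 @ replicate (n + i - 2 - k') 1"
      if g: "good (d 1) (d 2) (d 3) k t m" and i: "i \<in> {1..(n - t' - 1) div 2}" "k' \<in> {i + t' + 1..n - i}" "t' \<in> {4..k' - i - 1}" for i k' t'
    proof
      assume "\<pi> = [n - i, k', t'] @ replicate t' 3 @ replicate (k' - i - t' - 1) 2 @ replicate (n + i - 2 - k') 1"
      then have "seq_list (d 1) (d 2) (d 3) k t m = seq_list (n - i) k' t' t' (k' - i - t' - 1) (n + i - 2 - k')"
        unfolding sl[symmetric] by (simp add: seq_list_def)
      then have e: "d 1 = n - i" "d 2 = k'" "k = t'" "t = k' - i - t' - 1" "m = n + i - 2 - k'"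
        unfolding seq_list_eq_iff by auto
      \<comment> \<open>In this family \<open>d 1 + d 2\<close> is
        \<open>2 * k + 2 * t + m + 4\<close>, one more than the bound.\<close>
      have "d 1 + d 2 \<le> 2 * k + 2 * t + m + 3" using g by (auto simp: good_def lin_def)
      moreover have "t + i + t' + 1 = k'" "d 1 + i = n" using e(1,4) i(2) by auto
      ultimately show False using e(2,3) nk by linarith
    qed
    have nine: "\<pi> \<in> ?A \<longleftrightarrow> sporadic (d 1) (d 2) (d 3) k t m"
      unfolding sl using nk by (intro sporadic_seq_lists) simp
    have two: "(\<forall>i \<in> {1, 2}. d 1 = n - i \<longrightarrow> 4 \<le> d (4 - i)) \<longleftrightarrow> (d 1 = n - 1 \<longrightarrow> 4 \<le> d 3) \<and> (d 1 = n - 2 \<longrightarrow> 4 \<le> d 2)"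
      by simp
    have a: "d 1 \<le> n - 1" using less by simp
    note iff = good_iff_conditions[OF nk k ord(1,2) d3 ev a]
    have n4: "\<not> 4 \<le> d 4" using lin by simp
    have i4: "(\<forall>i \<in> {3..n - 4}. d 1 + d 2 = 2 * n - i \<and> d (n - i + 3) = 1 \<longrightarrow> d 4 \<ge> 4) \<longleftrightarrow>
        (\<forall>i \<in> {3..n - 4}. d 1 + d 2 = 2 * n - i \<longrightarrow> n - i + 3 \<le> 3 + k + t)"
      using one4 n4 by (intro ball_cong refl) auto
    have i5: "(\<forall>i \<in> {4..n - 3}. d 1 + d 2 = 2 * n - i \<and> d (n - i + 4) = 1 \<longrightarrow> d 3 \<ge> 4) \<longleftrightarrow>
        (\<forall>i \<in> {4..n - 3}. d 1 + d 2 = 2 * n - i \<longrightarrow> 3 + k + t < n - i + 4 \<longrightarrow> 4 \<le> d 3)"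
      using one5 by (intro ball_cong refl) auto
    show ?thesis
      unfolding pg
    proof (intro iffI conjI)
      assume g: "good (d 1) (d 2) (d 3) k t m"
      note R = iff[THEN iffD1, OF g]
      show "3 \<le> d 6" using lin by blast
      show "\<forall>i \<in> {1, 2}. d 1 = n - i \<longrightarrow> 4 \<le> d (4 - i)" using R two by blast
      show "d 2 = n - 1 \<longrightarrow> 4 \<le> d 4" using R by blast
      show "\<forall>i \<in> {3..n - 4}. d 1 + d 2 = 2 * n - i \<and> d (n - i + 3) = 1 \<longrightarrow> d 4 \<ge> 4"
        unfolding i4 using R by blast
      show "\<forall>i \<in> {4..n - 3}. d 1 + d 2 = 2 * n - i \<and> d (n - i + 4) = 1 \<longrightarrow> d 3 \<ge> 4"
        unfolding i5 using R by blast
      show "\<forall>k t. \<pi> = [d 1, d 2, d 3] @ replicate k 3 @ replicate t 2 @ replicate (n - 3 - k - t) 1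
          \<longrightarrow> d 1 + d 2 + d 3 \<le> n + 2 * k + t + 1"
        unfolding six using R by blast
      show "\<forall>t. \<pi> = [d 1, d 2] @ replicate 4 3 @ replicate t 2 @ replicate (n - 6 - t) 1
          \<longrightarrow> d 1 + d 2 \<le> n + t + 2"
        using seven[OF g] by blast
      show "\<forall>i k t. i \<in> {1..(n - t - 1) div 2} \<and> k \<in> {i + t + 1..n - i} \<and> t \<in> {4..k - i - 1}
          \<longrightarrow> \<pi> \<noteq> [n - i, k, t] @ replicate t 3 @ replicate (k - i - t - 1) 2
                 @ replicate (n + i - 2 - k) 1"
        using eight[OF g] by blast
      show "\<pi> \<notin> ?A" unfolding nine using R by blast
    next
      assume R: "3 \<le> d 6 \<and> (\<forall>i \<in> {1, 2}. d 1 = n - i \<longrightarrow> 4 \<le> d (4 - i)) \<and>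
        (d 2 = n - 1 \<longrightarrow> 4 \<le> d 4) \<and>
        (\<forall>i \<in> {3..n - 4}. d 1 + d 2 = 2 * n - i \<and> d (n - i + 3) = 1 \<longrightarrow> d 4 \<ge> 4) \<and>
        (\<forall>i \<in> {4..n - 3}. d 1 + d 2 = 2 * n - i \<and> d (n - i + 4) = 1 \<longrightarrow> d 3 \<ge> 4) \<and>
        (\<forall>k t. \<pi> = [d 1, d 2, d 3] @ replicate k 3 @ replicate t 2 @ replicate (n - 3 - k - t) 1
          \<longrightarrow> d 1 + d 2 + d 3 \<le> n + 2 * k + t + 1) \<and>
        (\<forall>t. \<pi> = [d 1, d 2] @ replicate 4 3 @ replicate t 2 @ replicate (n - 6 - t) 1
          \<longrightarrow> d 1 + d 2 \<le> n + t + 2) \<and>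
        (\<forall>i k t. i \<in> {1..(n - t - 1) div 2} \<and> k \<in> {i + t + 1..n - i} \<and> t \<in> {4..k - i - 1}
          \<longrightarrow> \<pi> \<noteq> [n - i, k, t] @ replicate t 3 @ replicate (k - i - t - 1) 2
                 @ replicate (n + i - 2 - k) 1) \<and>
        \<pi> \<notin> ?A"
      show "good (d 1) (d 2) (d 3) k t m"
        unfolding iff using R unfolding two i4 i5 six nine using n4 by blast
    qed
  qed
qed

end
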